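(* Let $3/4<r<1$. The fixed points $v_1^+$ and $v_1^-$ are asymptotically stable in $V_H^{2r}$.
   Context: Consider $u_t-u_{xx}\in H_0(u)$ for $x\in(0,1)$, $t>0$, with $u(0,t)=u(1,t)=0$, $u(x,0)=u_0(x)$, where $H_0(u)=\{-1\}$ if $u<0$, $H_0(0)=[-1,1]$, $H_0(u)=\{1\}$ if $u>0$. A strong solution with initial datum $u_0\in L^2(0,1)$ is $u\in C([0,\infty),L^2(0,1))$ with $u(0)=u_0$, absolutely continuous on every $[T_1,T_2]\subset(0,\infty)$, with $u(t)\in H^2(0,1)\cap H_0^1(0,1)$ for a.a. $t$, and such that there is $g\in L^2_{loc}(0,\infty;L^2(0,1))$ (square integrable on $(0,T)$ for each $T>0$) with $g(t)(x)\in H_0(u(t)(x))$ for a.a. $x\in(0,1)$, for a.a. $t$, and $\frac{du}{dt}(t)-u_{xx}(t)=g(t)$ for a.a. $t>0$. $v_1^+(x)=-\frac{x^2}{2}+\frac x2$ and $v_1^-=-v_1^+$ are fixed points (constant-in-time strong solutions). $A_H u=-u_{xx}$ in $L^2(0,1)$ with domain $H^2(0,1)\cap H_0^1(0,1)$; $V_H^{2r}=D(A_H^r)$ with norm $\|A_H^r u\|_{L^2}$. A fixed point $v$ is stable in $V_H^{2r}$ if for every $\varepsilon>0$ there is $\gamma>0$ such that every strong solution $u$ with $u(0)\in V_H^{2r}$ and $\|u(0)-v\|_{V_H^{2r}}\le\gamma$ satisfies $\|u(t)-v\|_{V_H^{2r}}\le\varepsilon$ for all $t\ge0$. It is asymptotically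 stable in $V_H^{2r}$ if it is stable and there is $\gamma_0>0$ such that every strong solution $u$ with $u(0)\in V_H^{2r}$ and $\|u(0)-v\|_{V_H^{2r}}\le\gamma_0$ satisfies $\|u(t)-v\|_{V_H^{2r}}\to0$ as $t\to+\infty$. *)

theory Defs
  imports "HOL-Analysis.Analysis"
begin

abbreviation unit_leb :: "real measure"
  where "unit_leb \<equiv> lebesgue_on {0<..<1}"

definition sq_int :: "(real \<Rightarrow> real) \<Rightarrow> bool"
  where "sq_int f \<longleftrightarrow> f \<in> borel_measurable unit_leb \<and> integrable unit_leb (\<lambda>x. (f x)\<^sup>2)"

definition eq_L2 :: "(real \<Rightarrow> real) \<Rightarrow> (real \<Rightarrow> real) \<Rightarrow> bool"
  where "eq_L2 f g \<longleftrightarrow> sq_int f \<and> sq_int g \<and> (AE x in unit_leb. f x = g x)"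

lemma sq_int_mult:
  assumes "sq_int f" "sq_int g"
  shows "integrable unit_leb (\<lambda>x. f x * g x)"
proof (rule Bochner_Integration.integrable_bound)
  show "integrable unit_leb (\<lambda>x. (f x)\<^sup>2 + (g x)\<^sup>2)"
    using assms unfolding sq_int_def by auto
  show "(\<lambda>x. f x * g x) \<in> borel_measurable unit_leb"
    using assms unfolding sq_int_def by (intro borel_measurable_times) auto
  have "\<bar>a * b\<bar> \<le> a\<^sup>2 + b\<^sup>2" for a b :: real
  proof -
    have "2 * (\<bar>a\<bar> * \<bar>b\<bar>) \<le> a\<^sup>2 + b\<^sup>2"
      using sum_squares_bound[of "\<bar>a\<bar>" "\<bar>b\<bar>"] by simp
    moreover have "0 \<le> \<bar>a\<bar> * \<bar>b\<bar>" by simp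
    ultimately show ?thesis unfolding abs_mult by linarith
  qed
  then show "AE x in unit_leb. norm (f x * g x) \<le> norm ((f x)\<^sup>2 + (g x)\<^sup>2)"
    by (simp add: abs_mult)
qed

lemma sq_int_zero: "sq_int (\<lambda>_. 0)"
  by (simp add: sq_int_def)

lemma sq_int_add:
  assumes "sq_int f" "sq_int g"
  shows "sq_int (\<lambda>x. f x + g x)"
proof -
  have "integrable unit_leb (\<lambda>x. (f x)\<^sup>2 + (g x)\<^sup>2 + 2 * (f x * g x))"
    using assms sq_int_mult[OF assms] unfolding sq_int_def by auto
  moreover have "f \<in> borel_measurable unit_leb" "g \<in> borel_measurable unit_leb"
    using assms unfolding sq_int_def by auto
  ultimately show ?thesis
    unfolding sq_int_def by (auto simp: power2_sum mult.assoc)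
qed

lemma sq_int_scale: "sq_int f \<Longrightarrow> sq_int (\<lambda>x. c * f x)"
  unfolding sq_int_def by (auto simp: power_mult_distrib)

lemma sq_int_uminus: "sq_int f \<Longrightarrow> sq_int (\<lambda>x. - f x)"
  using sq_int_scale[of f "-1"] by simp

lemma sq_int_diff: "sq_int f \<Longrightarrow> sq_int g \<Longrightarrow> sq_int (\<lambda>x. f x - g x)"
  using sq_int_add[of f "\<lambda>x. - g x"] sq_int_uminus[of g] by simp

lemma sq_int_continuous:
  assumes "continuous_on {0..1} f"
  shows "sq_int f"
proof -
  have "set_integrable lebesgue {0..1} (\<lambda>x. (f x)\<^sup>2)"
    using assms by (intro absolutely_integrable_continuous_real continuous_intros)
  then have "set_integrable lebesgue {0<..<1} (\<lambda>x. (f x)\<^sup>2)"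
    by (rule set_integrable_subset) auto
  then have "integrable unit_leb (\<lambda>x. (f x)\<^sup>2)"
    by (simp add: integrable_restrict_space set_integrable_def)
  moreover have "f \<in> borel_measurable unit_leb"
    using assms
    by (intro continuous_imp_measurable_on_sets_lebesgue) (auto elim: continuous_on_subset)
  ultimately show ?thesis by (simp add: sq_int_def)
qed

quotient_type l2 = "real \<Rightarrow> real" / partial: eq_L2
proof (rule part_equivpI)
  show "\<exists>f. eq_L2 f f"
    using sq_int_zero unfolding eq_L2_def by auto
  show "symp eq_L2"
    unfolding symp_def eq_L2_def by (auto simp: eq_commute)
  show "transp eq_L2"
  proof (rule transpI)
    fix f g h assume "eq_L2 f g" "eq_L2 g h"
    then show "eq_L2 f h"
      unfolding eq_L2_def by (auto elim: eventually_elim2)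
  qed
qed

text \<open>\<open>abs_l2 f\<close> is the class of the square integrable function \<open>f\<close>;
  \<open>rep_l2 u\<close> is some member of the class \<open>u\<close>, so its values are only meaningful almost everywhere.\<close>

instantiation l2 :: real_vector
begin

lift_definition zero_l2 :: l2 is "\<lambda>_. 0"
  by (simp add: eq_L2_def sq_int_zero)

lift_definition plus_l2 :: "l2 \<Rightarrow> l2 \<Rightarrow> l2" is "\<lambda>f g x. f x + g x"
  unfolding eq_L2_def by (auto intro: sq_int_add)

lift_definition uminus_l2 :: "l2 \<Rightarrow> l2" is "\<lambda>f x. - f x"
  unfolding eq_L2_def by (auto intro: sq_int_uminus)

lift_definition minus_l2 :: "l2 \<Rightarrow> l2 \<Rightarrow> l2" is "\<lambda>f g x. f x - g x"
  unfolding eq_L2_def by (auto intro: sq_int_diff)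

lift_definition scaleR_l2 :: "real \<Rightarrow> l2 \<Rightarrow> l2" is "\<lambda>c f x. c * f x"
  unfolding eq_L2_def by (auto intro: sq_int_scale)

instance
proof
  fix a b :: real and u v w :: l2
  show "u + v + w = u + (v + w)"
    by transfer (auto simp: eq_L2_def add.assoc intro!: sq_int_add)
  show "u + v = v + u"
    by transfer (auto simp: eq_L2_def add.commute intro!: sq_int_add)
  show "0 + u = u"
    by transfer (auto simp: eq_L2_def)
  show "- u + u = 0"
    by transfer (auto simp: eq_L2_def sq_int_zero)
  show "u - v = u + - v"
    by transfer (auto simp: eq_L2_def intro!: sq_int_diff)
  show "a *\<^sub>R (u + v) = a *\<^sub>R u + a *\<^sub>R v"
    by transfer (auto simp: eq_L2_def distrib_left intro!: sq_int_add sq_int_scale)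
  show "(a + b) *\<^sub>R u = a *\<^sub>R u + b *\<^sub>R u"
    by transfer (auto simp: eq_L2_def distrib_right intro!: sq_int_add sq_int_scale)
  show "a *\<^sub>R b *\<^sub>R u = (a * b) *\<^sub>R u"
    by transfer (auto simp: eq_L2_def mult.assoc[symmetric] intro!: sq_int_scale)
  show "1 *\<^sub>R u = u"
    by transfer (auto simp: eq_L2_def)
qed

end

instantiation l2 :: real_inner
begin

lift_definition inner_l2 :: "l2 \<Rightarrow> l2 \<Rightarrow> real" is "\<lambda>f g. LINT x|unit_leb. f x * g x"
proof -
  fix f f' g g' assume "eq_L2 f f'" "eq_L2 g g'"
  then show "(LINT x|unit_leb. f x * g x) = (LINT x|unit_leb. f' x * g' x)"
    unfolding eq_L2_def sq_int_def by (intro integral_cong_AE) auto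
qed

definition norm_l2 :: "l2 \<Rightarrow> real"
  where "norm_l2 u = sqrt (u \<bullet> u)"

definition dist_l2 :: "l2 \<Rightarrow> l2 \<Rightarrow> real"
  where "dist_l2 u v = norm (u - v)"

definition sgn_l2 :: "l2 \<Rightarrow> l2"
  where "sgn_l2 u = u /\<^sub>R norm u"

definition uniformity_l2 :: "(l2 \<times> l2) filter"
  where "uniformity_l2 = (INF e\<in>{0<..}. principal {(u, v). dist u v < e})"

definition open_l2 :: "l2 set \<Rightarrow> bool"
  where "open_l2 U \<longleftrightarrow> (\<forall>u\<in>U. \<forall>\<^sub>F (u', v) in uniformity. u' = u \<longrightarrow> v \<in> U)"

instance
proof
  fix a :: real and u v w :: l2 and U :: "l2 set"
  show "dist u v = norm (u - v)"
    by (rule dist_l2_def)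
  show "sgn u = u /\<^sub>R norm u"
    by (rule sgn_l2_def)
  show "(uniformity :: (l2 \<times> l2) filter) = (INF e\<in>{0<..}. principal {(u, v). dist u v < e})"
    by (rule uniformity_l2_def)
  show "open U \<longleftrightarrow> (\<forall>u\<in>U. \<forall>\<^sub>F (u', v) in uniformity. u' = u \<longrightarrow> v \<in> U)"
    by (rule open_l2_def)
  show "u \<bullet> v = v \<bullet> u"
    by transfer (simp add: mult.commute)
  show "(u + v) \<bullet> w = u \<bullet> w + v \<bullet> w"
  proof transfer
    fix f g h assume "eq_L2 f f" "eq_L2 g g" "eq_L2 h h"
    then have "sq_int f" "sq_int g" "sq_int h" by (auto simp: eq_L2_def)
    then show "(LINT x|unit_leb. (f x + g x) * h x)
        = (LINT x|unit_leb. f x * h x) + (LINT x|unit_leb. g x * h x)"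
      by (simp add: distrib_right sq_int_mult)
  qed
  show "(a *\<^sub>R u) \<bullet> v = a * (u \<bullet> v)"
    by transfer (simp add: mult.assoc)
  show "0 \<le> u \<bullet> u"
    by transfer simp
  show "u \<bullet> u = 0 \<longleftrightarrow> u = 0"
  proof transfer
    fix f assume "eq_L2 f f"
    then have f: "sq_int f" by (simp add: eq_L2_def)
    have "(LINT x|unit_leb. f x * f x) = 0 \<longleftrightarrow> (AE x in unit_leb. f x * f x = 0)"
      using sq_int_mult[OF f f] by (intro integral_nonneg_eq_0_iff_AE) auto
    then show "(LINT x|unit_leb. f x * f x) = 0 \<longleftrightarrow> eq_L2 f (\<lambda>_. 0)"
      using f by (simp add: eq_L2_def sq_int_zero)
  qed
  show "norm u = sqrt (u \<bullet> u)"
    by (rule norm_l2_def)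
qed

end

definition test_fun :: "(real \<Rightarrow> real) \<Rightarrow> bool"
  where "test_fun \<phi> \<longleftrightarrow>
    (\<forall>n. (deriv ^^ n) \<phi> differentiable_on UNIV) \<and> closure {x. \<phi> x \<noteq> 0} \<subseteq> {0<..<1}"

definition weak_deriv :: "l2 \<Rightarrow> l2 \<Rightarrow> bool"
  where "weak_deriv u w \<longleftrightarrow>
    (\<forall>\<phi>. test_fun \<phi> \<longrightarrow>
      (LINT x|unit_leb. rep_l2 u x * deriv \<phi> x) = - (LINT x|unit_leb. rep_l2 w x * \<phi> x))"

definition H2 :: "l2 set"
  where "H2 = {u. \<exists>w z. weak_deriv u w \<and> weak_deriv w z}"

text \<open>The closure of the test functions in the norm of $H^1(0,1)$.\<close>

definition H10 :: "l2 set"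
  where "H10 = {u. \<exists>w \<phi>. weak_deriv u w \<and> (\<forall>n. test_fun (\<phi> n)) \<and>
    (\<lambda>n. abs_l2 (\<phi> n)) \<longlonglongrightarrow> u \<and> (\<lambda>n. abs_l2 (deriv (\<phi> n))) \<longlonglongrightarrow> w}"

text \<open>The graph of the operator: \<open>A_H u f\<close> says that \<open>u\<close> lies in the domain
  $H^2(0,1) \cap H_0^1(0,1)$ and $f = -u_{xx}$.\<close>

definition A_H :: "l2 \<Rightarrow> l2 \<Rightarrow> bool"
  where "A_H u f \<longleftrightarrow> u \<in> H2 \<inter> H10 \<and> (\<exists>w. weak_deriv u w \<and> weak_deriv w (- f))"

definition eigenbasis ::
    "('a::real_inner \<Rightarrow> 'a \<Rightarrow> bool) \<Rightarrow> (nat \<Rightarrow> 'a) \<Rightarrow> (nat \<Rightarrow> real) \<Rightarrow> bool"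
  where "eigenbasis A e \<mu> \<longleftrightarrow>
    (\<forall>j k. e j \<bullet> e k = (if j = k then 1 else 0)) \<and> closure (span (range e)) = UNIV \<and>
    (\<forall>k. 0 < \<mu> k \<and> A (e k) (\<mu> k *\<^sub>R e k))"

text \<open>The graph of $A^r$ for a positive self-adjoint operator \<open>A\<close> with compact resolvent:
  $A^r u = \sum_k \mu_k^r \langle u, e_k\rangle e_k$, with domain the set of those \<open>u\<close> for which the
  series converges. By self-adjointness the sum does not depend on the eigenbasis. For \<open>A_H\<close> the
  functions $\sqrt 2 \sin(k \pi x)$ with eigenvalues $(k\pi)^2$, $k \ge 1$, form an eigenbasis.\<close>

definition frac_power ::
    "('a::real_inner \<Rightarrow> 'a \<Rightarrow> bool) \<Rightarrow> real \<Rightarrow> 'a \<Rightarrow> 'a \<Rightarrow> bool"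
  where "frac_power A r u w \<longleftrightarrow>
    (\<exists>e \<mu>. eigenbasis A e \<mu> \<and> (\<lambda>k. (\<mu> k powr r * (u \<bullet> e k)) *\<^sub>R e k) sums w)"

text \<open>\<open>V_H r\<close> and \<open>V_norm r\<close> are the space $V_H^{2r} = D(A_H^r)$ and its norm.\<close>

definition V_H :: "real \<Rightarrow> l2 set"
  where "V_H r = {u. \<exists>w. frac_power A_H r u w}"

definition V_norm :: "real \<Rightarrow> l2 \<Rightarrow> real"
  where "V_norm r u = norm (THE w. frac_power A_H r u w)"

definition H0 :: "real \<Rightarrow> real set"
  where "H0 s = (if s < 0 then {-1} else if s = 0 then {-1..1} else {1})"

definition abs_cont_on :: "real set \<Rightarrow> (real \<Rightarrow> 'a::metric_space) \<Rightarrow> bool"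
  where "abs_cont_on S u \<longleftrightarrow>
    (\<forall>\<epsilon>>0. \<exists>\<delta>>0. \<forall>(n::nat) a b.
      (\<forall>i<n. a i \<le> b i \<and> {a i..b i} \<subseteq> S) \<and>
      disjoint_family_on (\<lambda>i. {a i<..<b i}) {..<n} \<and> (\<Sum>i<n. b i - a i) < \<delta> \<longrightarrow>
      (\<Sum>i<n. dist (u (a i)) (u (b i))) < \<epsilon>)"

text \<open>Since $L^2(0,1)$ is separable, Borel measurability of \<open>g\<close> below is the same as strong
  measurability.\<close>

definition strong_solution :: "l2 \<Rightarrow> (real \<Rightarrow> l2) \<Rightarrow> bool"
  where "strong_solution u0 u \<longleftrightarrow>
    continuous_on {0..} u \<and> u 0 = u0 \<and>
    (\<forall>T1 T2. 0 < T1 \<and> T1 < T2 \<longrightarrow> abs_cont_on {T1..T2} u) \<and>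
    (AE t in lebesgue_on {0<..}. u t \<in> H2 \<inter> H10) \<and>
    (\<exists>g :: real \<Rightarrow> l2.
      (\<forall>T>0. g \<in> borel_measurable (lebesgue_on {0<..<T}) \<and>
             integrable (lebesgue_on {0<..<T}) (\<lambda>t. (norm (g t))\<^sup>2)) \<and>
      (AE t in lebesgue_on {0<..}. AE x in unit_leb. rep_l2 (g t) x \<in> H0 (rep_l2 (u t) x)) \<and>
      (AE t in lebesgue_on {0<..}. \<exists>u' f.
        (u has_vector_derivative u') (at t) \<and> A_H (u t) f \<and> u' + f = g t))"

definition fixed_point :: "l2 \<Rightarrow> bool"
  where "fixed_point v \<longleftrightarrow> strong_solution v (\<lambda>_. v)"

definition v1_plus :: l2
  where "v1_plus = abs_l2 (\<lambda>x. - (x\<^sup>2 / 2) + x / 2)"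

definition v1_minus :: l2
  where "v1_minus = - v1_plus"

text \<open>\<open>V_norm r w\<close> is only meaningful for \<open>w \<in> V_H r\<close>, hence the membership conditions on
  \<open>u t - v\<close>.\<close>

definition stable_in_V :: "real \<Rightarrow> l2 \<Rightarrow> bool"
  where "stable_in_V r v \<longleftrightarrow>
    fixed_point v \<and> v \<in> V_H r \<and>
    (\<forall>\<epsilon>>0. \<exists>\<gamma>>0. \<forall>u. strong_solution (u 0) u \<and> u 0 \<in> V_H r \<and> V_norm r (u 0 - v) \<le> \<gamma> \<longrightarrow>
      (\<forall>t\<ge>0. u t - v \<in> V_H r \<and> V_norm r (u t - v) \<le> \<epsilon>))"

definition asymp_stable_in_V :: "real \<Rightarrow> l2 \<Rightarrow> bool"
  where "asymp_stable_in_V r v \<longleftrightarrow>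
    stable_in_V r v \<and>
    (\<exists>\<gamma>0>0. \<forall>u. strong_solution (u 0) u \<and> u 0 \<in> V_H r \<and> V_norm r (u 0 - v) \<le> \<gamma>0 \<longrightarrow>
      (\<forall>t\<ge>0. u t - v \<in> V_H r) \<and> ((\<lambda>t. V_norm r (u t - v)) \<longlongrightarrow> 0) at_top)"

end

theory Submission
  imports Defs
begin

text \<open>
  Write \<open>h = u(0) - v\<close> with \<open>v = v_1\<^sup>+\<close>, and let \<open>p_N(t) = v + (\<Sum>k<N. e\<^bsup>-\<mu>\<^sub>k t\<^esup> h\<^sub>k e\<^sub>k)\<close> be the truncated solution of the
  linear equation with right-hand side \<open>1\<close>. For \<open>r > 3/4\<close> Cauchy--Schwarz bounds \<open>\<Sum>k. \<surd>\<mu>\<^sub>k \<bar>h\<^sub>k\<bar>\<close> by the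
  \<open>V\<^sup>2\<^sup>r\<close>-norm of \<open>h\<close>, so if this norm is small then \<open>p_N(t)(x) \<ge> x(1 - x)/4\<close> for all \<open>N\<close> and \<open>t\<close>.
  Solutions of the inclusion need not be unique, but here the difference \<open>z = u - p_N\<close> solves
  \<open>z' + Az = g - 1\<close>, where \<open>g - 1\<close> has values in \<open>[-2, 0]\<close> and vanishes unless \<open>u \<le> 0\<close>, in which case
  \<open>\<bar>z\<bar> \<ge> x(1 - x)/4\<close>. Together with the pointwise bounds \<open>z(x)\<^sup>2 \<le> min x (1 - x) \<langle>Az, z\<rangle>\<close> this
  gives \<open>\<langle>g - 1, z\<rangle> \<le> \<langle>Az, z\<rangle> + C \<parallel>z\<parallel>\<^sup>2\<close>, and Gronwall bounds \<open>\<parallel>z(t)\<parallel>\<^sup>2\<close> by \<open>e\<^bsup>2Ct\<^esup> \<parallel>z(0)\<parallel>\<^sup>2\<close>, which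
  tends to \<open>0\<close> as \<open>N\<close> grows. Hence the coefficients of \<open>u(t) - v\<close> are \<open>e\<^bsup>-\<mu>\<^sub>k t\<^esup> h\<^sub>k\<close>, so its
  \<open>V\<^sup>2\<^sup>r\<close>-norm decays exponentially. The case of \<open>v_1\<^sup>-\<close> follows by oddness of \<open>H\<^sub>0\<close>.
\<close>

section \<open>The space $L^2(0,1)$\<close>


text \<open>The obstacle is the boundary: the parabola vanishes at 0 and 1, so closeness in the sup
  norm does not keep a function positive there, and where the sign is lost \<open>g\<close> may drop
  by 2. Since |sin(c x)| is of order c x (1 - x), a perturbation is dominated by the parabola once
  the sum of frequency times coefficient is small; Cauchy-Schwarz then asks for the sum of c^(2 -
  4r), which is finite exactly when r > 3/4. The bound r < 1 enters through the coefficients of the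
  parabola, of order k^(-3), which have to stay absolutely summable after multiplication by k^(2r).

  Positivity is known for the explicit linear flow only, while u is an arbitrary solution from the
  same datum. Hence the comparison by energy: near the boundary the jump of \<open>g\<close> is paid
  for by the Dirichlet energy, elsewhere by the L^2 norm. The flow is truncated because finite sums
  of eigenfunctions are differentiable in time and lie in the domain of \<open>A_H\<close> for every
  t, including t = 0; the price is an initial error that vanishes as N grows.\<close>

lemma sq_int_rep_l2 [simp]: "sq_int (rep_l2 u)"
  using Quotient3_rep_reflp[OF Quotient3_l2, of u] by (simp add: eq_L2_def)

lemma abs_rep_l2 [simp]: "abs_l2 (rep_l2 u) = u"
  by (rule Quotient3_abs_rep[OF Quotient3_l2])

lemma abs_l2_eq_iff:
  assumes "sq_int f" "sq_int g"
  shows "abs_l2 f = abs_l2 g \<longleftrightarrow> (AE x in unit_leb. f x = g x)"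
  using Quotient3_rel[OF Quotient3_l2, of f g] assms by (auto simp: eq_L2_def)

lemma rep_abs_l2: "sq_int f \<Longrightarrow> AE x in unit_leb. rep_l2 (abs_l2 f) x = f x"
  using abs_l2_eq_iff[of "rep_l2 (abs_l2 f)" f] by simp

lemma borel_measurable_rep_l2 [measurable]: "rep_l2 u \<in> borel_measurable unit_leb"
  using sq_int_rep_l2[of u] unfolding sq_int_def by blast

lemma inner_abs_l2:
  "sq_int f \<Longrightarrow> sq_int g \<Longrightarrow> abs_l2 f \<bullet> abs_l2 g = (LINT x|unit_leb. f x * g x)"
  by (rule inner_l2.abs_eq) (auto simp: eq_L2_def)

lemma inner_l2_rep: "u \<bullet> v = (LINT x|unit_leb. rep_l2 u x * rep_l2 v x)"
  using inner_abs_l2[of "rep_l2 u" "rep_l2 v"] by simp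

lemma inner_l2_rep_abs:
  "sq_int g \<Longrightarrow> u \<bullet> abs_l2 g = (LINT x|unit_leb. rep_l2 u x * g x)"
  using inner_abs_l2[of "rep_l2 u" g] by simp

lemma abs_l2_add: "sq_int f \<Longrightarrow> sq_int g \<Longrightarrow> abs_l2 (\<lambda>x. f x + g x) = abs_l2 f + abs_l2 g"
  by (subst plus_l2.abs_eq) (auto simp: eq_L2_def)

lemma abs_l2_diff: "sq_int f \<Longrightarrow> sq_int g \<Longrightarrow> abs_l2 (\<lambda>x. f x - g x) = abs_l2 f - abs_l2 g"
  by (subst minus_l2.abs_eq) (auto simp: eq_L2_def)

lemma abs_l2_scale: "sq_int f \<Longrightarrow> abs_l2 (\<lambda>x. c * f x) = c *\<^sub>R abs_l2 f"
  by (subst scaleR_l2.abs_eq) (auto simp: eq_L2_def)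

lemma abs_l2_uminus: "sq_int f \<Longrightarrow> abs_l2 (\<lambda>x. - f x) = - abs_l2 f"
  by (subst uminus_l2.abs_eq) (auto simp: eq_L2_def)

lemma abs_l2_zero: "abs_l2 (\<lambda>x. 0) = 0"
  by (simp add: zero_l2.abs_eq)

lemma sq_int_sum: "(\<And>i. i \<in> I \<Longrightarrow> sq_int (f i)) \<Longrightarrow> sq_int (\<lambda>x. \<Sum>i\<in>I. f i x)"
  by (induction I rule: infinite_finite_induct) (auto intro: sq_int_add sq_int_zero)

lemma abs_l2_sum:
  "(\<And>i. i \<in> I \<Longrightarrow> sq_int (f i)) \<Longrightarrow> abs_l2 (\<lambda>x. \<Sum>i\<in>I. f i x) = (\<Sum>i\<in>I. abs_l2 (f i))"
  by (induction I rule: infinite_finite_induct) (simp_all add: abs_l2_zero abs_l2_add sq_int_sum)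

lemma rep_l2_diff: "AE x in unit_leb. rep_l2 (u - v) x = rep_l2 u x - rep_l2 v x"
  using rep_abs_l2[of "\<lambda>x. rep_l2 u x - rep_l2 v x"] by (simp add: abs_l2_diff sq_int_diff)

lemma rep_l2_uminus: "AE x in unit_leb. rep_l2 (- u) x = - rep_l2 u x"
  using rep_abs_l2[of "\<lambda>x. - rep_l2 u x"] by (simp add: abs_l2_uminus sq_int_uminus)

lemma norm_l2_squared: "(norm u)\<^sup>2 = (LINT x|unit_leb. (rep_l2 u x)\<^sup>2)"
  unfolding power2_norm_eq_inner inner_l2_rep by (simp add: power2_eq_square)

lemma norm_abs_l2_squared: "sq_int f \<Longrightarrow> (norm (abs_l2 f))\<^sup>2 = (LINT x|unit_leb. (f x)\<^sup>2)"
  unfolding power2_norm_eq_inner by (simp add: inner_abs_l2 power2_eq_square)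

lemma sq_int_bounded_by:
  assumes "f \<in> borel_measurable unit_leb" "sq_int G" "AE x in unit_leb. \<bar>f x\<bar> \<le> G x"
  shows "sq_int f"
proof -
  have "integrable unit_leb (\<lambda>x. (f x)\<^sup>2)"
  proof (rule Bochner_Integration.integrable_bound)
    show "integrable unit_leb (\<lambda>x. (G x)\<^sup>2)" using assms by (auto simp: sq_int_def)
    show "(\<lambda>x. (f x)\<^sup>2) \<in> borel_measurable unit_leb" using assms by measurable
    show "AE x in unit_leb. norm ((f x)\<^sup>2) \<le> norm ((G x)\<^sup>2)"
      using assms(3) by eventually_elim (simp add: abs_le_square_iff[symmetric])
  qed
  then show ?thesis using assms by (simp add: sq_int_def)
qed

text \<open>The majorant passes to the limit, so |f n - f0| <= 2 G, and 4 G^2 dominates the squared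
  error.\<close>

lemma l2_dominated_convergence:
  assumes f: "\<And>n. f n \<in> borel_measurable unit_leb" and f0: "f0 \<in> borel_measurable unit_leb"
    and G: "sq_int G" and lim: "AE x in unit_leb. (\<lambda>n. f n x) \<longlonglongrightarrow> f0 x"
    and bound: "\<And>n. AE x in unit_leb. \<bar>f n x\<bar> \<le> G x"
  shows "sq_int f0" "(\<lambda>n. abs_l2 (f n)) \<longlonglongrightarrow> abs_l2 f0"
proof -
  have sf: "sq_int (f n)" for n by (rule sq_int_bounded_by[OF f G bound])
  have bound_all: "AE x in unit_leb. \<forall>n. \<bar>f n x\<bar> \<le> G x"
    using bound by (simp add: AE_all_countable)
  have b0: "AE x in unit_leb. \<bar>f0 x\<bar> \<le> G x"
    using lim bound_all
  proof eventually_elim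
    case (elim x)
    then show ?case by (intro LIMSEQ_le_const2[OF tendsto_rabs]) auto
  qed
  show s0: "sq_int f0" by (rule sq_int_bounded_by[OF f0 G b0])
  have "(\<lambda>n. LINT x|unit_leb. (f n x - f0 x)\<^sup>2) \<longlonglongrightarrow> (LINT x|unit_leb. 0)"
  proof (rule integral_dominated_convergence[where w = "\<lambda>x. 4 * (G x)\<^sup>2"])
    show "integrable unit_leb (\<lambda>x. 4 * (G x)\<^sup>2)" using G by (simp add: sq_int_def)
    show "AE x in unit_leb. (\<lambda>n. (f n x - f0 x)\<^sup>2) \<longlonglongrightarrow> 0"
      using lim
    proof eventually_elim
      case (elim x)
      then have "(\<lambda>n. (f n x - f0 x)\<^sup>2) \<longlonglongrightarrow> (f0 x - f0 x)\<^sup>2" by (intro tendsto_intros)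
      then show ?case by simp
    qed
    show "AE x in unit_leb. norm ((f n x - f0 x)\<^sup>2) \<le> 4 * (G x)\<^sup>2" for n
      using bound[of n] b0
    proof eventually_elim
      case (elim x)
      then have "\<bar>f n x - f0 x\<bar> \<le> \<bar>2 * G x\<bar>" by linarith
      then have "(f n x - f0 x)\<^sup>2 \<le> (2 * G x)\<^sup>2" by (simp only: abs_le_square_iff)
      then show ?case by (simp add: power_mult_distrib)
    qed
  qed (use f f0 in measurable)
  then have "(\<lambda>n. (norm (abs_l2 (f n) - abs_l2 f0))\<^sup>2) \<longlonglongrightarrow> 0"
    by (simp add: abs_l2_diff[symmetric] sf s0 norm_abs_l2_squared sq_int_diff)
  then have "(\<lambda>n. sqrt ((norm (abs_l2 (f n) - abs_l2 f0))\<^sup>2)) \<longlonglongrightarrow> sqrt 0"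
    by (rule tendsto_real_sqrt)
  then have "(\<lambda>n. norm (abs_l2 (f n) - abs_l2 f0)) \<longlonglongrightarrow> 0" by simp
  then show "(\<lambda>n. abs_l2 (f n)) \<longlonglongrightarrow> abs_l2 f0"
    by (simp add: LIM_zero_iff tendsto_norm_zero_iff)
qed

text \<open>Norm convergence carries pointwise inequalities over only along such a subsequence; this
  is how bounds for test functions reach the elements of \<open>H10\<close>.\<close>

lemma l2_AE_subsequence:
  assumes "U \<longlonglongrightarrow> u"
  obtains r where "strict_mono (r :: nat \<Rightarrow> nat)"
    "AE x in unit_leb. (\<lambda>n. rep_l2 (U (r n)) x) \<longlonglongrightarrow> rep_l2 u x"
proof -
  have i: "integrable unit_leb (\<lambda>x. (rep_l2 (U n) x - rep_l2 u x)\<^sup>2)" for n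
    using sq_int_diff[OF sq_int_rep_l2[of "U n"] sq_int_rep_l2[of u]] unfolding sq_int_def by blast
  have "(LINT x|unit_leb. (rep_l2 (U n) x - rep_l2 u x)\<^sup>2) = (norm (U n - u))\<^sup>2" for n
    using norm_abs_l2_squared[of "\<lambda>x. rep_l2 (U n) x - rep_l2 u x"]
    by (simp add: abs_l2_diff sq_int_diff)
  moreover have "(\<lambda>n. (norm (U n - u))\<^sup>2) \<longlonglongrightarrow> 0\<^sup>2"
    using assms by (intro tendsto_intros) (simp add: LIM_zero_iff tendsto_norm_zero_iff)
  ultimately have "(\<lambda>n. LINT x|unit_leb. norm ((rep_l2 (U n) x - rep_l2 u x)\<^sup>2)) \<longlonglongrightarrow> 0"
    by simp
  from tendsto_L1_AE_subseq[OF i this] obtain r :: "nat \<Rightarrow> nat" where r: "strict_mono r"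
    "AE x in unit_leb. (\<lambda>n. (rep_l2 (U (r n)) x - rep_l2 u x)\<^sup>2) \<longlonglongrightarrow> 0" by blast
  have "AE x in unit_leb. (\<lambda>n. rep_l2 (U (r n)) x) \<longlonglongrightarrow> rep_l2 u x"
    using r(2)
  proof eventually_elim
    case (elim x)
    then have "(\<lambda>n. sqrt ((rep_l2 (U (r n)) x - rep_l2 u x)\<^sup>2)) \<longlonglongrightarrow> sqrt 0"
      by (rule tendsto_real_sqrt)
    then show ?case by (simp add: tendsto_rabs_zero_iff LIM_zero_iff)
  qed
  with r(1) show thesis by (rule that)
qed

lemma integrable_unit_continuous:
  assumes "continuous_on {0..1} (f :: real \<Rightarrow> real)"
  shows "integrable unit_leb f"
  using sq_int_mult[OF sq_int_continuous[OF assms] sq_int_continuous, of "\<lambda>x. 1"] by simp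

lemma integral_unit_FTC:
  assumes "continuous_on {0..1} f" "\<And>x. x \<in> {0..1} \<Longrightarrow> (F has_field_derivative f x) (at x)"
  shows "(LINT x|unit_leb. f x) = F 1 - F (0::real)"
proof -
  have "(f has_integral F 1 - F 0) {0..1}"
    using assms(2)
    by (intro fundamental_theorem_of_calculus)
      (auto simp: has_real_derivative_iff_has_vector_derivative[symmetric] intro: has_field_derivative_at_within)
  then have "integral {0<..<1} f = F 1 - F 0"
    using integral_open_interval_real[of 0 1 f] integral_unique by metis
  then show ?thesis
    using lebesgue_integral_eq_integral[OF integrable_unit_continuous[OF assms(1)]] by simp
qed

section \<open>Smooth functions and test functions\<close>


text \<open>The powers of 1/x are built in to make the family closed under differentiation: the
  derivative of \<open>flat n\<close> is a combination of \<open>flat (n + 2)\<close> and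
  \<open>flat (n + 1)\<close>. The classical smooth transition function is
  \<open>flat 0\<close>.\<close>

definition flat :: "nat \<Rightarrow> real \<Rightarrow> real"
  where "flat n x = (if x \<le> 0 then 0 else exp (- (1 / x)) / x ^ n)"

lemma flat_nonneg: "0 \<le> flat n x"
  by (simp add: flat_def)

lemma flat_nonpos_arg [simp]: "x \<le> 0 \<Longrightarrow> flat n x = 0"
  by (simp add: flat_def)

text \<open>One term of the exponential series at 1/x is enough: (1/x)^n / n! <= exp (1/x).\<close>

lemma flat_le_fact: "flat n x \<le> fact n"
proof (cases "x \<le> 0")
  case False
  have "(1 / x) ^ n / fact n \<le> exp (1 / x)"
    using False sum_le_suminf[OF summable_exp_generic[of "1 / x"], of "{n}"]
    by (simp add: exp_def divide_inverse mult.commute)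
  then show ?thesis
    using False by (simp add: flat_def exp_minus field_simps)
qed simp

lemma flat_0_le_1: "flat 0 x \<le> 1"
  using flat_le_fact[of 0 x] by simp

lemma flat_Suc_mult: "x * flat (Suc n) x = flat n x"
  by (simp add: flat_def)

lemma pow_pred: "0 < n \<Longrightarrow> x ^ n = x * x ^ (n - Suc 0)"
  by (cases n) auto

lemma flat_has_derivative:
  "(flat n has_field_derivative (flat (n + 2) x - real n * flat (n + 1) x)) (at x)"
proof (cases x "0::real" rule: linorder_cases)
  case less
  have "((\<lambda>x. 0) has_field_derivative 0) (at x)" by simp
  moreover have "\<forall>\<^sub>F y in nhds x. (0::real) = flat n y"
    using eventually_nhds_in_open[of "{..<0}" x] less by (auto elim!: eventually_mono)
  ultimately show ?thesis
    using less DERIV_cong_ev[OF refl, of "\<lambda>x. 0" "flat n" x 0 0] by simp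
next
  case greater
  have "((\<lambda>x. exp (- (1 / x)) / x ^ n) has_field_derivative
      (flat (n + 2) x - real n * flat (n + 1) x)) (at x)"
    using greater
    by (cases n) (auto intro!: derivative_eq_intros simp: flat_def field_simps power2_eq_square,
        metis pow_pred neq0_conv)
  moreover have "\<forall>\<^sub>F y in nhds x. exp (- (1 / y)) / y ^ n = flat n y"
    using eventually_nhds_in_open[of "{0<..}" x] greater
    by (auto elim!: eventually_mono simp: flat_def)
  ultimately show ?thesis
    using DERIV_cong_ev[OF refl, of "\<lambda>x. exp (- (1 / x)) / x ^ n" "flat n" x] by simp
next
  case equal
  \<comment> \<open>For positive h the difference quotient at 0 is
    \<open>h * flat (n + 2) h\<close>, which the factorial bound makes O(h).\<close>
  have "(\<lambda>h. flat n h / h) \<midarrow>0\<rightarrow> 0"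
  proof (rule tendsto_0_le[where K = 1 and f = "\<lambda>h. fact (n + 2) * h"])
    show "(\<lambda>h::real. fact (n + 2) * h) \<midarrow>0\<rightarrow> 0" by (auto intro!: tendsto_eq_intros)
    have "\<bar>flat n h / h\<bar> \<le> \<bar>fact (n + 2) * h\<bar>" for h
    proof (cases "h \<le> 0")
      case False
      then have "flat n h / h = h * flat (n + 2) h" by (simp add: flat_def)
      also have "\<dots> \<le> h * fact (n + 2)"
        using False flat_le_fact[of "n + 2" h] by (intro mult_left_mono) auto
      finally show ?thesis using False flat_nonneg[of n h] by (simp add: abs_mult mult.commute)
    qed simp
    then show "\<forall>\<^sub>F h in at 0. norm (flat n h / h) \<le> norm (fact (n + 2) * h) * 1"
      by simp
  qed
  then show ?thesis using equal by (simp add: DERIV_def)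
qed

lemma flat_affine_has_derivative:
  "((\<lambda>x. flat n (a * x + b)) has_field_derivative
    a * (flat (n + 2) (a * x + b) - real n * flat (n + 1) (a * x + b))) (at x)"
proof -
  have "((\<lambda>x. a * x + b) has_field_derivative a) (at x)"
    by (auto intro!: derivative_eq_intros)
  from DERIV_chain2[OF flat_has_derivative this] show ?thesis by (simp add: mult.commute)
qed

text \<open>Test functions need all iterated derivatives. A class of terms closed under
  differentiation settles this by one induction; it contains the sines, the parabola and the
  cutoffs.\<close>

inductive smooth :: "(real \<Rightarrow> real) \<Rightarrow> bool" where
  const: "smooth (\<lambda>x. c)"
| ident: "smooth (\<lambda>x. x)"
| sin: "smooth (\<lambda>x. sin (a * x))"
| cos: "smooth (\<lambda>x. cos (a * x))"
| flat: "smooth (\<lambda>x. flat n (a * x + b))"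
| add: "smooth f \<Longrightarrow> smooth g \<Longrightarrow> smooth (\<lambda>x. f x + g x)"
| mult: "smooth f \<Longrightarrow> smooth g \<Longrightarrow> smooth (\<lambda>x. f x * g x)"

lemma smooth_has_smooth_derivative:
  "smooth f \<Longrightarrow> \<exists>g. smooth g \<and> (\<forall>x. (f has_field_derivative g x) (at x))"
proof (induction rule: smooth.induct)
  case (const c)
  then show ?case by (intro exI[of _ "\<lambda>x. 0"]) (auto intro: smooth.const)
next
  case ident
  then show ?case by (intro exI[of _ "\<lambda>x. 1"]) (auto intro: smooth.const)
next
  case (sin a)
  have "smooth (\<lambda>x. a * cos (a * x))" by (intro smooth.intros)
  then show ?case
    by (intro exI[of _ "\<lambda>x. a * cos (a * x)"]) (auto intro!: derivative_eq_intros)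
next
  case (cos a)
  have "smooth (\<lambda>x. (- a) * sin (a * x))" by (intro smooth.intros)
  then show ?case
    by (intro exI[of _ "\<lambda>x. (- a) * sin (a * x)"]) (auto intro!: derivative_eq_intros)
next
  case (flat n a b)
  let ?g = "\<lambda>x. a * (flat (n + 2) (a * x + b) + (- real n) * flat (n + 1) (a * x + b))"
  have "smooth ?g" by (intro smooth.intros)
  moreover have "((\<lambda>x. flat n (a * x + b)) has_field_derivative ?g x) (at x)" for x
    using flat_affine_has_derivative[of n a b x] by simp
  ultimately show ?case by blast
next
  case (add f g)
  then show ?case by (blast intro: smooth.add DERIV_add)
next
  case (mult f g)
  then obtain f' g' where "smooth f'" "smooth g'"
    "\<And>x. (f has_field_derivative f' x) (at x)" "\<And>x. (g has_field_derivative g' x) (at x)"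
    by blast
  moreover from this have "smooth (\<lambda>x. f' x * g x + g' x * f x)"
    using mult.hyps by (intro smooth.intros)
  ultimately show ?case
    by (intro exI[of _ "\<lambda>x. f' x * g x + g' x * f x"]) (auto intro: DERIV_mult)
qed

lemma smooth_deriv: "smooth f \<Longrightarrow> smooth (deriv f)"
  and smooth_has_deriv: "smooth f \<Longrightarrow> (f has_field_derivative deriv f x) (at x)"
proof -
  assume "smooth f"
  then obtain g where g: "smooth g" "\<And>x. (f has_field_derivative g x) (at x)"
    using smooth_has_smooth_derivative by blast
  then have "deriv f = g" by (auto intro: DERIV_imp_deriv)
  with g show "smooth (deriv f)" "(f has_field_derivative deriv f x) (at x)" by auto
qed

lemma smooth_continuous_on: "smooth f \<Longrightarrow> continuous_on S f"
  by (meson DERIV_continuous_on has_field_derivative_at_within smooth_has_deriv)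

lemma smooth_funpow_deriv: "smooth f \<Longrightarrow> smooth ((deriv ^^ n) f)"
  by (induction n) (auto intro: smooth_deriv)

section \<open>Test functions and weak derivatives\<close>

lemma test_fun_smoothI:
  assumes "smooth f" "0 < a" "b < 1" "\<And>x. f x \<noteq> 0 \<Longrightarrow> a \<le> x \<and> x \<le> b"
  shows "test_fun f"
proof -
  have "(deriv ^^ n) f differentiable_on UNIV" for n
    using smooth_has_deriv[OF smooth_funpow_deriv[OF assms(1)]]
    by (meson differentiable_on_def differentiable_at_withinI real_differentiable_def)
  moreover have "closure {x. f x \<noteq> 0} \<subseteq> {a..b}"
    using assms(4) by (intro closure_minimal) auto
  ultimately show ?thesis
    using assms(2,3) by (force simp: test_fun_def)
qed

lemma test_fun_has_deriv:
  assumes "test_fun \<phi>" shows "(\<phi> has_field_derivative deriv \<phi> x) (at x)"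
proof -
  have "(deriv ^^ 0) \<phi> differentiable_on UNIV" using assms unfolding test_fun_def by blast
  then show ?thesis
    by (auto simp: differentiable_on_def DERIV_deriv_iff_real_differentiable)
qed

lemma test_fun_continuous:
  assumes "test_fun \<phi>" shows "continuous_on S \<phi>" "continuous_on S (deriv \<phi>)"
proof -
  have "(deriv ^^ 0) \<phi> differentiable_on UNIV" "(deriv ^^ 1) \<phi> differentiable_on UNIV"
    using assms unfolding test_fun_def by blast+
  then show "continuous_on S \<phi>" "continuous_on S (deriv \<phi>)"
    by (auto dest!: differentiable_imp_continuous_on elim: continuous_on_subset)
qed

lemma test_fun_boundary:
  assumes "test_fun \<phi>" shows "\<phi> 0 = 0" "\<phi> 1 = 0"
  using assms closure_subset[of "{x. \<phi> x \<noteq> 0}"] unfolding test_fun_def by fastforce+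

lemma test_fun_sq_int: "test_fun \<phi> \<Longrightarrow> sq_int \<phi>" "test_fun \<phi> \<Longrightarrow> sq_int (deriv \<phi>)"
  by (auto intro!: sq_int_continuous test_fun_continuous)

lemma smooth_sq_int: "smooth f \<Longrightarrow> sq_int f"
  by (auto intro!: sq_int_continuous smooth_continuous_on)

text \<open>In this form linear combinations and limits of weak derivatives come down to bilinearity
  and continuity of the inner product.\<close>

lemma weak_deriv_inner:
  "weak_deriv u w \<longleftrightarrow>
    (\<forall>\<phi>. test_fun \<phi> \<longrightarrow> u \<bullet> abs_l2 (deriv \<phi>) = - (w \<bullet> abs_l2 \<phi>))"
  unfolding weak_deriv_def by (auto simp: inner_l2_rep_abs test_fun_sq_int)

lemma weak_deriv_smooth:
  assumes "smooth f" shows "weak_deriv (abs_l2 f) (abs_l2 (deriv f))"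
  unfolding weak_deriv_inner
proof (intro allI impI)
  fix \<phi> assume t: "test_fun \<phi>"
  have "(LINT x|unit_leb. f x * deriv \<phi> x + deriv f x * \<phi> x) = f 1 * \<phi> 1 - f 0 * \<phi> 0"
    using assms t
    by (intro integral_unit_FTC[where F = "\<lambda>x. f x * \<phi> x"] continuous_intros
        smooth_continuous_on smooth_deriv test_fun_continuous)
      (auto intro!: derivative_eq_intros smooth_has_deriv test_fun_has_deriv)
  moreover have "\<dots> = 0" by (simp add: test_fun_boundary[OF t])
  moreover have "(LINT x|unit_leb. f x * deriv \<phi> x + deriv f x * \<phi> x)
      = (LINT x|unit_leb. f x * deriv \<phi> x) + (LINT x|unit_leb. deriv f x * \<phi> x)"
    using assms t by (intro Bochner_Integration.integral_add sq_int_mult)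
      (auto simp: smooth_sq_int test_fun_sq_int smooth_deriv)
  ultimately show "abs_l2 f \<bullet> abs_l2 (deriv \<phi>) = - (abs_l2 (deriv f) \<bullet> abs_l2 \<phi>)"
    using assms t by (simp add: inner_abs_l2 smooth_sq_int test_fun_sq_int smooth_deriv)
qed

text \<open>Both cutoff arguments have this form, with the distance to one of the two endpoints in
  place of \<open>x\<close>.\<close>

lemma filterlim_cut_arg:
  fixes x :: real
  assumes "0 < x" shows "filterlim (\<lambda>n. real (Suc n) * x - 1) at_top sequentially"
proof -
  have "filterlim (\<lambda>n. real (Suc n)) at_top sequentially"
    by (rule filterlim_compose[OF filterlim_real_sequentially filterlim_Suc])
  then have "filterlim (\<lambda>n. real (Suc n) * x) at_top sequentially"
    using assms by (intro filterlim_at_top_mult_tendsto_pos[where c = x]) auto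
  then show ?thesis
    using filterlim_tendsto_add_at_top[OF tendsto_const[of "-1"]] by simp
qed

lemma flat_0_tendsto: "(flat 0 \<longlongrightarrow> 1) at_top"
proof -
  have "((\<lambda>x::real. exp (- (1 / x))) \<longlongrightarrow> exp (- 0)) at_top"
    by (intro tendsto_intros tendsto_divide_0[OF tendsto_const] filterlim_at_top_imp_at_infinity filterlim_ident)
  moreover have "\<forall>\<^sub>F x in at_top. exp (- (1 / x)) = flat 0 x"
    using eventually_gt_at_top[of "0::real"] by eventually_elim (simp add: flat_def)
  ultimately show ?thesis by (simp add: filterlim_cong[OF refl refl])
qed

text \<open>If y = E d - 1 is a cutoff argument, d being the distance to the endpoint, then d E = y
  + 1. So this weight is d times the derivative of the cutoff, the quantity that must vanish in the
  limit.\<close>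

lemma flat_weight_tendsto: "((\<lambda>x. (x + 1) * flat 2 x) \<longlongrightarrow> 0) at_top"
proof (rule tendsto_0_le[where K = 1 and f = "\<lambda>x::real. 1 / x + (1 / x) * (1 / x)"])
  have "((\<lambda>x::real. 1 / x + (1 / x) * (1 / x)) \<longlongrightarrow> 0 + 0 * 0) at_top"
    by (intro tendsto_intros tendsto_divide_0[OF tendsto_const] filterlim_at_top_imp_at_infinity filterlim_ident)
  then show "((\<lambda>x::real. 1 / x + (1 / x) * (1 / x)) \<longlongrightarrow> 0) at_top" by simp
  show "\<forall>\<^sub>F x in at_top. norm ((x + 1) * flat 2 x) \<le> norm (1 / x + (1 / x) * (1 / x)) * 1"
    using eventually_gt_at_top[of "0::real"]
  proof eventually_elim
    case (elim x)
    have "(x + 1) * flat 2 x = (1 / x + (1 / x) * (1 / x)) * flat 0 x"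
      using elim by (simp add: flat_def field_simps power2_eq_square)
    also have "\<dots> \<le> (1 / x + (1 / x) * (1 / x)) * 1"
      using elim by (intro mult_left_mono flat_0_le_1) auto
    finally show ?case using elim flat_nonneg[of 2 x] by simp
  qed
qed

text \<open>The constant is 1! + 2!, because \<open>x * flat 2 x\<close> equals
  \<open>flat 1 x\<close>.\<close>

lemma flat_weight_le: "(x + 1) * flat 2 x \<le> 3"
proof -
  have "(x + 1) * flat 2 x = flat 1 x + flat 2 x"
    using flat_Suc_mult[of x 1] by (simp add: distrib_right numeral_2_eq_2)
  then show ?thesis using flat_le_fact[of 1 x] flat_le_fact[of 2 x] by (simp add: fact_2)
qed

lemma smooth_vanishing_bound:
  assumes "smooth f" "f 0 = 0" "f 1 = 0"
  obtains K where "0 \<le> K" "\<And>x. x \<in> {0..1} \<Longrightarrow> \<bar>deriv f x\<bar> \<le> K"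
    "\<And>x. x \<in> {0..1} \<Longrightarrow> \<bar>f x\<bar> \<le> K * x" "\<And>x. x \<in> {0..1} \<Longrightarrow> \<bar>f x\<bar> \<le> K * (1 - x)"
proof -
  have "compact (deriv f ` {0..1})"
    using assms by (intro compact_continuous_image smooth_continuous_on smooth_deriv) auto
  then obtain K where K: "\<And>x. x \<in> {0..1} \<Longrightarrow> \<bar>deriv f x\<bar> \<le> K"
    by (force dest!: compact_imp_bounded simp: bounded_iff)
  have lip: "\<bar>f y - f x\<bar> \<le> K * (y - x)" if "0 \<le> x" "x \<le> y" "y \<le> 1" for x y
  proof -
    have "norm (f y - f x) \<le> K * norm (y - x)"
      using that K assms
      by (intro field_differentiable_bound[where S = "{0..1}" and f' = "deriv f"])
        (auto intro: smooth_has_deriv has_field_derivative_at_within)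
    then show ?thesis using that by simp
  qed
  show thesis
    using lip[of 0] lip[of _ 1] assms K[of 0] K by (intro that[of K]) force+
qed

text \<open>The cutoff is $f(x) e^{-1/(x/\epsilon - 1)} e^{-1/((1-x)/\epsilon - 1)}$ with $\epsilon = 1/(n+1)$.
  The derivative of a cutoff factor is of size $1/\epsilon$, but only where $|f| = O(\epsilon)$, so dominated
  convergence applies.\<close>

lemma smooth_H10_approx:
  assumes f: "smooth f" "f 0 = 0" "f 1 = 0"
  obtains \<phi> where "\<And>n. test_fun (\<phi> n)" "(\<lambda>n. abs_l2 (\<phi> n)) \<longlonglongrightarrow> abs_l2 f"
    "(\<lambda>n. abs_l2 (deriv (\<phi> n))) \<longlonglongrightarrow> abs_l2 (deriv f)"
proof -
  obtain K where K: "0 \<le> K" "\<And>x. x \<in> {0..1} \<Longrightarrow> \<bar>deriv f x\<bar> \<le> K"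
    "\<And>x. x \<in> {0..1} \<Longrightarrow> \<bar>f x\<bar> \<le> K * x" "\<And>x. x \<in> {0..1} \<Longrightarrow> \<bar>f x\<bar> \<le> K * (1 - x)"
    by (rule smooth_vanishing_bound[OF f]) (rule that)
  define E where "E n = real (Suc n)" for n
  have E: "0 < E n" for n by (simp add: E_def)
  define F where "F n x = flat 0 (E n * x + (- 1))" for n x
  define G where "G n x = flat 0 ((- E n) * x + (E n - 1))" for n x
  define F' where "F' n x = flat 2 (E n * x + (- 1))" for n x
  define G' where "G' n x = flat 2 ((- E n) * x + (E n - 1))" for n x
  define \<phi> where "\<phi> n x = f x * F n x * G n x" for n x
  define \<psi> where "\<psi> n x = deriv f x * F n x * G n x + f x * (E n * F' n x) * G n x
    + f x * F n x * (- E n * G' n x)" for n x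
  have sF: "smooth (F n)" "smooth (G n)" "smooth (F' n)" "smooth (G' n)" for n
    unfolding F_def G_def F'_def G'_def by (rule smooth.flat)+
  have s\<phi>: "smooth (\<phi> n)" for n
    unfolding \<phi>_def by (intro smooth.mult f(1) sF)
  have dF: "(F n has_field_derivative E n * F' n x) (at x)" for n x
    using flat_affine_has_derivative[of 0 "E n" "- 1" x]
    unfolding F_def F'_def by (simp add: numeral_2_eq_2)
  have dG: "(G n has_field_derivative - E n * G' n x) (at x)" for n x
    using flat_affine_has_derivative[of 0 "- E n" "E n - 1" x]
    unfolding G_def G'_def by (simp add: numeral_2_eq_2)
  have d\<phi>: "deriv (\<phi> n) = \<psi> n" for n
  proof (intro ext DERIV_imp_deriv)
    show "(\<phi> n has_field_derivative \<psi> n x) (at x)" for x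
      unfolding \<phi>_def \<psi>_def
      using DERIV_mult[OF DERIV_mult[OF smooth_has_deriv[OF f(1)] dF[of n x]] dG[of n x]]
      by (rule DERIV_cong) (simp add: algebra_simps)
  qed
  have FG: "0 \<le> F n x" "F n x \<le> 1" "0 \<le> G n x" "G n x \<le> 1" "0 \<le> F' n x" "0 \<le> G' n x" for n x
    by (auto simp: F_def G_def F'_def G'_def flat_nonneg flat_0_le_1)
  have t: "test_fun (\<phi> n)" for n
  proof (rule test_fun_smoothI[OF s\<phi>])
    \<comment> \<open>For n = 0 the interval between these bounds is empty, and
      \<open>\<phi> 0\<close> is the zero function.\<close>
    show "0 < 1 / E n" "1 - 1 / E n < 1" using E by auto
    fix x assume "\<phi> n x \<noteq> 0"
    then have "\<not> E n * x + (- 1) \<le> 0" "\<not> (- E n) * x + (E n - 1) \<le> 0"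
      by (auto simp: \<phi>_def F_def G_def)
    then show "1 / E n \<le> x \<and> x \<le> 1 - 1 / E n"
      using E[of n] by (auto simp: field_simps)
  qed
  have b1: "\<bar>f x\<bar> * E n * F' n x \<le> K * ((E n * x + (- 1) + 1) * flat 2 (E n * x + (- 1)))"
    "\<bar>f x\<bar> * E n * G' n x
      \<le> K * (((- E n) * x + (E n - 1) + 1) * flat 2 ((- E n) * x + (E n - 1)))"
    if "x \<in> {0<..<1}" for n x
  proof -
    have "\<bar>f x\<bar> * E n * F' n x \<le> (K * x) * E n * F' n x"
      using that K(3)[of x] E[of n] FG by (intro mult_right_mono) auto
    then show "\<bar>f x\<bar> * E n * F' n x \<le> K * ((E n * x + (- 1) + 1) * flat 2 (E n * x + (- 1)))"
      by (simp add: F'_def ac_simps)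
    have "\<bar>f x\<bar> * E n * G' n x \<le> (K * (1 - x)) * E n * G' n x"
      using that K(4)[of x] E[of n] FG by (intro mult_right_mono) auto
    also have "(K * (1 - x)) * E n * G' n x
        = K * (((- E n) * x + (E n - 1) + 1) * flat 2 ((- E n) * x + (E n - 1)))"
    proof -
      have "(- E n) * x + (E n - 1) + 1 = (1 - x) * E n" by (simp add: algebra_simps)
      then show ?thesis by (simp only: G'_def mult.assoc)
    qed
    finally show "\<bar>f x\<bar> * E n * G' n x
        \<le> K * (((- E n) * x + (E n - 1) + 1) * flat 2 ((- E n) * x + (E n - 1)))" .
  qed
  have b2: "\<bar>f x\<bar> * E n * F' n x \<le> K * 3" "\<bar>f x\<bar> * E n * G' n x \<le> K * 3"
    if "x \<in> {0<..<1}" for n x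
    by (rule order_trans[OF b1(1)[OF that] mult_left_mono[OF flat_weight_le K(1)]]
        order_trans[OF b1(2)[OF that] mult_left_mono[OF flat_weight_le K(1)]])+
  have eq: "\<bar>f x * (E n * F' n x)\<bar> = \<bar>f x\<bar> * E n * F' n x"
    "\<bar>f x * (- E n * G' n x)\<bar> = \<bar>f x\<bar> * E n * G' n x" for n x
    using FG(5,6)[of n x] E[of n] by (simp_all add: abs_mult)
  have lims: "(\<lambda>n. F n x) \<longlonglongrightarrow> 1" "(\<lambda>n. G n x) \<longlonglongrightarrow> 1"
    "(\<lambda>n. f x * (E n * F' n x)) \<longlonglongrightarrow> 0" "(\<lambda>n. f x * (- E n * G' n x)) \<longlonglongrightarrow> 0"
    if x: "x \<in> {0<..<1}" for x
  proof -
    have 1: "filterlim (\<lambda>n. E n * x + (- 1)) at_top sequentially"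
      using filterlim_cut_arg[of x] x by (simp add: E_def)
    have 2: "filterlim (\<lambda>n. (- E n) * x + (E n - 1)) at_top sequentially"
      using filterlim_cut_arg[of "1 - x"] x by (simp add: E_def algebra_simps)
    show "(\<lambda>n. F n x) \<longlonglongrightarrow> 1" "(\<lambda>n. G n x) \<longlonglongrightarrow> 1"
      unfolding F_def G_def by (rule filterlim_compose[OF flat_0_tendsto] 1 2)+
    show "(\<lambda>n. f x * (E n * F' n x)) \<longlonglongrightarrow> 0"
    proof (rule tendsto_0_le[OF filterlim_compose[OF flat_weight_tendsto 1], where K = K],
        intro always_eventually allI)
      fix n
      show "norm (f x * (E n * F' n x)) \<le> norm ((E n * x + (- 1) + 1) * flat 2 (E n * x + (- 1))) * K"
        unfolding real_norm_def eq
        using b1(1)[OF x, of n] K(1) by (smt (verit) mult.commute mult_right_mono)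
    qed
    show "(\<lambda>n. f x * (- E n * G' n x)) \<longlonglongrightarrow> 0"
    proof (rule tendsto_0_le[OF filterlim_compose[OF flat_weight_tendsto 2], where K = K],
        intro always_eventually allI)
      fix n
      show "norm (f x * (- E n * G' n x)) \<le> norm (((- E n) * x + (E n - 1) + 1) * flat 2 ((- E n) * x + (E n - 1))) * K"
        unfolding real_norm_def eq
        using b1(2)[OF x, of n] K(1) by (smt (verit) mult.commute mult_right_mono)
    qed
  qed
  have meas: "g \<in> borel_measurable unit_leb" if "smooth g" for g
    using smooth_sq_int[OF that] by (simp add: sq_int_def)
  \<comment> \<open>One K comes from the derivative of \<open>f\<close>, and 3 K from each of the
    two cutoff derivatives.\<close>
  have bnd: "\<bar>\<psi> n x\<bar> \<le> 7 * K" if x: "x \<in> {0<..<1}" for n x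
  proof -
    have "\<bar>deriv f x * F n x * G n x\<bar> \<le> K * 1 * 1"
      unfolding abs_mult using K x FG by (intro mult_mono) auto
    moreover have "\<bar>f x * (E n * F' n x) * G n x\<bar> \<le> (K * 3) * 1"
      unfolding abs_mult[of _ "G n x"] eq
      by (rule mult_mono) (use b2(1)[OF x, of n] FG(3,4)[of n x] K(1) in auto)
    moreover have "\<bar>f x * F n x * (- E n * G' n x)\<bar> = F n x * (\<bar>f x\<bar> * E n * G' n x)"
      using FG[of n x] E[of n] by (simp add: abs_mult)
    moreover have "F n x * (\<bar>f x\<bar> * E n * G' n x) \<le> 1 * (K * 3)"
      by (rule mult_mono) (use b2(2)[OF x, of n] FG[of n x] E[of n] K(1) in auto)
    ultimately show ?thesis unfolding \<psi>_def by linarith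
  qed
  have "(\<lambda>n. abs_l2 (\<phi> n)) \<longlonglongrightarrow> abs_l2 f"
  proof (rule l2_dominated_convergence(2)[where G = "\<lambda>x. \<bar>f x\<bar>"])
    show "sq_int (\<lambda>x. \<bar>f x\<bar>)"
      by (intro sq_int_continuous continuous_intros smooth_continuous_on f)
    have "\<bar>f x * F n x * G n x\<bar> \<le> \<bar>f x\<bar> * 1 * 1" for n x
      unfolding abs_mult using FG by (intro mult_mono) auto
    then show "AE x in unit_leb. \<bar>\<phi> n x\<bar> \<le> \<bar>f x\<bar>" for n by (simp add: \<phi>_def)
    have "(\<lambda>n. \<phi> n x) \<longlonglongrightarrow> f x * 1 * 1" if "x \<in> {0<..<1}" for x
      unfolding \<phi>_def by (intro tendsto_intros lims that)
    then show "AE x in unit_leb. (\<lambda>n. \<phi> n x) \<longlonglongrightarrow> f x"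
      by (intro AE_I2) simp
  qed (auto intro: meas s\<phi> f)
  moreover have "(\<lambda>n. abs_l2 (\<psi> n)) \<longlonglongrightarrow> abs_l2 (deriv f)"
  proof (rule l2_dominated_convergence(2)[where G = "\<lambda>x. 7 * K"])
    show "sq_int (\<lambda>x. 7 * K)" by (intro sq_int_continuous continuous_intros)
    show "AE x in unit_leb. \<bar>\<psi> n x\<bar> \<le> 7 * K" for n
      using bnd by (intro AE_I2) simp
    have "(\<lambda>n. f x * F n x * (- E n * G' n x)) = (\<lambda>n. F n x * (f x * (- E n * G' n x)))" for x
      by (simp add: ac_simps)
    moreover have "(\<lambda>n. deriv f x * F n x * G n x + f x * (E n * F' n x) * G n x
        + F n x * (f x * (- E n * G' n x))) \<longlonglongrightarrow> deriv f x * 1 * 1 + 0 * 1 + 1 * 0"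
      if "x \<in> {0<..<1}" for x
      by (intro tendsto_intros lims that)
    ultimately have "(\<lambda>n. \<psi> n x) \<longlonglongrightarrow> deriv f x" if "x \<in> {0<..<1}" for x
      using that unfolding \<psi>_def by (simp add: ac_simps)
    then show "AE x in unit_leb. (\<lambda>n. \<psi> n x) \<longlonglongrightarrow> deriv f x"
      by (intro AE_I2) simp
    show "\<psi> n \<in> borel_measurable unit_leb" for n
      using meas[OF smooth_deriv[OF s\<phi>]] d\<phi> by metis
  qed (auto intro: meas f smooth_deriv)
  ultimately show thesis using t by (intro that[of \<phi>]) (auto simp: d\<phi>)
qed

lemma smooth_in_H10: "smooth f \<Longrightarrow> f 0 = 0 \<Longrightarrow> f 1 = 0 \<Longrightarrow> abs_l2 f \<in> H10"
  unfolding H10_def mem_Collect_eq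
  by (rule smooth_H10_approx, assumption+, intro exI conjI allI, rule weak_deriv_smooth)
lemma A_H_smooth:
  assumes "smooth f" "f 0 = 0" "f 1 = 0"
  shows "A_H (abs_l2 f) (- abs_l2 (deriv (deriv f)))"
  using assms weak_deriv_smooth[of f] weak_deriv_smooth[of "deriv f"]
  by (auto simp: A_H_def H2_def smooth_in_H10 smooth_deriv)

section \<open>Completeness of the sine system\<close>


definition sine :: "nat \<Rightarrow> real \<Rightarrow> real"
  where "sine k x = sqrt 2 * sin (real (Suc k) * pi * x)"

definition eig :: "nat \<Rightarrow> real"
  where "eig k = (real (Suc k) * pi)\<^sup>2"

abbreviation sin_l2 :: "nat \<Rightarrow> l2"
  where "sin_l2 k \<equiv> abs_l2 (sine k)"

lemma eig_pos [simp]: "0 < eig k"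
  by (simp add: eig_def)

lemma smooth_sine [simp]: "smooth (sine k)"
proof -
  have "smooth (\<lambda>x. sqrt 2 * sin ((real (Suc k) * pi) * x))" by (intro smooth.intros)
  then show ?thesis by (simp add: sine_def[abs_def])
qed

lemma sine_sq_int [simp]: "sq_int (sine k)"
  by (simp add: smooth_sq_int)

lemma abs_sine_le: "\<bar>sine k x\<bar> \<le> sqrt 2"
  by (simp add: sine_def abs_mult mult_left_le)

lemma deriv_sine: "deriv (sine k) = (\<lambda>x. sqrt 2 * (real (Suc k) * pi) * cos (real (Suc k) * pi * x))"
  by (intro ext DERIV_imp_deriv) (auto simp: sine_def[abs_def] intro!: derivative_eq_intros)

lemma deriv_deriv_sine: "deriv (deriv (sine k)) = (\<lambda>x. - eig k * sine k x)"
  unfolding deriv_sine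
  by (intro ext DERIV_imp_deriv)
    (auto simp: sine_def eig_def power2_eq_square intro!: derivative_eq_intros)

lemma A_H_sin_l2: "A_H (sin_l2 k) (eig k *\<^sub>R sin_l2 k)"
proof -
  have "sine k 1 = 0"
    using sin_npi[of "Suc k"] unfolding sine_def by simp
  then have "A_H (sin_l2 k) (- abs_l2 (\<lambda>x. - eig k * sine k x))"
    using A_H_smooth[of "sine k"] by (simp add: deriv_deriv_sine sine_def)
  moreover have "abs_l2 (\<lambda>x. - eig k * sine k x) = - eig k *\<^sub>R sin_l2 k"
    by (rule abs_l2_scale) simp
  ultimately show ?thesis by simp
qed

text \<open>Multiplication by cos(pi x) turns sin(m pi x) into the mean of its neighbours at m + 1
  and m - 1. Hence the induction on \<open>n\<close> with \<open>m\<close> arbitrary; at m = 0 the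
  function is zero.\<close>

lemma sin_cos_power_in_span:
  "abs_l2 (\<lambda>x. sin (real m * pi * x) * cos (pi * x) ^ n) \<in> span (range sin_l2)"
proof (induction n arbitrary: m)
  case 0
  show ?case
  proof (cases m)
    case (Suc k)
    have "(1 / sqrt 2) *\<^sub>R sin_l2 k \<in> span (range sin_l2)"
      by (intro span_scale span_base rangeI)
    then have "abs_l2 (\<lambda>x. (1 / sqrt 2) * sine k x) \<in> span (range sin_l2)"
      by (simp only: abs_l2_scale sine_sq_int)
    moreover have "(\<lambda>x. (1 / sqrt 2) * sine k x) = (\<lambda>x. sin (real m * pi * x) * cos (pi * x) ^ 0)"
      by (simp add: Suc sine_def fun_eq_iff)
    ultimately show ?thesis by (simp only:)
  qed (simp add: abs_l2_zero span_zero)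
next
  case (Suc n)
  show ?case
  proof (cases m)
    case (Suc k)
    have sq: "sq_int (\<lambda>x. sin (real m * pi * x) * cos (pi * x) ^ n)" for m
      by (intro sq_int_continuous continuous_intros)
    have "sin (real m * pi * x) * cos (pi * x) ^ Suc n
      = (1/2) * (sin (real (Suc m) * pi * x) * cos (pi * x) ^ n + sin (real k * pi * x) * cos (pi * x) ^ n)"
      for x
    proof -
      have "sin (real m * pi * x) * cos (pi * x)
        = (1/2) * (sin (real m * pi * x + pi * x) + sin (real m * pi * x - pi * x))"
        by (simp add: sin_times_cos)
      also have "real m * pi * x + pi * x = real (Suc m) * pi * x" by (simp add: algebra_simps)
      also have "real m * pi * x - pi * x = real k * pi * x" by (simp add: Suc algebra_simps)
      finally have "(sin (real m * pi * x) * cos (pi * x)) * cos (pi * x) ^ n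
        = ((1/2) * (sin (real (Suc m) * pi * x) + sin (real k * pi * x))) * cos (pi * x) ^ n" by (rule arg_cong)
      then show ?thesis by (simp only: power_Suc mult.assoc distrib_right)
    qed
    then show ?thesis
      using Suc.IH[of "Suc m"] Suc.IH[of k] sq
      by (simp only: abs_l2_scale abs_l2_add sq_int_add span_scale span_add)
  qed (simp add: abs_l2_zero span_zero)
qed

abbreviation cl_span :: "l2 set"
  where "cl_span \<equiv> closure (span (range sin_l2))"

lemma cl_span_limit: "(\<And>n. u n \<in> cl_span) \<Longrightarrow> u \<longlonglongrightarrow> l \<Longrightarrow> l \<in> cl_span"
  by (rule closed_sequentially) auto

lemma continuous_measurable_unit:
  fixes f :: "real \<Rightarrow> real"
  assumes "continuous_on {0..1} f" shows "f \<in> borel_measurable unit_leb"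
  using sq_int_continuous[OF assms] by (simp add: sq_int_def)

lemma sin_pi_measurable: "(\<lambda>x. sin (pi * x)) \<in> borel_measurable unit_leb"
  by (intro continuous_measurable_unit continuous_intros)

lemma sq_int_const: "sq_int (\<lambda>x. c)"
  by (intro sq_int_continuous continuous_intros)

text \<open>The functions $\sin(\pi x)\, p(\cos(\pi x))$ with polynomial $p$ are sine sums, and by the Weierstrass
  theorem for $y \mapsto f(\arccos(y)/\pi)$ they approximate $\sin(\pi x) f(x)$.\<close>

lemma sin_times_continuous_in_cl_span:
  assumes f: "continuous_on {0..1} f"
  shows "abs_l2 (\<lambda>x. sin (pi * x) * f x) \<in> cl_span"
proof -
  have "continuous_on {-1..1} (\<lambda>y. f (arccos y / pi))"
  proof (rule continuous_on_compose2[OF f])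
    show "continuous_on {-1..1} (\<lambda>y. arccos y / pi)" by (intro continuous_intros) auto
    show "(\<lambda>y. arccos y / pi) ` {-1..1} \<subseteq> {0..1}"
      using arccos_lbound arccos_ubound by auto
  qed
  then have "\<exists>p. real_polynomial_function p \<and> (\<forall>y\<in>{-1..1}. \<bar>f (arccos y / pi) - p y\<bar> < inverse (real (Suc n)))" for n
    by (rule_tac Stone_Weierstrass_real_polynomial_function[of "{-1..1}" "\<lambda>y. f (arccos y / pi)" "inverse (real (Suc n))"]) auto
  then obtain p where p: "\<And>n. real_polynomial_function (p n)"
    "\<And>n y. y \<in> {-1..1} \<Longrightarrow> \<bar>f (arccos y / pi) - p n y\<bar> < inverse (real (Suc n))" by metis
  have close: "\<bar>f x - p n (cos (pi * x))\<bar> < inverse (real (Suc n))" if "x \<in> {0..1}" for x n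
  proof -
    have "arccos (cos (pi * x)) = pi * x" using that by (intro arccos_cos) auto
    then show ?thesis using p(2)[of "cos (pi * x)" n] by simp
  qed
  have in_span: "abs_l2 (\<lambda>x. sin (pi * x) * p n (cos (pi * x))) \<in> cl_span" for n
  proof -
    obtain a N where pn: "p n = (\<lambda>x. \<Sum>i\<le>N. a i * x ^ i)"
      using p(1)[of n] real_polynomial_function_iff_sum by metis
    have "(\<lambda>x. sin (pi * x) * p n (cos (pi * x)))
        = (\<lambda>x. \<Sum>i\<le>N. a i * (sin (real 1 * pi * x) * cos (pi * x) ^ i))"
      by (simp add: pn sum_distrib_left algebra_simps)
    moreover have "sq_int (\<lambda>x. sin (real 1 * pi * x) * cos (pi * x) ^ i)" for i
      by (intro sq_int_continuous continuous_intros)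
    ultimately have "abs_l2 (\<lambda>x. sin (pi * x) * p n (cos (pi * x)))
        = (\<Sum>i\<le>N. a i *\<^sub>R abs_l2 (\<lambda>x. sin (real 1 * pi * x) * cos (pi * x) ^ i))"
      by (simp only: abs_l2_sum abs_l2_scale sq_int_scale)
    also have "\<dots> \<in> span (range sin_l2)"
      by (intro span_sum span_scale sin_cos_power_in_span)
    finally show ?thesis using closure_subset by blast
  qed
  have cont_p: "continuous_on T (\<lambda>x. p n (cos (pi * x)))" for n T
  proof -
    have "continuous_on UNIV (p n)" using p(1)[of n] continuous_on_polymonial_function[of "p n" UNIV]
      by (simp add: real_polynomial_function_eq[symmetric])
    then show ?thesis by (rule continuous_on_compose2) (auto intro!: continuous_intros)
  qed
  obtain B where B: "\<And>x. x \<in> {0..1} \<Longrightarrow> \<bar>f x\<bar> \<le> B"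
    using compact_imp_bounded[OF compact_continuous_image[OF f]] by (force simp: bounded_iff)
  show ?thesis
  proof (rule cl_span_limit[OF in_span],
      rule l2_dominated_convergence(2)[where G = "\<lambda>x. B + 1"])
    show "AE x in unit_leb. (\<lambda>n. sin (pi * x) * p n (cos (pi * x))) \<longlonglongrightarrow> sin (pi * x) * f x"
    proof (rule AE_I2)
      fix x assume "x \<in> space unit_leb"
      then have x: "x \<in> {0..1}" by auto
      have "(\<lambda>n. f x - p n (cos (pi * x))) \<longlonglongrightarrow> 0"
        using close[OF x] by (intro tendsto_0_le[OF LIMSEQ_inverse_real_of_nat, of _ 1])
          (auto intro!: always_eventually less_imp_le)
      then have "(\<lambda>n. f x - (f x - p n (cos (pi * x)))) \<longlonglongrightarrow> f x - 0" by (intro tendsto_intros)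
      then have "(\<lambda>n. p n (cos (pi * x))) \<longlonglongrightarrow> f x" by simp
      then show "(\<lambda>n. sin (pi * x) * p n (cos (pi * x))) \<longlonglongrightarrow> sin (pi * x) * f x"
        by (intro tendsto_intros)
    qed
    show "AE x in unit_leb. \<bar>sin (pi * x) * p n (cos (pi * x))\<bar> \<le> B + 1" for n
    proof (rule AE_I2)
      fix x assume "x \<in> space unit_leb"
      then have x: "x \<in> {0..1}" by auto
      have "inverse (real (Suc n)) \<le> 1" by (simp add: inverse_le_1_iff)
      then have "\<bar>p n (cos (pi * x))\<bar> \<le> B + 1" using close[OF x, of n] B[OF x] by linarith
      then have "\<bar>sin (pi * x)\<bar> * \<bar>p n (cos (pi * x))\<bar> \<le> 1 * (B + 1)" by (intro mult_mono) auto
      then show "\<bar>sin (pi * x) * p n (cos (pi * x))\<bar> \<le> B + 1" by (simp add: abs_mult)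
    qed
  qed (auto intro!: continuous_measurable_unit continuous_intros cont_p f sq_int_const)
qed

text \<open>Measurability provides continuous functions converging to \<open>f\<close> off a null
  set. Truncating them at M keeps them continuous, does not change the limit, and supplies a
  constant majorant.\<close>

lemma sin_times_bounded_in_cl_span:
  assumes f: "f \<in> borel_measurable unit_leb" and M: "\<And>x. \<bar>f x\<bar> \<le> M"
  shows "abs_l2 (\<lambda>x. sin (pi * x) * f x) \<in> cl_span"
proof -
  have "f measurable_on {0<..<1}" using f by (simp add: measurable_on_iff_borel_measurable)
  then obtain N g where N: "negligible N" and g: "\<And>n. continuous_on UNIV (g n)"
    "\<And>x. x \<notin> N \<Longrightarrow> (\<lambda>n. g n x) \<longlonglongrightarrow> (if x \<in> {0<..<1} then f x else 0)"
    unfolding measurable_on_def by blast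
  define h where "h n x = max (- M) (min M (g n x))" for n and x :: real
  have h: "continuous_on T (h n)" for n T
    unfolding h_def using g(1)[of n] by (intro continuous_intros) (auto elim: continuous_on_subset)
  have M0: "0 \<le> M" using M[of 0] by simp
  have hM: "\<bar>h n x\<bar> \<le> M" for n x using M0 by (simp add: h_def abs_le_iff)
  have AE_N: "AE x in unit_leb. x \<notin> N"
    using N by (simp add: AE_restrict_space_iff) (auto simp: negligible_iff_null_sets intro: AE_not_in eventually_mono)
  show ?thesis
  proof (rule cl_span_limit[OF sin_times_continuous_in_cl_span[OF h]],
      rule l2_dominated_convergence(2)[where G = "\<lambda>x. M"])
    show "AE x in unit_leb. (\<lambda>n. sin (pi * x) * h n x) \<longlonglongrightarrow> sin (pi * x) * f x"
      using AE_N AE_space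
    proof eventually_elim
      case (elim x)
      then have "(\<lambda>n. g n x) \<longlonglongrightarrow> f x" using g(2)[of x] by auto
      then have "(\<lambda>n. max (- M) (min M (g n x))) \<longlonglongrightarrow> max (- M) (min M (f x))"
        by (intro tendsto_intros)
      moreover have "max (- M) (min M (f x)) = f x" using M[of x] by (auto simp: max_def min_def)
      ultimately show ?case unfolding h_def by (intro tendsto_intros) simp
    qed
    have "\<bar>sin (pi * x)\<bar> * \<bar>h n x\<bar> \<le> 1 * M" for n x using hM M0 by (intro mult_mono) auto
    then show "AE x in unit_leb. \<bar>sin (pi * x) * h n x\<bar> \<le> M" for n by (simp add: abs_mult)
    show "(\<lambda>x. sin (pi * x) * h n x) \<in> borel_measurable unit_leb" for n
      by (intro continuous_measurable_unit continuous_intros h)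
    show "(\<lambda>x. sin (pi * x) * f x) \<in> borel_measurable unit_leb"
      using f sin_pi_measurable by measurable
  qed (rule sq_int_const)
qed

text \<open>Write u as sin(pi x) times u / sin(pi x). The quotient need not be bounded, but its
  truncations at level n are, and their products with sin(pi x) are dominated by |u|.\<close>

lemma cl_span_UNIV: "cl_span = UNIV"
proof -
  have "u \<in> cl_span" for u
  proof -
    let ?f = "rep_l2 u"
    define h where "h n x = max (- real n) (min (real n) (?f x / sin (pi * x)))" for n x
    note s = sin_pi_measurable
    have h: "h n \<in> borel_measurable unit_leb" for n
      unfolding h_def using s borel_measurable_rep_l2[of u] by measurable
    have hn: "\<bar>h n x\<bar> \<le> real n" for n x by (simp add: h_def abs_le_iff)
    have sin_pos: "0 < sin (pi * x)" if "x \<in> space unit_leb" for x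
      using that by (intro sin_gt_zero) auto
    have "abs_l2 ?f \<in> cl_span"
    proof (rule cl_span_limit[OF sin_times_bounded_in_cl_span[OF h hn]],
        rule l2_dominated_convergence(2)[where G = "\<lambda>x. \<bar>?f x\<bar>"])
      show "sq_int (\<lambda>x. \<bar>?f x\<bar>)"
        using sq_int_rep_l2[of u] unfolding sq_int_def by (auto intro: borel_measurable_abs)
      show "AE x in unit_leb. (\<lambda>n. sin (pi * x) * h n x) \<longlonglongrightarrow> ?f x"
      proof (rule AE_I2)
        fix x assume x: "x \<in> space unit_leb"
        obtain m where m: "\<bar>?f x / sin (pi * x)\<bar> \<le> real m" using real_arch_simple by blast
        have "\<forall>\<^sub>F n in sequentially. sin (pi * x) * h n x = ?f x"
          using eventually_ge_at_top[of m]
        proof eventually_elim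
          case (elim n)
          then have "\<bar>?f x / sin (pi * x)\<bar> \<le> real n" using m by linarith
          then have "h n x = ?f x / sin (pi * x)" unfolding h_def by linarith
          then show ?case using sin_pos[OF x] by simp
        qed
        then show "(\<lambda>n. sin (pi * x) * h n x) \<longlonglongrightarrow> ?f x" by (rule tendsto_eventually)
      qed
      show "AE x in unit_leb. \<bar>sin (pi * x) * h n x\<bar> \<le> \<bar>?f x\<bar>" for n
      proof (rule AE_I2)
        fix x assume x: "x \<in> space unit_leb"
        have "\<bar>h n x\<bar> \<le> \<bar>?f x / sin (pi * x)\<bar>" unfolding h_def by linarith
        then have "sin (pi * x) * \<bar>h n x\<bar> \<le> sin (pi * x) * \<bar>?f x / sin (pi * x)\<bar>"
          using sin_pos[OF x] by (intro mult_left_mono) auto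
        then show "\<bar>sin (pi * x) * h n x\<bar> \<le> \<bar>?f x\<bar>" using sin_pos[OF x] by (simp add: abs_mult)
      qed
      show "(\<lambda>x. sin (pi * x) * h n x) \<in> borel_measurable unit_leb" for n
        using s h by measurable
    qed measurable
    then show ?thesis by simp
  qed
  then show ?thesis by blast
qed

text \<open>The vectors orthogonal to \<open>w\<close> form a closed subspace; it contains all
  sines, hence by completeness \<open>w\<close> itself.\<close>

lemma orthogonal_sines_imp_zero:
  assumes "\<And>k. w \<bullet> sin_l2 k = 0" shows "w = 0"
proof -
  have "span (range sin_l2) \<subseteq> {v. w \<bullet> v = 0}"
    using assms by (intro span_minimal) (auto simp: subspace_hyperplane)
  then have "cl_span \<subseteq> {v. w \<bullet> v = 0}"
    by (intro closure_minimal closed_hyperplane)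
  then have "w \<bullet> w = 0" unfolding cl_span_UNIV by blast
  then show ?thesis by simp
qed

lemma inner_sines_eqI: "(\<And>k. v \<bullet> sin_l2 k = w \<bullet> sin_l2 k) \<Longrightarrow> v = w"
  using orthogonal_sines_imp_zero[of "v - w"] by (simp add: inner_diff_left)

section \<open>The operator $A_H$ and its powers\<close>


lemma test_fun_lincomb:
  assumes t: "test_fun \<phi>" "test_fun \<psi>"
  shows "test_fun (\<lambda>x. \<phi> x + c * \<psi> x)"
    and "deriv (\<lambda>x. \<phi> x + c * \<psi> x) = (\<lambda>x. deriv \<phi> x + c * deriv \<psi> x)"
proof -
  have d: "((deriv ^^ n) \<theta> has_field_derivative (deriv ^^ Suc n) \<theta> x) (at x)"
    if "test_fun \<theta>" for \<theta> n x
    using that by (auto simp: test_fun_def differentiable_on_def DERIV_deriv_iff_real_differentiable)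
  have step: "deriv (\<lambda>x. (deriv ^^ n) \<phi> x + c * (deriv ^^ n) \<psi> x)
      = (\<lambda>x. (deriv ^^ Suc n) \<phi> x + c * (deriv ^^ Suc n) \<psi> x)" for n
    by (intro ext DERIV_imp_deriv DERIV_add DERIV_cmult d t)
  show "deriv (\<lambda>x. \<phi> x + c * \<psi> x) = (\<lambda>x. deriv \<phi> x + c * deriv \<psi> x)"
    using step[of 0] by simp
  have iter: "(deriv ^^ n) (\<lambda>x. \<phi> x + c * \<psi> x)
      = (\<lambda>x. (deriv ^^ n) \<phi> x + c * (deriv ^^ n) \<psi> x)" for n
    by (induction n) (use step in \<open>simp_all\<close>)
  have "(deriv ^^ n) (\<lambda>x. \<phi> x + c * \<psi> x) differentiable_on UNIV" for n
    unfolding iter using DERIV_add[OF d[OF t(1)] DERIV_cmult[OF d[OF t(2)]]]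
    by (meson differentiable_on_def differentiable_at_withinI real_differentiable_def)
  moreover have "closure {x. \<phi> x + c * \<psi> x \<noteq> 0} \<subseteq> closure {x. \<phi> x \<noteq> 0} \<union> closure {x. \<psi> x \<noteq> 0}"
    unfolding closure_Un[symmetric] by (intro closure_mono) auto
  ultimately show "test_fun (\<lambda>x. \<phi> x + c * \<psi> x)"
    using t unfolding test_fun_def by blast
qed

lemma weak_deriv_lincomb:
  "weak_deriv u w \<Longrightarrow> weak_deriv u' w' \<Longrightarrow> weak_deriv (u + c *\<^sub>R u') (w + c *\<^sub>R w')"
  by (simp add: weak_deriv_inner inner_add_left algebra_simps)

text \<open>Test functions approximate each sine in L^2, so the two candidates have the same sine
  coefficients.\<close>

lemma weak_deriv_unique:
  assumes "weak_deriv u w" "weak_deriv u w'" shows "w = w'"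
proof (rule inner_sines_eqI)
  fix k
  have "sine k 1 = 0" "sine k 0 = 0"
    using sin_npi[of "Suc k"] unfolding sine_def by simp_all
  then obtain \<phi> where \<phi>: "\<And>n. test_fun (\<phi> n)" "(\<lambda>n. abs_l2 (\<phi> n)) \<longlonglongrightarrow> sin_l2 k"
    using smooth_H10_approx[OF smooth_sine] by metis
  have "(\<lambda>n. w \<bullet> abs_l2 (\<phi> n)) \<longlonglongrightarrow> w \<bullet> sin_l2 k" "(\<lambda>n. w' \<bullet> abs_l2 (\<phi> n)) \<longlonglongrightarrow> w' \<bullet> sin_l2 k"
    by (intro tendsto_intros \<phi>)+
  moreover have "w \<bullet> abs_l2 (\<phi> n) = w' \<bullet> abs_l2 (\<phi> n)" for n
    using assms \<phi>(1)[of n] unfolding weak_deriv_inner by (metis neg_equal_iff_equal)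
  ultimately show "w \<bullet> sin_l2 k = w' \<bullet> sin_l2 k" by (simp add: LIMSEQ_unique)
qed

text \<open>\<open>A_H\<close> and \<open>H10\<close> each choose a weak derivative of
  \<open>u\<close>. Uniqueness identifies them, so the derivatives of the approximating test
  functions converge to the very \<open>w\<close> whose weak derivative is
  \<open>- f\<close>.\<close>

lemma A_H_elim:
  assumes "A_H u f"
  obtains w \<phi> where "weak_deriv u w" "weak_deriv w (- f)" "\<And>n. test_fun (\<phi> n)"
    "(\<lambda>n. abs_l2 (\<phi> n)) \<longlonglongrightarrow> u" "(\<lambda>n. abs_l2 (deriv (\<phi> n))) \<longlonglongrightarrow> w"
proof -
  from assms obtain w where w: "weak_deriv u w" "weak_deriv w (- f)" "u \<in> H10"
    unfolding A_H_def by blast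
  moreover from w(3) obtain w' \<phi> where "weak_deriv u w'" "\<And>n. test_fun (\<phi> n)"
    "(\<lambda>n. abs_l2 (\<phi> n)) \<longlonglongrightarrow> u" "(\<lambda>n. abs_l2 (deriv (\<phi> n))) \<longlonglongrightarrow> w'"
    unfolding H10_def by blast
  ultimately show thesis
    using weak_deriv_unique[of u w w'] by (intro that[of w \<phi>]) auto
qed

lemma A_H_intro:
  assumes "weak_deriv u w" "weak_deriv w (- f)" "\<And>n. test_fun (\<phi> n)"
    "(\<lambda>n. abs_l2 (\<phi> n)) \<longlonglongrightarrow> u" "(\<lambda>n. abs_l2 (deriv (\<phi> n))) \<longlonglongrightarrow> w"
  shows "A_H u f"
  using assms unfolding A_H_def H2_def H10_def by blast

lemma A_H_lincomb:
  assumes "A_H u f" "A_H v g" shows "A_H (u + c *\<^sub>R v) (f + c *\<^sub>R g)"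
proof -
  from assms(1) obtain w \<phi> where w: "weak_deriv u w" "weak_deriv w (- f)"
    and \<phi>: "\<And>n. test_fun (\<phi> n)"
    "(\<lambda>n. abs_l2 (\<phi> n)) \<longlonglongrightarrow> u" "(\<lambda>n. abs_l2 (deriv (\<phi> n))) \<longlonglongrightarrow> w" by (rule A_H_elim) (rule that)
  from assms(2) obtain z \<psi> where z: "weak_deriv v z" "weak_deriv z (- g)"
    and \<psi>: "\<And>n. test_fun (\<psi> n)"
    "(\<lambda>n. abs_l2 (\<psi> n)) \<longlonglongrightarrow> v" "(\<lambda>n. abs_l2 (deriv (\<psi> n))) \<longlonglongrightarrow> z" by (rule A_H_elim) (rule that)
  have "weak_deriv (w + c *\<^sub>R z) (- (f + c *\<^sub>R g))"
    using weak_deriv_lincomb[OF w(2) z(2), of c] by simp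
  moreover have "abs_l2 (\<lambda>x. \<phi> n x + c * \<psi> n x) = abs_l2 (\<phi> n) + c *\<^sub>R abs_l2 (\<psi> n)"
    "abs_l2 (\<lambda>x. deriv (\<phi> n) x + c * deriv (\<psi> n) x)
      = abs_l2 (deriv (\<phi> n)) + c *\<^sub>R abs_l2 (deriv (\<psi> n))" for n
    using \<phi>(1) \<psi>(1) by (simp_all only: abs_l2_add abs_l2_scale test_fun_sq_int sq_int_scale)
  moreover have "(\<lambda>n. abs_l2 (\<phi> n) + c *\<^sub>R abs_l2 (\<psi> n)) \<longlonglongrightarrow> u + c *\<^sub>R v"
    "(\<lambda>n. abs_l2 (deriv (\<phi> n)) + c *\<^sub>R abs_l2 (deriv (\<psi> n))) \<longlonglongrightarrow> w + c *\<^sub>R z"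
    by (intro tendsto_intros \<phi> \<psi>)+
  ultimately show ?thesis
    using weak_deriv_lincomb[OF w(1) z(1), of c] test_fun_lincomb[OF \<phi>(1) \<psi>(1)]
    by (intro A_H_intro[where w = "w + c *\<^sub>R z" and \<phi> = "\<lambda>n x. \<phi> n x + c * \<psi> n x"]) simp_all
qed

lemma A_H_zero: "A_H 0 0"
  using A_H_smooth[of "\<lambda>x. 0"] by (simp add: smooth.const abs_l2_zero)

lemma A_H_scale: "A_H v g \<Longrightarrow> A_H (c *\<^sub>R v) (c *\<^sub>R g)"
  using A_H_lincomb[OF A_H_zero, of v g c] by simp

lemma A_H_add: "A_H u f \<Longrightarrow> A_H v g \<Longrightarrow> A_H (u + v) (f + g)"
  using A_H_lincomb[of u f v g 1] by simp

lemma A_H_diff: "A_H u f \<Longrightarrow> A_H v g \<Longrightarrow> A_H (u - v) (f - g)"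
  using A_H_lincomb[of u f v g "-1"] by simp

lemma A_H_uminus: "A_H u f \<Longrightarrow> A_H (- u) (- f)"
  using A_H_scale[of u f "-1"] by simp

lemma A_H_sum: "(\<And>i. i \<in> I \<Longrightarrow> A_H (u i) (f i)) \<Longrightarrow> A_H (\<Sum>i\<in>I. u i) (\<Sum>i\<in>I. f i)"
  by (induction I rule: infinite_finite_induct) (auto intro: A_H_zero A_H_add)

text \<open>Integration by parts without boundary terms: it holds by definition against test
  functions and passes to their limits in the H^1 norm.\<close>

lemma weak_deriv_inner_limit:
  assumes "weak_deriv w (- f)" "\<And>n. test_fun (\<phi> n)"
    "(\<lambda>n. abs_l2 (\<phi> n)) \<longlonglongrightarrow> v" "(\<lambda>n. abs_l2 (deriv (\<phi> n))) \<longlonglongrightarrow> z"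
  shows "f \<bullet> v = w \<bullet> z"
proof -
  have "f \<bullet> abs_l2 (\<phi> n) = w \<bullet> abs_l2 (deriv (\<phi> n))" for n
    using assms(1,2) unfolding weak_deriv_inner by simp
  moreover have "(\<lambda>n. f \<bullet> abs_l2 (\<phi> n)) \<longlonglongrightarrow> f \<bullet> v"
    "(\<lambda>n. w \<bullet> abs_l2 (deriv (\<phi> n))) \<longlonglongrightarrow> w \<bullet> z"
    by (intro tendsto_intros assms)+
  ultimately show ?thesis by (simp add: LIMSEQ_unique)
qed

lemma A_H_symmetric:
  assumes "A_H u f" "A_H v g" shows "f \<bullet> v = u \<bullet> g"
proof -
  from assms(1) obtain w \<phi> where w: "weak_deriv w (- f)" "\<And>n. test_fun (\<phi> n)"
    "(\<lambda>n. abs_l2 (\<phi> n)) \<longlonglongrightarrow> u" "(\<lambda>n. abs_l2 (deriv (\<phi> n))) \<longlonglongrightarrow> w" by (rule A_H_elim) (rule that)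
  from assms(2) obtain z \<psi> where z: "weak_deriv z (- g)" "\<And>n. test_fun (\<psi> n)"
    "(\<lambda>n. abs_l2 (\<psi> n)) \<longlonglongrightarrow> v" "(\<lambda>n. abs_l2 (deriv (\<psi> n))) \<longlonglongrightarrow> z" by (rule A_H_elim) (rule that)
  have "f \<bullet> v = w \<bullet> z" using weak_deriv_inner_limit[OF w(1) z(2-4)] .
  moreover have "g \<bullet> u = z \<bullet> w" using weak_deriv_inner_limit[OF z(1) w(2-4)] .
  ultimately show ?thesis by (simp add: inner_commute)
qed

text \<open>The value at x is the integral of the derivative from either endpoint; Cauchy-Schwarz
  against the indicator of that interval contributes its length.\<close>

lemma test_fun_pointwise_bound:
  assumes t: "test_fun \<phi>" and x: "x \<in> {0<..<1}"
  shows "(\<phi> x)\<^sup>2 \<le> x * (norm (abs_l2 (deriv \<phi>)))\<^sup>2"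
    and "(\<phi> x)\<^sup>2 \<le> (1 - x) * (norm (abs_l2 (deriv \<phi>)))\<^sup>2"
proof -
  have aux: "(\<phi> b - \<phi> a)\<^sup>2 \<le> (b - a) * (norm (abs_l2 (deriv \<phi>)))\<^sup>2" if ab: "0 \<le> a" "a < b" "b \<le> 1" for a b
  proof -
    let ?i = "indicator {a<..<b} :: real \<Rightarrow> real"
    have m: "?i \<in> borel_measurable unit_leb"
      by (intro measurable_restrict_space1 borel_measurable_indicator) auto
    have si: "sq_int ?i"
      by (rule sq_int_bounded_by[OF m sq_int_const[of 1]]) (simp add: indicator_def)
    have sub: "{a<..<b} \<inter> {0<..<1} = {a<..<b}" using ab by auto
    have "(?i x)\<^sup>2 = ?i x" for x by (simp add: indicator_def)
    then have "(norm (abs_l2 ?i))\<^sup>2 = (LINT x|unit_leb. ?i x)"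
      using norm_abs_l2_squared[OF si] by (simp only:)
    also have "\<dots> = measure unit_leb {a<..<b}"
      using ab by (simp add: Bochner_Integration.integral_indicator max_absorb1 min_absorb1)
    also have "\<dots> = b - a"
      using ab by (subst measure_restrict_space) (auto simp: subset_eq)
    finally have n: "(norm (abs_l2 ?i))\<^sup>2 = b - a" .
    have "(deriv \<phi> has_integral \<phi> b - \<phi> a) {a..b}"
      using test_fun_has_deriv[OF t] ab
      by (intro fundamental_theorem_of_calculus)
        (auto simp: has_real_derivative_iff_has_vector_derivative[symmetric] intro: has_field_derivative_at_within)
    then have hi: "integral {a<..<b} (deriv \<phi>) = \<phi> b - \<phi> a"
      using integral_open_interval_real[of a b "deriv \<phi>"] integral_unique by metis
    have prod: "integrable unit_leb (\<lambda>x. deriv \<phi> x * ?i x)"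
      by (intro sq_int_mult test_fun_sq_int t si)
    have "abs_l2 (deriv \<phi>) \<bullet> abs_l2 ?i = (LINT x|unit_leb. deriv \<phi> x * ?i x)"
      by (simp add: inner_abs_l2 test_fun_sq_int t si)
    also have "\<dots> = integral {0<..<1} (\<lambda>x. deriv \<phi> x * ?i x)"
      using prod by (intro lebesgue_integral_eq_integral) auto
    also have "\<dots> = integral {0<..<1} (\<lambda>x. if x \<in> {a<..<b} then deriv \<phi> x else 0)"
      by (intro arg_cong2[where f = integral] refl) (auto simp: indicator_def)
    also have "\<dots> = integral {a<..<b} (deriv \<phi>)"
      using ab by (subst integral_restrict_Int) (simp add: Int_commute sub)
    finally have "abs_l2 (deriv \<phi>) \<bullet> abs_l2 ?i = \<phi> b - \<phi> a" using hi by simp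
    moreover have "(abs_l2 (deriv \<phi>) \<bullet> abs_l2 ?i)\<^sup>2 \<le> (norm (abs_l2 (deriv \<phi>)))\<^sup>2 * (norm (abs_l2 ?i))\<^sup>2"
      using Cauchy_Schwarz_ineq[of "abs_l2 (deriv \<phi>)" "abs_l2 ?i"] by (simp add: power2_norm_eq_inner)
    ultimately show ?thesis by (simp add: n mult.commute)
  qed
  show "(\<phi> x)\<^sup>2 \<le> x * (norm (abs_l2 (deriv \<phi>)))\<^sup>2" "(\<phi> x)\<^sup>2 \<le> (1 - x) * (norm (abs_l2 (deriv \<phi>)))\<^sup>2"
    using aux[of 0 x] aux[of x 1] x by (simp_all add: test_fun_boundary[OF t])
qed

text \<open>\<open>E\<close> is the Dirichlet energy, the squared norm of the weak derivative of
  \<open>u\<close>. It appears both in the energy identity and in the pointwise bounds, which lets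
  one absorb the other later.\<close>

lemma A_H_energy:
  assumes "A_H u f"
  obtains E where "0 \<le> E" "f \<bullet> u = E" "AE x in unit_leb. (rep_l2 u x)\<^sup>2 \<le> x * E"
    "AE x in unit_leb. (rep_l2 u x)\<^sup>2 \<le> (1 - x) * E"
proof -
  from assms obtain w \<phi> where w: "weak_deriv w (- f)" "\<And>n. test_fun (\<phi> n)"
    "(\<lambda>n. abs_l2 (\<phi> n)) \<longlonglongrightarrow> u" "(\<lambda>n. abs_l2 (deriv (\<phi> n))) \<longlonglongrightarrow> w" by (rule A_H_elim) (rule that)
  from w(3) obtain r :: "nat \<Rightarrow> nat" where r: "strict_mono r"
    "AE x in unit_leb. (\<lambda>n. rep_l2 (abs_l2 (\<phi> (r n))) x) \<longlonglongrightarrow> rep_l2 u x"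
    by (rule l2_AE_subsequence) (rule that)
  have nr: "(\<lambda>n. (norm (abs_l2 (deriv (\<phi> (r n)))))\<^sup>2) \<longlonglongrightarrow> (norm w)\<^sup>2"
    using LIMSEQ_subseq_LIMSEQ[OF w(4) r(1)] by (intro tendsto_intros) (simp add: o_def)
  have reps: "AE x in unit_leb. \<forall>n. rep_l2 (abs_l2 (\<phi> (r n))) x = \<phi> (r n) x"
    using rep_abs_l2[OF test_fun_sq_int(1)[OF w(2)]] by (simp add: AE_all_countable)
  have bounds: "AE x in unit_leb. (rep_l2 u x)\<^sup>2 \<le> x * (norm w)\<^sup>2 \<and> (rep_l2 u x)\<^sup>2 \<le> (1 - x) * (norm w)\<^sup>2"
    using r(2) reps AE_space
  proof eventually_elim
    case (elim x)
    then have x: "x \<in> {0<..<1}" by simp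
    have lim: "(\<lambda>n. (\<phi> (r n) x)\<^sup>2) \<longlonglongrightarrow> (rep_l2 u x)\<^sup>2"
      using elim by (intro tendsto_intros) simp
    have "(rep_l2 u x)\<^sup>2 \<le> x * (norm w)\<^sup>2"
      by (rule LIMSEQ_le[OF lim tendsto_mult[OF tendsto_const nr]])
        (use test_fun_pointwise_bound(1)[OF w(2) x] in auto)
    moreover have "(rep_l2 u x)\<^sup>2 \<le> (1 - x) * (norm w)\<^sup>2"
      by (rule LIMSEQ_le[OF lim tendsto_mult[OF tendsto_const nr]])
        (use test_fun_pointwise_bound(2)[OF w(2) x] in auto)
    ultimately show ?case by blast
  qed
  have "f \<bullet> u = (norm w)\<^sup>2"
    using weak_deriv_inner_limit[OF w] by (simp add: power2_norm_eq_inner)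
  then show thesis
    using bounds by (intro that[of "(norm w)\<^sup>2"]) (auto elim: eventually_mono)
qed

text \<open>Only the normalization needs an integral; orthogonality follows from symmetry of the
  operator and distinctness of the eigenvalues.\<close>

lemma inner_sin_l2: "sin_l2 j \<bullet> sin_l2 k = (if j = k then 1 else 0)"
proof (cases "j = k")
  case True
  define c where "c = real (Suc k) * pi"
  have c: "c \<noteq> 0" by (simp add: c_def)
  have "(LINT x|unit_leb. sine k x * sine k x)
    = (1 - sin (2 * c * 1) / (2 * c)) - (0 - sin (2 * c * 0) / (2 * c))"
  proof (rule integral_unit_FTC)
    show "continuous_on {0..1} (\<lambda>x. sine k x * sine k x)"
      by (intro continuous_intros smooth_continuous_on) simp_all
    show "((\<lambda>x. x - sin (2 * c * x) / (2 * c)) has_real_derivative sine k x * sine k x) (at x)" for x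
    proof -
      have "sine k x = sqrt 2 * sin (c * x)" by (simp add: sine_def c_def)
      then have "sine k x * sine k x = 1 - cos (2 * (c * x))"
        by (simp add: cos_double_sin power2_eq_square)
      then show ?thesis using c by (auto intro!: derivative_eq_intros simp: mult.assoc)
    qed
  qed
  moreover have "2 * c = real (2 * Suc k) * pi" by (simp add: c_def)
  then have "sin (2 * c) = 0" using sin_npi[of "2 * Suc k"] by (simp only:)
  ultimately show ?thesis using True by (simp add: inner_abs_l2)
next
  case False
  have "eig j \<noteq> eig k" using False unfolding eig_def by (subst power2_eq_iff_nonneg) auto
  moreover have "eig j * (sin_l2 j \<bullet> sin_l2 k) = eig k * (sin_l2 j \<bullet> sin_l2 k)"
    using A_H_symmetric[OF A_H_sin_l2[of j] A_H_sin_l2[of k]] by simp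
  ultimately show ?thesis using False by simp
qed

lemma eigenbasis_sin_l2: "eigenbasis A_H sin_l2 eig"
  using cl_span_UNIV by (auto simp: eigenbasis_def inner_sin_l2 A_H_sin_l2)

text \<open>The partial sum \<open>P n\<close> is the orthogonal projection onto the first n vectors
  and so a best approximation. Density then forces convergence, without completeness of the space.
  The basis is arbitrary because \<open>frac_power\<close> allows any eigenbasis.\<close>

lemma orthonormal_expansion:
  fixes e :: "nat \<Rightarrow> 'a::real_inner"
  assumes ortho: "\<And>j k. e j \<bullet> e k = (if j = k then 1 else 0)"
    and dense: "closure (span (range e)) = UNIV"
  shows "(\<lambda>k. (u \<bullet> e k) *\<^sub>R e k) sums u"
proof -
  define P where "P n = (\<Sum>k<n. (u \<bullet> e k) *\<^sub>R e k)" for n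
  have P_in: "P n \<in> span (e ` {..<n})" for n
    unfolding P_def by (intro span_sum span_scale span_base) auto
  have perp: "(u - P n) \<bullet> v = 0" if "v \<in> span (e ` {..<n})" for n v
  proof -
    have "(u - P n) \<bullet> e j = 0" if "j < n" for j
    proof -
      have "P n \<bullet> e j = (\<Sum>k<n. if k = j then u \<bullet> e j else 0)"
        unfolding P_def inner_sum_left by (intro sum.cong) (auto simp: ortho)
      then show ?thesis using that by (simp add: inner_diff_left)
    qed
    then have "span (e ` {..<n}) \<subseteq> {v. (u - P n) \<bullet> v = 0}"
      by (intro span_minimal) (auto simp: subspace_hyperplane)
    with that show ?thesis by blast
  qed
  have best: "norm (u - P n) \<le> norm (u - v)" if v: "v \<in> span (e ` {..<n})" for n v
  proof -
    have "(u - P n) \<bullet> (P n - v) = 0" by (intro perp span_diff P_in v)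
    then have "(norm (u - v))\<^sup>2 = (norm (u - P n))\<^sup>2 + (norm (P n - v))\<^sup>2"
      using norm_add_Pythagorean[of "u - P n" "P n - v"] by (simp add: orthogonal_def)
    then have "(norm (u - P n))\<^sup>2 \<le> (norm (u - v))\<^sup>2" by simp
    then show ?thesis by (rule power2_le_imp_le) simp
  qed
  have "P \<longlonglongrightarrow> u"
  proof (rule LIMSEQ_I)
    fix \<epsilon> :: real assume "0 < \<epsilon>"
    moreover have "u \<in> closure (span (range e))" by (simp add: dense)
    ultimately obtain v where v: "v \<in> span (range e)" "dist v u < \<epsilon>"
      unfolding closure_approachable by blast
    from v(1) obtain T q where T0: "finite T" "T \<subseteq> range e" "v = (\<Sum>a\<in>T. q a *\<^sub>R a)"
      unfolding span_explicit by blast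
    have T: "finite T" "T \<subseteq> range e" "v \<in> span T"
      unfolding T0(3) by (rule T0, rule T0, intro span_sum span_scale span_base)
    then obtain J where J: "finite J" "T = e ` J" using finite_subset_image[of T e UNIV] by auto
    obtain N where N: "J \<subseteq> {..<N}" using finite_nat_iff_bounded J(1) by blast
    have "norm (P n - u) < \<epsilon>" if "N \<le> n" for n
    proof -
      have "e ` J \<subseteq> e ` {..<n}" using N that by force
      then have "v \<in> span (e ` {..<n})" using T(3) J(2) span_mono by blast
      then show ?thesis using best[of v n] v(2) by (simp add: dist_norm norm_minus_commute)
    qed
    then show "\<exists>N. \<forall>n\<ge>N. norm (P n - u) < \<epsilon>" by blast
  qed
  then show ?thesis by (simp add: sums_def P_def[abs_def])
qed

section \<open>Fractional powers in sine coefficients\<close>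

lemma sine_expansion: "(\<lambda>k. (u \<bullet> sin_l2 k) *\<^sub>R sin_l2 k) sums u"
  by (rule orthonormal_expansion) (auto simp: inner_sin_l2 cl_span_UNIV)

lemma sine_Parseval: "(\<lambda>k. (u \<bullet> sin_l2 k)\<^sup>2) sums (norm u)\<^sup>2"
  using bounded_linear.sums[OF bounded_linear_inner_right sine_expansion, of u u]
  by (simp add: power2_norm_eq_inner) (simp add: power2_eq_square)

text \<open>Independence of the eigenbasis: by symmetry \<open>e k\<close> is orthogonal to
  \<open>sin_l2 j\<close> unless their eigenvalues agree, so in every product
  \<open>e k \<bullet> sin_l2 j\<close> the factor \<open>\<mu> k powr r\<close> may be replaced by
  \<open>eig j powr r\<close>.\<close>

lemma frac_power_iff:
  "frac_power A_H r u w \<longleftrightarrow> (\<forall>k. w \<bullet> sin_l2 k = eig k powr r * (u \<bullet> sin_l2 k))"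
proof
  assume "frac_power A_H r u w"
  then obtain e \<mu> where e: "eigenbasis A_H e \<mu>"
    and w: "(\<lambda>k. (\<mu> k powr r * (u \<bullet> e k)) *\<^sub>R e k) sums w"
    unfolding frac_power_def by blast
  have u: "(\<lambda>k. (u \<bullet> e k) *\<^sub>R e k) sums u"
    using e by (intro orthonormal_expansion) (auto simp: eigenbasis_def)
  show "\<forall>k. w \<bullet> sin_l2 k = eig k powr r * (u \<bullet> sin_l2 k)"
  proof
    fix j
    have eq: "\<mu> k powr r * (e k \<bullet> sin_l2 j) = eig j powr r * (e k \<bullet> sin_l2 j)" for k
    proof -
      have "A_H (e k) (\<mu> k *\<^sub>R e k)" using e by (simp add: eigenbasis_def)
      from A_H_symmetric[OF this A_H_sin_l2[of j]] have "\<mu> k * (e k \<bullet> sin_l2 j) = eig j * (e k \<bullet> sin_l2 j)" by simp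
      then show ?thesis by auto
    qed
    have "(\<lambda>k. ((\<mu> k powr r * (u \<bullet> e k)) *\<^sub>R e k) \<bullet> sin_l2 j) sums (w \<bullet> sin_l2 j)"
      by (rule bounded_linear.sums[OF bounded_linear_inner_left w])
    moreover have "((\<mu> k powr r * (u \<bullet> e k)) *\<^sub>R e k) \<bullet> sin_l2 j
        = eig j powr r * (((u \<bullet> e k) *\<^sub>R e k) \<bullet> sin_l2 j)" for k
      using eq[of k] by (simp add: algebra_simps)
    ultimately have "(\<lambda>k. eig j powr r * (((u \<bullet> e k) *\<^sub>R e k) \<bullet> sin_l2 j)) sums (w \<bullet> sin_l2 j)"
      by (simp only:)
    moreover have "(\<lambda>k. eig j powr r * (((u \<bullet> e k) *\<^sub>R e k) \<bullet> sin_l2 j)) sums (eig j powr r * (u \<bullet> sin_l2 j))"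
      by (intro sums_mult bounded_linear.sums[OF bounded_linear_inner_left u])
    ultimately show "w \<bullet> sin_l2 j = eig j powr r * (u \<bullet> sin_l2 j)" by (rule sums_unique2)
  qed
next
  assume "\<forall>k. w \<bullet> sin_l2 k = eig k powr r * (u \<bullet> sin_l2 k)"
  then show "frac_power A_H r u w"
    using sine_expansion[of w] eigenbasis_sin_l2 unfolding frac_power_def by auto
qed

lemma V_H_iff: "u \<in> V_H r \<longleftrightarrow> (\<exists>w. \<forall>k. w \<bullet> sin_l2 k = eig k powr r * (u \<bullet> sin_l2 k))"
  by (simp add: V_H_def frac_power_iff)

lemma V_norm_eq:
  assumes "\<And>k. w \<bullet> sin_l2 k = eig k powr r * (u \<bullet> sin_l2 k)" shows "V_norm r u = norm w"
proof -
  have "(THE w. frac_power A_H r u w) = w"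
    unfolding frac_power_iff using assms by (intro the_equality inner_sines_eqI) auto
  then show ?thesis by (simp add: V_norm_def)
qed

lemma V_H_diff:
  assumes "u \<in> V_H r" "v \<in> V_H r" shows "u - v \<in> V_H r"
proof -
  obtain w z where "\<And>k. w \<bullet> sin_l2 k = eig k powr r * (u \<bullet> sin_l2 k)" "\<And>k. z \<bullet> sin_l2 k = eig k powr r * (v \<bullet> sin_l2 k)"
    using assms unfolding V_H_iff by blast
  then show ?thesis unfolding V_H_iff by (intro exI[of _ "w - z"]) (simp add: algebra_simps)
qed

lemma V_uminus:
  assumes "u \<in> V_H r" shows "- u \<in> V_H r" "V_norm r (- u) = V_norm r u"
proof -
  obtain w where w: "\<And>k. w \<bullet> sin_l2 k = eig k powr r * (u \<bullet> sin_l2 k)"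
    using assms unfolding V_H_iff by blast
  then have m: "\<And>k. (- w) \<bullet> sin_l2 k = eig k powr r * ((- u) \<bullet> sin_l2 k)" by simp
  show "- u \<in> V_H r" unfolding V_H_iff using m by blast
  show "V_norm r (- u) = V_norm r u"
    by (simp add: V_norm_eq[OF w] V_norm_eq[OF m])
qed

text \<open>Absolute summability makes the sine series converge uniformly, which avoids the completeness of
  \<open>l2\<close>.\<close>

lemma summable_coefficients:
  assumes c: "summable (\<lambda>k. \<bar>c k\<bar>)"
  obtains w where "\<And>k. w \<bullet> sin_l2 k = c k"
proof -
  define F where "F n x = (\<Sum>k<n. c k * sine k x)" for n x
  have term_le: "norm (c k * sine k x) \<le> \<bar>c k\<bar> * sqrt 2" for k x
    using abs_sine_le[of k x] by (simp add: abs_mult mult_left_mono)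
  have sm: "summable (\<lambda>k. c k * sine k x)" for x
    by (rule summable_comparison_test'[OF summable_mult2[OF c, of "sqrt 2"]]) (rule term_le)
  have lim: "(\<lambda>n. F n x) \<longlonglongrightarrow> (\<Sum>k. c k * sine k x)" for x
    unfolding F_def using summable_LIMSEQ[OF sm] .
  have sF: "sq_int (F n)" for n unfolding F_def by (intro sq_int_sum sq_int_scale) simp
  then have mF: "F n \<in> borel_measurable unit_leb" for n by (simp add: sq_int_def)
  have bd: "\<bar>F n x\<bar> \<le> (\<Sum>k. \<bar>c k\<bar>) * sqrt 2" for n x
  proof -
    have "\<bar>F n x\<bar> \<le> (\<Sum>k<n. norm (c k * sine k x))" unfolding F_def real_norm_def by (rule sum_abs)
    also have "\<dots> \<le> (\<Sum>k<n. \<bar>c k\<bar> * sqrt 2)" by (intro sum_mono term_le)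
    also have "\<dots> \<le> (\<Sum>k. \<bar>c k\<bar>) * sqrt 2"
      unfolding sum_distrib_right[symmetric] using c by (intro mult_right_mono sum_le_suminf) auto
    finally show ?thesis .
  qed
  define w where "w = abs_l2 (\<lambda>x. \<Sum>k. c k * sine k x)"
  have conv: "(\<lambda>n. abs_l2 (F n)) \<longlonglongrightarrow> w"
    unfolding w_def
    by (rule l2_dominated_convergence(2)[OF mF borel_measurable_LIMSEQ_real[OF lim mF] sq_int_const])
      (use lim bd in auto)
  have FS: "abs_l2 (F n) = (\<Sum>k<n. c k *\<^sub>R sin_l2 k)" for n
    unfolding F_def by (simp add: abs_l2_sum abs_l2_scale sq_int_scale)
  have "w \<bullet> sin_l2 j = c j" for j
  proof -
    have "(\<lambda>n. abs_l2 (F n) \<bullet> sin_l2 j) \<longlonglongrightarrow> w \<bullet> sin_l2 j" by (intro tendsto_intros conv)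
    moreover have "\<forall>\<^sub>F n in sequentially. abs_l2 (F n) \<bullet> sin_l2 j = c j"
      using eventually_gt_at_top[of j]
      by eventually_elim (simp add: FS inner_sum_left inner_sin_l2 if_distrib[of "\<lambda>x. _ * x"] cong: if_cong)
    then have "(\<lambda>n. abs_l2 (F n) \<bullet> sin_l2 j) \<longlonglongrightarrow> c j" by (rule tendsto_eventually)
    ultimately show ?thesis by (rule LIMSEQ_unique)
  qed
  then show thesis by (rule that)
qed

section \<open>Gronwall's inequality and the reaction term\<close>


text \<open>Cousin's lemma yields a tagged division that is fine for a gauge with values inside a small open
  neighbourhood of \<open>N\<close> at the points of \<open>N\<close>: absolute continuity controls the intervals tagged in \<open>N\<close>,
  the sign of the derivative the others.\<close>

lemma abs_cont_nonincreasing: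
  fixes F :: "real \<Rightarrow> real" and U :: "real \<Rightarrow> 'a::metric_space"
  assumes ab: "a \<le> b" and U: "abs_cont_on {a..b} U" and K: "0 \<le> K"
    and F: "\<And>x y. a \<le> x \<Longrightarrow> x \<le> y \<Longrightarrow> y \<le> b \<Longrightarrow> F y - F x \<le> K * (dist (U x) (U y) + (y - x))"
    and N: "negligible N"
    and D: "\<And>t. t \<in> {a..b} - N \<Longrightarrow> \<exists>D\<le>0. (F has_field_derivative D) (at t)"
  shows "F b \<le> F a"
proof -
  have main: "F b - F a \<le> \<epsilon> * (2 * K + (b - a))" if \<epsilon>: "0 < \<epsilon>" for \<epsilon>
  proof -
    obtain \<delta> where \<delta>: "0 < \<delta>" and AC: "\<And>(n::nat) A B.
        (\<forall>i<n. A i \<le> B i \<and> {A i..B i} \<subseteq> {a..b}) \<Longrightarrow>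
        disjoint_family_on (\<lambda>i. {A i<..<B i}) {..<n} \<Longrightarrow> (\<Sum>i<n. B i - A i) < \<delta> \<Longrightarrow>
        (\<Sum>i<n. dist (U (A i)) (U (B i))) < \<epsilon>"
    proof -
      from U have "\<forall>\<epsilon>>0. \<exists>\<delta>>0. \<forall>(n::nat) A B.
        (\<forall>i<n. A i \<le> B i \<and> {A i..B i} \<subseteq> {a..b}) \<and>
        disjoint_family_on (\<lambda>i. {A i<..<B i}) {..<n} \<and> (\<Sum>i<n. B i - A i) < \<delta> \<longrightarrow>
        (\<Sum>i<n. dist (U (A i)) (U (B i))) < \<epsilon>"
        unfolding abs_cont_on_def .
      from this[rule_format, OF \<epsilon>] show thesis by (elim exE conjE) (rule that, auto)
    qed
    \<comment> \<open>Measure below \<open>\<delta>\<close> activates absolute continuity of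
      \<open>U\<close>; measure below \<open>\<epsilon>\<close> controls the summands
      \<open>y - x\<close> in the bound on \<open>F\<close>.\<close>
    have "0 < min \<delta> \<epsilon>" using \<delta> \<epsilon> by simp
    then obtain T where T: "open T" "N \<subseteq> T" "(T - N) \<in> lmeasurable"
        "emeasure lebesgue (T - N) < ennreal (min \<delta> \<epsilon>)"
      by (rule sets_lebesgue_outer_open[OF negligible_imp_sets[OF N]]) (rule that)
    have TN: "T = (T - N) \<union> N" using T(2) by blast
    have TL: "T \<in> lmeasurable"
      by (subst TN) (intro fmeasurable.Un T(3) negligible_imp_measurable N)
    have mT: "measure lebesgue T < min \<delta> \<epsilon>"
    proof -
      have "measure lebesgue T \<le> measure lebesgue (T - N) + measure lebesgue N"
        by (subst TN) (intro measure_Un_le fmeasurableD T(3) negligible_imp_measurable N)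
      moreover have "measure lebesgue N = 0" using N by (simp add: negligible_imp_measure0)
      moreover have "measure lebesgue (T - N) < min \<delta> \<epsilon>"
        using T(4) emeasure_eq_measure2[OF T(3)] by (simp only: ennreal_less_iff[OF measure_nonneg])
      ultimately show ?thesis by linarith
    qed
    have "\<exists>d>0. \<forall>y. \<bar>y - t\<bar> < d \<longrightarrow> (t \<le> y \<longrightarrow> F y - F t \<le> \<epsilon> * (y - t)) \<and> (y \<le> t \<longrightarrow> F t - F y \<le> \<epsilon> * (t - y))"
      if t: "t \<in> {a..b} - N" for t
    proof -
      obtain E where E: "E \<le> 0" "(F has_field_derivative E) (at t)" using D[OF t] by blast
      from E(2) have "(F has_derivative (\<lambda>h. E * h)) (at t)" by (simp add: has_field_derivative_def)
      then obtain d where d: "0 < d" "\<And>y. norm (y - t) < d \<Longrightarrow> norm (F y - F t - E * (y - t)) \<le> \<epsilon> * norm (y - t)"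
        using \<epsilon> unfolding has_derivative_at_alt by blast
      have "(t \<le> y \<longrightarrow> F y - F t \<le> \<epsilon> * (y - t)) \<and> (y \<le> t \<longrightarrow> F t - F y \<le> \<epsilon> * (t - y))"
        if "\<bar>y - t\<bar> < d" for y
      proof (intro conjI impI)
        have *: "\<bar>F y - F t - E * (y - t)\<bar> \<le> \<epsilon> * \<bar>y - t\<bar>" using d(2)[of y] that by simp
        show "F y - F t \<le> \<epsilon> * (y - t)" if "t \<le> y"
        proof -
          have "E * (y - t) \<le> 0" using E(1) that by (simp add: mult_nonpos_nonneg)
          then show ?thesis using * that by simp
        qed
        show "F t - F y \<le> \<epsilon> * (t - y)" if "y \<le> t"
        proof -
          have "0 \<le> E * (y - t)" using E(1) that by (simp add: mult_nonpos_nonpos)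
          then show ?thesis using * that by simp
        qed
      qed
      with d(1) show ?thesis by blast
    qed
    then obtain d where d: "\<And>t. t \<in> {a..b} - N \<Longrightarrow> 0 < d t"
      "\<And>t y. t \<in> {a..b} - N \<Longrightarrow> \<bar>y - t\<bar> < d t \<Longrightarrow>
        (t \<le> y \<longrightarrow> F y - F t \<le> \<epsilon> * (y - t)) \<and> (y \<le> t \<longrightarrow> F t - F y \<le> \<epsilon> * (t - y))" by metis
    \<comment> \<open>Outside N and {a..b} the gauge takes a default value; no tag lies
      there.\<close>
    define \<gamma> where "\<gamma> t = (if t \<in> N then T else if t \<in> {a..b} then ball t (d t) else UNIV)" for t
    have "gauge \<gamma>"
      using T(1,2) d(1) by (auto simp: gauge_def \<gamma>_def)
    then obtain p where p: "p tagged_division_of {a..b}" "\<gamma> fine p"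
      using fine_division_exists_real by blast
    have fin: "finite p" using p(1) by (rule tagged_division_ofD(1))
    have pk: "x \<in> {a..b} \<and> Inf k \<le> x \<and> x \<le> Sup k \<and> k = {Inf k..Sup k} \<and> k \<subseteq> {a..b} \<and> k \<subseteq> \<gamma> x" if xk: "(x, k) \<in> p" for x k
    proof -
      have 1: "x \<in> k" "k \<subseteq> {a..b}" using tagged_division_ofD(2,3)[OF p(1) that] by auto
      obtain u v where "k = cbox u v" using tagged_division_ofD(4)[OF p(1) xk] by blast
      then have "k = {u..v}" "u \<le> v" using 1 by auto
      then show ?thesis using 1 fineD[OF p(2) that] by auto
    qed
    let ?f = "\<lambda>(x, k). F (Sup k) - F (Inf k)"
    define p1 where "p1 = {q \<in> p. fst q \<in> N}"
    define p2 where "p2 = {q \<in> p. fst q \<notin> N}"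
    have pp: "p = p1 \<union> p2" "p1 \<inter> p2 = {}" "finite p1" "finite p2" using fin by (auto simp: p1_def p2_def)
    have "F b - F a = sum ?f p"
      using additive_tagged_division_1[OF ab p(1), of F] by simp
    also have "\<dots> = sum ?f p1 + sum ?f p2" unfolding pp(1) by (rule sum.union_disjoint[OF pp(3,4,2)])
    also have "sum ?f p2 \<le> \<epsilon> * (b - a)"
    proof -
      have "sum ?f p2 \<le> (\<Sum>(x, k)\<in>p2. \<epsilon> * (Sup k - Inf k))"
      proof (rule sum_mono, clarify)
        fix x k assume "(x, k) \<in> p2"
        then have xk: "(x, k) \<in> p" "x \<notin> N" by (auto simp: p2_def)
        have x: "x \<in> {a..b} - N" using pk[OF xk(1)] xk(2) by blast
        have "Inf k \<in> k" "Sup k \<in> k" using pk[OF xk(1)] by auto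
        then have "Inf k \<in> ball x (d x)" "Sup k \<in> ball x (d x)"
          using pk[OF xk(1)] x by (auto simp: \<gamma>_def)
        then have "F (Sup k) - F x \<le> \<epsilon> * (Sup k - x)" "F x - F (Inf k) \<le> \<epsilon> * (x - Inf k)"
          using d(2)[OF x, of "Sup k"] d(2)[OF x, of "Inf k"] pk[OF xk(1)] by (auto simp: dist_real_def)
        then show "F (Sup k) - F (Inf k) \<le> \<epsilon> * (Sup k - Inf k)" by (simp add: algebra_simps)
      qed
      also have "\<dots> \<le> (\<Sum>(x, k)\<in>p. \<epsilon> * (Sup k - Inf k))"
      proof (rule sum_mono2[OF fin])
        show "p2 \<subseteq> p" by (auto simp: p2_def)
        show "0 \<le> (case q of (x, k) \<Rightarrow> \<epsilon> * (Sup k - Inf k))" if "q \<in> p - p2" for q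
          using that pk[of "fst q" "snd q"] \<epsilon> by (auto simp: case_prod_beta)
      qed
      also have "\<dots> = \<epsilon> * (b - a)"
        using additive_tagged_division_1[OF ab p(1), of "\<lambda>x. x"]
        by (simp add: case_prod_beta sum_distrib_left[symmetric])
      finally show ?thesis .
    qed
    also have "sum ?f p1 \<le> K * (\<epsilon> + \<epsilon>)"
    proof -
      \<comment> \<open>\<open>abs_cont_on\<close> speaks of families indexed by an initial segment
        of the naturals, so the intervals tagged in N are enumerated.\<close>
      obtain e where e: "bij_betw e {..<card p1} p1"
        using ex_bij_betw_nat_finite[OF pp(3)] by (auto simp: atLeast0LessThan)
      define n A B where "n = card p1" and "A i = Inf (snd (e i))" and "B i = Sup (snd (e i))" for i
      have ei: "e i \<in> p" "fst (e i) \<in> N" if "i < n" for i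
        using bij_betwE[OF e] that by (auto simp: n_def p1_def)
      have AB: "A i \<le> B i" "{A i..B i} \<subseteq> {a..b}" "{A i..B i} \<subseteq> T" "snd (e i) = {A i..B i}" if "i < n" for i
      proof -
        have pi: "(fst (e i), snd (e i)) \<in> p" using ei(1)[OF that] by simp
        show "A i \<le> B i" "{A i..B i} \<subseteq> {a..b}" "{A i..B i} \<subseteq> T" "snd (e i) = {A i..B i}"
          using pk[OF pi] ei(2)[OF that] by (auto simp: A_def B_def \<gamma>_def)
      qed
      have disj: "disjoint_family_on (\<lambda>i. {A i<..<B i}) {..<n}"
        unfolding disjoint_family_on_def
      proof (intro ballI impI)
        fix i j assume ij: "i \<in> {..<n}" "j \<in> {..<n}" "i \<noteq> j"
        then have "e i \<noteq> e j" using bij_betw_imp_inj_on[OF e] by (auto simp: n_def inj_on_def)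
        then have "(fst (e i), snd (e i)) \<noteq> (fst (e j), snd (e j))" by (metis prod.collapse)
        moreover have "(fst (e i), snd (e i)) \<in> p" "(fst (e j), snd (e j)) \<in> p" using ij ei by auto
        ultimately have "interior (snd (e i)) \<inter> interior (snd (e j)) = {}"
          using tagged_division_ofD(5)[OF p(1)] by metis
        then show "{A i<..<B i} \<inter> {A j<..<B j} = {}"
          using ij AB(4) by (simp add: interior_atLeastAtMost_real)
      qed
      have len: "(\<Sum>i<n. B i - A i) \<le> measure lebesgue T"
      proof -
        have "(\<Sum>i<n. B i - A i) = (\<Sum>i<n. measure lebesgue {A i<..<B i})"
          using AB(1) by (intro sum.cong) auto
        also have "\<dots> = measure lebesgue (\<Union>i<n. {A i<..<B i})"
          by (rule measure_finite_Union[symmetric]) (use disj fmeasurableD2[OF lmeasurable_box[of "A _" "B _ :: real"]] in auto)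
        also have "\<dots> \<le> measure lebesgue T"
        proof (rule measure_mono_fmeasurable)
          have "{A i<..<B i} \<subseteq> T" if "i < n" for i
            using AB(3)[OF that] greaterThanLessThan_subseteq_atLeastAtMost_iff[of "A i" "B i" "A i" "B i"] by auto
          then show "(\<Union>i<n. {A i<..<B i}) \<subseteq> T" by blast
        qed (use TL in auto)
        finally show ?thesis .
      qed
      have small: "(\<Sum>i<n. dist (U (A i)) (U (B i))) < \<epsilon>"
        using AB(1,2) disj len mT by (intro AC) auto
      have "sum ?f p1 = (\<Sum>i<n. F (B i) - F (A i))"
        using sum.reindex_bij_betw[OF e, of ?f] by (simp add: case_prod_beta n_def A_def B_def)
      also have "\<dots> \<le> (\<Sum>i<n. K * (dist (U (A i)) (U (B i)) + (B i - A i)))"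
        using AB(1,2) by (intro sum_mono F) auto
      also have "\<dots> = K * ((\<Sum>i<n. dist (U (A i)) (U (B i))) + (\<Sum>i<n. B i - A i))"
        by (simp only: sum_distrib_left[symmetric] sum.distrib)
      also have "\<dots> \<le> K * (\<epsilon> + \<epsilon>)"
        using small len mT K by (intro mult_left_mono add_mono) auto
      finally show ?thesis .
    qed
    finally show ?thesis by (simp add: algebra_simps)
  qed
  have "F b - F a \<le> 0 + e" if e: "0 < e" for e
  proof -
    \<comment> \<open>The added 1 keeps the divisor positive also for K = 0 and a = b.\<close>
    have pos: "0 < 2 * K + (b - a) + 1" using K ab by linarith
    have "F b - F a \<le> e / (2 * K + (b - a) + 1) * (2 * K + (b - a))"
      using e pos by (intro main) simp
    also have "\<dots> \<le> e" using e pos by (simp add: field_simps)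
    finally show ?thesis by simp
  qed
  then have "F b - F a \<le> 0" by (rule field_le_epsilon)
  then show ?thesis by simp
qed

text \<open>Let m = min x (1 - x). Where the product is positive, |z| >= x (1 - x)/4 >= m/8, hence 2
  m |z| <= 16 z^2. For m < 1/32 the bound z^2 <= m E turns this into 2 |z| <= 16 E; for m >= 1/32 it
  reads 2 |z| <= 512 z^2. The layers near the boundary are so thin that they contribute at most E,
  which is all that the dissipation can absorb.\<close>

lemma reaction_energy_bound:
  assumes A: "A_H z f"
    and G: "AE x in unit_leb. rep_l2 G x * rep_l2 z x \<le> 2 * \<bar>rep_l2 z x\<bar> \<and>
      (x * (1 - x) / 4 \<le> \<bar>rep_l2 z x\<bar> \<or> rep_l2 G x * rep_l2 z x \<le> 0)"
  shows "G \<bullet> z \<le> f \<bullet> z + 512 * (norm z)\<^sup>2"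
proof -
  obtain E where E: "0 \<le> E" "f \<bullet> z = E" "AE x in unit_leb. (rep_l2 z x)\<^sup>2 \<le> x * E"
    "AE x in unit_leb. (rep_l2 z x)\<^sup>2 \<le> (1 - x) * E"
    using A by (rule A_H_energy) (rule that)
  \<comment> \<open>The two layers have total measure 1/16, so that 16 E times \<open>L\<close>
    integrates to exactly E.\<close>
  define L where "L x = (indicator {0<..<1/32} x + indicator {31/32<..<1} x :: real)" for x :: real
  have Li: "integrable unit_leb (indicator {0<..<1/32} :: real \<Rightarrow> real)"
    "integrable unit_leb (indicator {31/32<..<1} :: real \<Rightarrow> real)"
    by (auto simp: integrable_indicator_iff sets_restrict_space_iff emeasure_restrict_space subset_eq)
  have "measure unit_leb {0<..<1/32} = 1/32" "measure unit_leb {31/32<..<1} = 1/32"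
    by (subst measure_restrict_space; auto)+
  then have Lint: "(LINT x|unit_leb. L x) = 1/16"
    unfolding L_def using Li by (simp add: Bochner_Integration.integral_indicator max_absorb1 min_absorb1)
  have zi: "integrable unit_leb (\<lambda>x. (rep_l2 z x)\<^sup>2)"
    using sq_int_rep_l2[of z] unfolding sq_int_def by blast
  have "G \<bullet> z = (LINT x|unit_leb. rep_l2 G x * rep_l2 z x)" by (rule inner_l2_rep)
  also have "\<dots> \<le> (LINT x|unit_leb. 16 * E * L x + 512 * (rep_l2 z x)\<^sup>2)"
  proof (rule integral_mono_AE)
    show "integrable unit_leb (\<lambda>x. rep_l2 G x * rep_l2 z x)" by (intro sq_int_mult sq_int_rep_l2)
    show "integrable unit_leb (\<lambda>x. 16 * E * L x + 512 * (rep_l2 z x)\<^sup>2)"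
      unfolding L_def using Li zi by simp
    show "AE x in unit_leb. rep_l2 G x * rep_l2 z x \<le> 16 * E * L x + 512 * (rep_l2 z x)\<^sup>2"
      using G E(3,4) AE_space
    proof eventually_elim
      case (elim x)
      let ?z = "rep_l2 z x"
      have x: "0 < x" "x < 1" using elim(4) by auto
      have L0: "0 \<le> L x" by (simp add: L_def)
      have nn: "0 \<le> 16 * E * L x" "0 \<le> 512 * ?z\<^sup>2" using E(1) L0 by auto
      show ?case
      proof (cases "rep_l2 G x * ?z \<le> 0")
        case True
        then show ?thesis using nn by linarith
      next
        case False
        define m where "m = min x (1 - x)"
        have m: "0 < m" "m \<le> 1/2" using x by (auto simp: m_def min_def)
        have "m / 2 \<le> x * (1 - x)"
        proof (cases "x \<le> 1/2")
          case True
          then have "x * (1/2) \<le> x * (1 - x)" using x by (intro mult_left_mono) auto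
          then show ?thesis using True by (simp add: m_def min_def)
        next
          case False
          then have "(1/2) * (1 - x) \<le> x * (1 - x)" using x by (intro mult_right_mono) auto
          then show ?thesis using False by (simp add: m_def min_def)
        qed
        then have mz: "m / 8 \<le> \<bar>?z\<bar>" using elim(1) False by linarith
        have sq: "m * (2 * \<bar>?z\<bar>) \<le> 16 * ?z\<^sup>2"
        proof -
          have "(m / 8) * \<bar>?z\<bar> \<le> \<bar>?z\<bar> * \<bar>?z\<bar>" using mz by (intro mult_right_mono) auto
          then show ?thesis by (simp add: power2_eq_square abs_mult_self_eq)
        qed
        show ?thesis
        proof (cases "m < 1/32")
          case True
          then have L1: "1 \<le> L x" using x by (auto simp: L_def m_def min_def indicator_def split: if_splits)
          have "?z\<^sup>2 \<le> m * E" using elim(2,3) by (auto simp: m_def min_def)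
          then have "m * (2 * \<bar>?z\<bar>) \<le> m * (16 * E)" using sq by linarith
          then have "2 * \<bar>?z\<bar> \<le> 16 * E" using m(1) by (simp only: mult_le_cancel_left_pos)
          also have "\<dots> \<le> 16 * E * L x" using mult_left_mono[OF L1, of "16 * E"] E(1) by simp
          finally show ?thesis using elim(1) nn by linarith
        next
          case False
          then have "1/32 * (2 * \<bar>?z\<bar>) \<le> m * (2 * \<bar>?z\<bar>)" by (intro mult_right_mono) auto
          then have "2 * \<bar>?z\<bar> \<le> 512 * ?z\<^sup>2" using sq by linarith
          then show ?thesis using elim(1) nn by linarith
        qed
      qed
    qed
  qed
  also have "\<dots> = 16 * E * (LINT x|unit_leb. L x) + 512 * (LINT x|unit_leb. (rep_l2 z x)\<^sup>2)"
    unfolding L_def using Li zi by simp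
  also have "\<dots> = E + 512 * (norm z)\<^sup>2"
    by (simp add: Lint norm_l2_squared)
  finally show ?thesis using E(2) by simp
qed

section \<open>The linear heat flow\<close>


definition profile :: "real \<Rightarrow> real"
  where "profile x = - (x\<^sup>2 / 2) + x / 2"

definition one_l2 :: l2
  where "one_l2 = abs_l2 (\<lambda>x. 1)"

lemma v1_plus_eq: "v1_plus = abs_l2 profile"
  by (simp add: v1_plus_def profile_def[abs_def])

lemma smooth_profile: "smooth profile"
proof -
  have "smooth (\<lambda>x. (- (1/2)) * (x * x) + (1/2) * x)" by (intro smooth.intros)
  then show ?thesis by (simp add: profile_def[abs_def] power2_eq_square)
qed

lemma profile_sq_int: "sq_int profile"
  by (rule smooth_sq_int[OF smooth_profile])

lemma A_H_v1_plus: "A_H v1_plus one_l2"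
proof -
  have 1: "deriv profile = (\<lambda>x. - x + 1 / 2)"
    by (intro ext DERIV_imp_deriv) (auto simp: profile_def[abs_def] intro!: derivative_eq_intros)
  have 2: "deriv (deriv profile) = (\<lambda>x. - 1)"
    unfolding 1 by (intro ext DERIV_imp_deriv) (auto intro!: derivative_eq_intros)
  have "abs_l2 (\<lambda>x. - 1) = - one_l2"
    unfolding one_l2_def by (rule abs_l2_uminus) (rule sq_int_const)
  moreover have "profile 0 = 0" "profile 1 = 0" by (simp_all add: profile_def)
  ultimately show ?thesis
    using A_H_smooth[OF smooth_profile] by (simp add: v1_plus_eq 2)
qed

lemma eig_eq_powr: "eig k = (real (Suc k) * pi) powr 2"
  by (simp add: eig_def)

lemma summable_freq_powr:
  assumes "s < -1" shows "summable (\<lambda>k. (real (Suc k) * pi) powr s)"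
proof -
  have "summable (\<lambda>n. real (Suc n) powr s)"
    using assms by (subst summable_Suc_iff) (simp add: summable_real_powr_iff)
  then have "summable (\<lambda>n. real (Suc n) powr s * pi powr s)" by (rule summable_mult2)
  then show ?thesis by (simp add: powr_mult)
qed

text \<open>The exact coefficient is sqrt 2 (1 - cos c)/c at frequency c; each of the two factors in
  the numerator is at most 2.\<close>

lemma one_inner_sine: "\<bar>one_l2 \<bullet> sin_l2 k\<bar> \<le> 4 * (real (Suc k) * pi) powr (- 1)"
proof -
  define c where "c = real (Suc k) * pi"
  have c: "0 < c" by (simp add: c_def)
  have sine: "sine k = (\<lambda>x. sqrt 2 * sin (c * x))" by (simp add: sine_def[abs_def] c_def)
  have "one_l2 \<bullet> sin_l2 k = (LINT x|unit_leb. 1 * sine k x)"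
    unfolding one_l2_def by (rule inner_abs_l2) (auto intro: sq_int_const)
  also have "\<dots> = - sqrt 2 * cos (c * 1) / c - (- sqrt 2 * cos (c * 0) / c)"
    using c by (intro integral_unit_FTC)
      (auto simp: sine intro!: continuous_intros derivative_eq_intros)
  also have "\<dots> = sqrt 2 * (1 - cos c) / c" by (simp add: diff_divide_distrib right_diff_distrib)
  finally have "\<bar>one_l2 \<bullet> sin_l2 k\<bar> = sqrt 2 * \<bar>1 - cos c\<bar> / c" using c by (simp add: abs_mult)
  also have "\<dots> \<le> 2 * 2 / c"
    using c cos_ge_minus_one[of c] cos_le_one[of c] real_sqrt_le_mono[of 2 4]
    by (intro divide_right_mono mult_mono) auto
  finally have "\<bar>one_l2 \<bullet> sin_l2 k\<bar> \<le> 4 * c powr (- 1)"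
    using c by (simp add: powr_minus divide_inverse)
  then show ?thesis by (simp only: c_def)
qed

text \<open>The coefficients of \<open>v1_plus\<close> are those of its image \<open>one_l2\<close>
  divided by the eigenvalue, hence of order c^(-3) in the frequency c. Multiplied by c^(2r) they
  remain absolutely summable for r < 1.\<close>

lemma v1_plus_in_V_H:
  assumes "r < 1" shows "v1_plus \<in> V_H r"
proof -
  have bound: "norm (\<bar>eig k powr r * (v1_plus \<bullet> sin_l2 k)\<bar>) \<le> 4 * (real (Suc k) * pi) powr (2 * r - 3)" for k
  proof -
    define c where "c = real (Suc k) * pi"
    have c: "0 < c" by (simp add: c_def)
    have e: "eig k = c powr 2" by (simp add: eig_eq_powr c_def)
    have "one_l2 \<bullet> sin_l2 k = eig k * (v1_plus \<bullet> sin_l2 k)"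
      using A_H_symmetric[OF A_H_v1_plus A_H_sin_l2[of k]] by simp
    then have "v1_plus \<bullet> sin_l2 k = c powr (- 2) * (one_l2 \<bullet> sin_l2 k)"
      using c by (simp add: e powr_minus)
    then have "eig k powr r * (v1_plus \<bullet> sin_l2 k) = c powr (2 * r - 2) * (one_l2 \<bullet> sin_l2 k)"
      by (simp add: e powr_powr powr_add[symmetric] mult.assoc[symmetric])
    then have "norm (\<bar>eig k powr r * (v1_plus \<bullet> sin_l2 k)\<bar>) = c powr (2 * r - 2) * \<bar>one_l2 \<bullet> sin_l2 k\<bar>"
      by (simp add: abs_mult)
    also have "\<dots> \<le> c powr (2 * r - 2) * (4 * c powr (- 1))"
      using one_inner_sine[of k] by (intro mult_left_mono) (simp_all add: c_def)
    also have "\<dots> = 4 * c powr ((2 * r - 2) + (- 1))"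
      unfolding powr_add by (rule mult.left_commute)
    also have "(2 * r - 2) + (- 1) = 2 * r - 3" by simp
    finally show ?thesis by (simp only: c_def)
  qed
  have "summable (\<lambda>k. 4 * (real (Suc k) * pi) powr (2 * r - 3))"
    using assms by (intro summable_mult summable_freq_powr) simp
  then have "summable (\<lambda>k. \<bar>eig k powr r * (v1_plus \<bullet> sin_l2 k)\<bar>)"
    by (rule summable_comparison_test'[where N = 0]) (rule bound)
  then obtain w where "\<And>k. w \<bullet> sin_l2 k = eig k powr r * (v1_plus \<bullet> sin_l2 k)"
    by (rule summable_coefficients[where c = "\<lambda>k. eig k powr r * (v1_plus \<bullet> sin_l2 k)"]) (rule that)
  then show ?thesis unfolding V_H_iff by blast
qed

lemma fixed_point_v1_plus: "fixed_point v1_plus"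
proof -
  have m: "(\<lambda>t. one_l2) \<in> borel_measurable (lebesgue_on {0<..<T})" for T :: real by simp
  have i: "integrable (lebesgue_on {0<..<T}) (\<lambda>t. (norm one_l2)\<^sup>2)" for T :: real
    by (intro finite_measure.integrable_const finite_measureI)
      (use fmeasurableD2[OF lmeasurable_box[of 0 T]] in \<open>simp add: emeasure_restrict_space\<close>)
  have "AE x in unit_leb. rep_l2 one_l2 x = 1"
    unfolding one_l2_def by (rule rep_abs_l2) (rule sq_int_const)
  moreover have "AE x in unit_leb. rep_l2 v1_plus x = profile x"
    unfolding v1_plus_eq by (rule rep_abs_l2) (rule profile_sq_int)
  ultimately have h: "AE x in unit_leb. rep_l2 one_l2 x \<in> H0 (rep_l2 v1_plus x)"
    using AE_space
  proof eventually_elim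
    case (elim x)
    have "profile x = x * (1 - x) / 2" by (simp add: profile_def power2_eq_square algebra_simps)
    moreover have "0 < x * (1 - x)" using elim by simp
    ultimately have "0 < profile x" by linarith
    then show ?case using elim by (simp add: H0_def)
  qed
  show ?thesis
    unfolding fixed_point_def strong_solution_def
  proof (intro conjI exI[of _ "\<lambda>t. one_l2"] allI impI)
    show "AE t in lebesgue_on {0<..}. \<exists>u' f. ((\<lambda>_. v1_plus) has_vector_derivative u') (at t) \<and>
        A_H v1_plus f \<and> u' + f = one_l2"
      by (intro AE_I2 exI[of _ 0] exI[of _ one_l2]) (simp add: A_H_v1_plus)
    show "AE t in lebesgue_on {0<..}. v1_plus \<in> H2 \<inter> H10"
      using A_H_v1_plus by (simp add: A_H_def)
    show "abs_cont_on {T1..T2} (\<lambda>_. v1_plus)" for T1 T2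
      by (auto simp: abs_cont_on_def intro: exI[of _ 1])
  qed (use m i h in auto)
qed

text \<open>Partial sums of the explicit solution $v_1^+ + e^{-tA_H}(u_0 - v_1^+)$ of the linear equation.\<close>

definition heat_sum :: "l2 \<Rightarrow> nat \<Rightarrow> real \<Rightarrow> real \<Rightarrow> real"
  where "heat_sum h N t x = profile x + (\<Sum>k<N. (exp (- eig k * t) * (h \<bullet> sin_l2 k)) * sine k x)"

definition heat_l2 :: "l2 \<Rightarrow> nat \<Rightarrow> real \<Rightarrow> l2"
  where "heat_l2 h N t = v1_plus + (\<Sum>k<N. (exp (- eig k * t) * (h \<bullet> sin_l2 k)) *\<^sub>R sin_l2 k)"

lemma heat_l2_eq: "sq_int (heat_sum h N t)" "heat_l2 h N t = abs_l2 (heat_sum h N t)"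
proof -
  have s: "sq_int (\<lambda>x. \<Sum>k<N. (exp (- eig k * t) * (h \<bullet> sin_l2 k)) * sine k x)"
    by (intro sq_int_sum sq_int_scale sine_sq_int)
  show "sq_int (heat_sum h N t)"
    unfolding heat_sum_def[abs_def] by (intro sq_int_add profile_sq_int s)
  show "heat_l2 h N t = abs_l2 (heat_sum h N t)"
    unfolding heat_sum_def[abs_def] heat_l2_def abs_l2_add[OF profile_sq_int s] v1_plus_eq
    by (simp only: abs_l2_sum abs_l2_scale sq_int_scale sine_sq_int)
qed

text \<open>The sine vanishes at both endpoints, so |sin(c x)| is at most c x and at most c (1 - x).
  Averaging these with weights 1 - x and x gives 2 c x (1 - x), and sqrt 2 is rounded up to
  2.\<close>

lemma abs_sine_le_weight:
  assumes x: "0 < x" "x < 1"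
  shows "\<bar>sine k x\<bar> \<le> 4 * (real (Suc k) * pi) * (x * (1 - x))"
proof -
  define c where "c = real (Suc k) * pi"
  have c: "0 < c" by (simp add: c_def)
  have 1: "\<bar>sin (c * x)\<bar> \<le> c * x"
    using abs_sin_x_le_abs_x[of "c * x"] c x by (simp add: abs_mult)
  have "sin (c * x) = sin (c - c * (1 - x))" by (simp add: algebra_simps)
  also have "\<dots> = - cos c * sin (c * (1 - x))"
    using sin_npi[of "Suc k"] unfolding sin_diff by (simp add: c_def)
  finally have "\<bar>sin (c * x)\<bar> = \<bar>cos c\<bar> * \<bar>sin (c * (1 - x))\<bar>" by (simp add: abs_mult)
  also have "\<dots> \<le> 1 * \<bar>c * (1 - x)\<bar>" by (intro mult_mono abs_sin_x_le_abs_x) auto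
  finally have 2: "\<bar>sin (c * x)\<bar> \<le> c * (1 - x)" using c x by (simp add: abs_mult)
  have "\<bar>sin (c * x)\<bar> = x * \<bar>sin (c * x)\<bar> + (1 - x) * \<bar>sin (c * x)\<bar>" by (simp add: algebra_simps)
  also have "\<dots> \<le> x * (c * (1 - x)) + (1 - x) * (c * x)"
    using x 1 2 by (intro add_mono mult_left_mono) auto
  finally have "\<bar>sin (c * x)\<bar> \<le> 2 * (c * (x * (1 - x)))" by (simp add: algebra_simps)
  moreover have "sqrt 2 \<le> 2" using real_sqrt_le_mono[of 2 4] by simp
  ultimately have "sqrt 2 * \<bar>sin (c * x)\<bar> \<le> 2 * (2 * (c * (x * (1 - x))))"
    by (intro mult_mono) auto
  then show ?thesis by (simp add: sine_def c_def abs_mult mult.assoc)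
qed

text \<open>In terms of \<open>w\<close>, frequency times |h_k| is |w_k| c^(1 - 2r), which explains
  the exponent 2 - 4r after Cauchy-Schwarz. Bessel's inequality bounds every partial sum and the
  exponentials are at most 1, so one \<open>\<gamma>\<close> serves all N and t.\<close>

lemma heat_sum_lower_bound:
  assumes r: "3 / 4 < r"
  obtains \<gamma> where "0 < \<gamma>" "\<And>h w N t x. \<lbrakk>\<And>k. w \<bullet> sin_l2 k = eig k powr r * (h \<bullet> sin_l2 k); norm w \<le> \<gamma>; 0 \<le> t;
      0 < x; x < 1\<rbrakk> \<Longrightarrow> x * (1 - x) / 4 \<le> heat_sum h N t x"
proof -
  define freq where "freq k = real (Suc k) * pi" for k
  have freq: "0 < freq k" for k by (simp add: freq_def)
  have eigf: "eig k = freq k powr 2" for k by (simp add: eig_eq_powr freq_def)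
  have sm: "summable (\<lambda>k. freq k powr (2 - 4 * r))"
    using r unfolding freq_def by (intro summable_freq_powr) simp
  define K where "K = sqrt (\<Sum>k. freq k powr (2 - 4 * r))"
  have K: "0 \<le> K" by (simp add: K_def suminf_nonneg[OF sm])
  show thesis
  \<comment> \<open>A weighted coefficient sum of at most 1/16, times 4 from
    \<open>abs_sine_le_weight\<close>, costs x (1 - x)/4, half of the profile. K + 1 instead of K
    keeps the divisor positive.\<close>
  proof (rule that[of "1 / (16 * (K + 1))"])
    show "0 < 1 / (16 * (K + 1))" using K by simp
    fix h w N t x
    assume w: "\<And>k. w \<bullet> sin_l2 k = eig k powr r * (h \<bullet> sin_l2 k)" and nw: "norm w \<le> 1 / (16 * (K + 1))"
      and t: "(0::real) \<le> t" and x: "(0::real) < x" "x < 1"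
    have "(\<Sum>k<N. \<bar>h \<bullet> sin_l2 k\<bar> * freq k) = (\<Sum>k<N. \<bar>w \<bullet> sin_l2 k\<bar> * \<bar>freq k powr (1 - 2 * r)\<bar>)"
    proof (rule sum.cong[OF refl])
      fix k
      have "\<bar>w \<bullet> sin_l2 k\<bar> * \<bar>freq k powr (1 - 2 * r)\<bar>
        = \<bar>h \<bullet> sin_l2 k\<bar> * (freq k powr (2 * r) * freq k powr (1 - 2 * r))"
        by (simp add: w eigf powr_powr abs_mult)
      also have "\<dots> = \<bar>h \<bullet> sin_l2 k\<bar> * freq k"
        using freq[of k] by (simp add: powr_add[symmetric])
      finally show "\<bar>h \<bullet> sin_l2 k\<bar> * freq k = \<bar>w \<bullet> sin_l2 k\<bar> * \<bar>freq k powr (1 - 2 * r)\<bar>" by simp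
    qed
    also have "\<dots> \<le> L2_set (\<lambda>k. w \<bullet> sin_l2 k) {..<N} * L2_set (\<lambda>k. freq k powr (1 - 2 * r)) {..<N}"
      by (rule L2_set_mult_ineq)
    also have "\<dots> \<le> norm w * K"
    proof (rule mult_mono)
      have "(\<Sum>k<N. (w \<bullet> sin_l2 k)\<^sup>2) \<le> (norm w)\<^sup>2"
        using sum_le_suminf[OF sums_summable[OF sine_Parseval[of w]], of "{..<N}"] sums_unique[OF sine_Parseval[of w]]
        by simp
      then show "L2_set (\<lambda>k. w \<bullet> sin_l2 k) {..<N} \<le> norm w"
        unfolding L2_set_def by (rule real_le_lsqrt[rotated -1]) auto
      have "(freq k powr (1 - 2 * r))\<^sup>2 = freq k powr (2 - 4 * r)" for k
        by (simp add: power2_eq_square powr_add[symmetric])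
      then show "L2_set (\<lambda>k. freq k powr (1 - 2 * r)) {..<N} \<le> K"
        unfolding L2_set_def K_def using sum_le_suminf[OF sm, of "{..<N}"] by simp
    qed (auto simp: L2_set_nonneg)
    also have "\<dots> \<le> 1 / (16 * (K + 1)) * K" using nw K by (intro mult_right_mono)
    also have "\<dots> \<le> 1 / 16" using K by (simp add: field_simps)
    finally have hsum: "(\<Sum>k<N. \<bar>h \<bullet> sin_l2 k\<bar> * freq k) \<le> 1 / 16" .
    have "\<bar>\<Sum>k<N. (exp (- eig k * t) * (h \<bullet> sin_l2 k)) * sine k x\<bar>
      \<le> (\<Sum>k<N. \<bar>(exp (- eig k * t) * (h \<bullet> sin_l2 k)) * sine k x\<bar>)" by (rule sum_abs)
    also have "\<dots> \<le> (\<Sum>k<N. (\<bar>h \<bullet> sin_l2 k\<bar> * freq k) * (4 * (x * (1 - x))))"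
    proof (rule sum_mono)
      fix k
      have "exp (- eig k * t) \<le> 1" using t by (simp add: mult_nonneg_nonneg less_imp_le)
      then have "\<bar>(exp (- eig k * t) * (h \<bullet> sin_l2 k)) * sine k x\<bar> \<le> (1 * \<bar>h \<bullet> sin_l2 k\<bar>) * (4 * freq k * (x * (1 - x)))"
        unfolding abs_mult using abs_sine_le_weight[OF x, of k] by (intro mult_mono) (auto simp: freq_def)
      then show "\<bar>(exp (- eig k * t) * (h \<bullet> sin_l2 k)) * sine k x\<bar> \<le> (\<bar>h \<bullet> sin_l2 k\<bar> * freq k) * (4 * (x * (1 - x)))"
        by (simp add: mult_ac)
    qed
    also have "\<dots> = (\<Sum>k<N. \<bar>h \<bullet> sin_l2 k\<bar> * freq k) * (4 * (x * (1 - x)))" by (rule sum_distrib_right[symmetric])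
    also have "\<dots> \<le> 1 / 16 * (4 * (x * (1 - x)))" using hsum x by (intro mult_right_mono) auto
    finally have "\<bar>\<Sum>k<N. (exp (- eig k * t) * (h \<bullet> sin_l2 k)) * sine k x\<bar> \<le> x * (1 - x) / 4" by simp
    moreover have "profile x = x * (1 - x) / 2" by (simp add: profile_def power2_eq_square algebra_simps)
    ultimately show "x * (1 - x) / 4 \<le> heat_sum h N t x" unfolding heat_sum_def by linarith
  qed
qed

lemma heat_l2_has_vector_derivative:
  "(heat_l2 h N has_vector_derivative - (\<Sum>k<N. (exp (- eig k * t) * (h \<bullet> sin_l2 k) * eig k) *\<^sub>R sin_l2 k)) (at t)"
proof -
  have "((\<lambda>t. exp (- eig k * t) * (h \<bullet> sin_l2 k)) has_real_derivative - (exp (- eig k * t) * (h \<bullet> sin_l2 k) * eig k)) (at t)" for k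
    by (auto intro!: derivative_eq_intros)
  then have "((\<lambda>t. (exp (- eig k * t) * (h \<bullet> sin_l2 k)) *\<^sub>R sin_l2 k) has_vector_derivative
      - (exp (- eig k * t) * (h \<bullet> sin_l2 k) * eig k) *\<^sub>R sin_l2 k) (at t)" for k
    using has_vector_derivative_scaleR[OF _ has_vector_derivative_const] by fastforce
  then have "((\<lambda>t. \<Sum>k<N. (exp (- eig k * t) * (h \<bullet> sin_l2 k)) *\<^sub>R sin_l2 k) has_vector_derivative
      (\<Sum>k<N. - (exp (- eig k * t) * (h \<bullet> sin_l2 k) * eig k) *\<^sub>R sin_l2 k)) (at t)"
    by (intro has_vector_derivative_sum)
  from has_vector_derivative_add[OF has_vector_derivative_const[of v1_plus] this]
  show ?thesis by (simp add: heat_l2_def[abs_def] sum_negf)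
qed

lemma A_H_heat_l2:
  "A_H (heat_l2 h N t) (one_l2 + (\<Sum>k<N. (exp (- eig k * t) * (h \<bullet> sin_l2 k) * eig k) *\<^sub>R sin_l2 k))"
  unfolding heat_l2_def
proof (intro A_H_add A_H_v1_plus A_H_sum)
  show "A_H ((exp (- eig k * t) * (h \<bullet> sin_l2 k)) *\<^sub>R sin_l2 k) ((exp (- eig k * t) * (h \<bullet> sin_l2 k) * eig k) *\<^sub>R sin_l2 k)" for k
    using A_H_scale[OF A_H_sin_l2[of k], of "exp (- eig k * t) * (h \<bullet> sin_l2 k)"] by simp
qed

text \<open>\<open>abs_cont_nonincreasing\<close> is applied with absolute continuity of the
  solution alone; the variation of the linear flow goes into its summand
  \<open>y - x\<close>.\<close>

lemma heat_l2_Lipschitz: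
  obtains L where "0 \<le> L"
    "\<And>x y. 0 \<le> x \<Longrightarrow> x \<le> y \<Longrightarrow> norm (heat_l2 h N x - heat_l2 h N y) \<le> L * (y - x)"
proof -
  have "norm (heat_l2 h N x - heat_l2 h N y) \<le> (\<Sum>k<N. \<bar>h \<bullet> sin_l2 k\<bar> * eig k) * (y - x)"
    if xy: "0 \<le> x" "x \<le> y" for x y
  proof -
    have "heat_l2 h N x - heat_l2 h N y
      = (\<Sum>k<N. ((exp (- eig k * x) - exp (- eig k * y)) * (h \<bullet> sin_l2 k)) *\<^sub>R sin_l2 k)"
      by (simp add: heat_l2_def sum_subtractf[symmetric] scaleR_diff_left[symmetric] left_diff_distrib)
    also have "norm \<dots> \<le> (\<Sum>k<N. norm (((exp (- eig k * x) - exp (- eig k * y)) * (h \<bullet> sin_l2 k)) *\<^sub>R sin_l2 k))"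
      by (rule norm_sum)
    also have "\<dots> \<le> (\<Sum>k<N. (\<bar>h \<bullet> sin_l2 k\<bar> * eig k) * (y - x))"
    proof (rule sum_mono)
      fix k
      have nS: "norm (sin_l2 k) = 1" by (simp add: norm_eq_sqrt_inner inner_sin_l2)
      have "exp (- eig k * x) - exp (- eig k * y) = exp (- eig k * x) * (1 - exp (- (eig k * (y - x))))"
        by (simp add: right_diff_distrib exp_add[symmetric] algebra_simps)
      moreover have "\<bar>exp (- eig k * x) * (1 - exp (- (eig k * (y - x))))\<bar> \<le> 1 * (eig k * (y - x))"
      proof -
        have "0 \<le> eig k * (y - x)" "0 \<le> eig k * x"
          using xy eig_pos[of k] by (simp_all del: eig_pos)
        moreover have "1 + - (eig k * (y - x)) \<le> exp (- (eig k * (y - x)))" by (rule exp_ge_add_one_self)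
        ultimately show ?thesis unfolding abs_mult by (intro mult_mono) auto
      qed
      ultimately have "\<bar>exp (- eig k * x) - exp (- eig k * y)\<bar> * \<bar>h \<bullet> sin_l2 k\<bar> \<le> (1 * (eig k * (y - x))) * \<bar>h \<bullet> sin_l2 k\<bar>"
        by (intro mult_right_mono) auto
      then show "norm (((exp (- eig k * x) - exp (- eig k * y)) * (h \<bullet> sin_l2 k)) *\<^sub>R sin_l2 k) \<le> (\<bar>h \<bullet> sin_l2 k\<bar> * eig k) * (y - x)"
        by (simp add: nS abs_mult mult_ac)
    qed
    also have "\<dots> = (\<Sum>k<N. \<bar>h \<bullet> sin_l2 k\<bar> * eig k) * (y - x)" by (rule sum_distrib_right[symmetric])
    finally show ?thesis .
  qed
  then show thesis by (intro that[of "\<Sum>k<N. \<bar>h \<bullet> sin_l2 k\<bar> * eig k"] sum_nonneg) (simp_all add: less_imp_le)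
qed

section \<open>Solutions close to the fixed points\<close>


text \<open>Merges the almost-everywhere conditions into one exceptional set and forgets the time
  dependence of \<open>g\<close>, which the energy argument uses at a single time only.\<close>

lemma strong_solution_ae:
  assumes "strong_solution u0 u"
  obtains N where "negligible N" "\<And>t. 0 < t \<Longrightarrow> t \<notin> N \<Longrightarrow> \<exists>u' f g.
    (u has_vector_derivative u') (at t) \<and> A_H (u t) f \<and> u' + f = g \<and>
    (AE x in unit_leb. rep_l2 g x \<in> H0 (rep_l2 (u t) x))"
proof -
  from assms obtain g where
    g: "AE t in lebesgue_on {0<..}. AE x in unit_leb. rep_l2 (g t) x \<in> H0 (rep_l2 (u t) x)"
      "AE t in lebesgue_on {0<..}. \<exists>u' f. (u has_vector_derivative u') (at t) \<and> A_H (u t) f \<and> u' + f = g t"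
    unfolding strong_solution_def by blast
  let ?P = "\<lambda>t. (\<exists>u' f g. (u has_vector_derivative u') (at t) \<and> A_H (u t) f \<and> u' + f = g \<and>
    (AE x in unit_leb. rep_l2 g x \<in> H0 (rep_l2 (u t) x)))"
  from g have "AE t in lebesgue_on {0<..}. ?P t"
    by eventually_elim blast
  then have "AE t in lebesgue. t \<in> {0<..} \<longrightarrow> ?P t"
    by (subst (asm) AE_restrict_space_iff) auto
  then obtain N where "N \<in> null_sets lebesgue" "{t \<in> space lebesgue. \<not> (t \<in> {0<..} \<longrightarrow> ?P t)} \<subseteq> N"
    unfolding eventually_ae_filter by blast
  then show thesis
    by (intro that[of N]) (auto simp: negligible_iff_null_sets)
qed

text \<open>Gronwall in the form that exp(-1024 t) times the squared distance is nonincreasing. The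
  rate is twice the constant 512 of \<open>reaction_energy_bound\<close>, the 2 coming from
  differentiating the square.\<close>

lemma distance_to_heat_sum:
  assumes sol: "strong_solution (u 0) u"
    and lower: "\<And>t x. 0 \<le> t \<Longrightarrow> 0 < x \<Longrightarrow> x < 1 \<Longrightarrow> x * (1 - x) / 4 \<le> heat_sum h N t x"
    and T: "0 \<le> T"
  shows "exp (- 1024 * T) * (norm (u T - heat_l2 h N T))\<^sup>2 \<le> (norm (u 0 - heat_l2 h N 0))\<^sup>2"
proof -
  define z where "z t = u t - heat_l2 h N t" for t
  define F where "F t = exp (- 1024 * t) * (norm (z t))\<^sup>2" for t
  have cu: "continuous_on {0..} u" and AC: "\<And>a b. 0 < a \<Longrightarrow> a < b \<Longrightarrow> abs_cont_on {a..b} u"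
    using sol unfolding strong_solution_def by blast+
  have "continuous_on {0..} (heat_l2 h N)"
    unfolding heat_l2_def[abs_def] by (intro continuous_intros)
  then have cz: "continuous_on {0..} z" unfolding z_def by (intro continuous_intros cu)
  then have cF: "continuous_on {0..} F" unfolding F_def by (intro continuous_intros)
  obtain Bad where Bad: "negligible Bad" and good: "\<And>t. 0 < t \<Longrightarrow> t \<notin> Bad \<Longrightarrow> \<exists>u' f g.
    (u has_vector_derivative u') (at t) \<and> A_H (u t) f \<and> u' + f = g \<and>
    (AE x in unit_leb. rep_l2 g x \<in> H0 (rep_l2 (u t) x))"
    using sol by (rule strong_solution_ae) (rule that)
  have D: "\<exists>D\<le>0. (F has_field_derivative D) (at t)" if t: "0 < t" "t \<notin> Bad" for t
  proof -
    obtain u' f g where du: "(u has_vector_derivative u') (at t)" and A: "A_H (u t) f" and eq: "u' + f = g"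
      and g: "AE x in unit_leb. rep_l2 g x \<in> H0 (rep_l2 (u t) x)"
      using good[OF t] by blast
    define q where "q = (\<Sum>k<N. (exp (- eig k * t) * (h \<bullet> sin_l2 k) * eig k) *\<^sub>R sin_l2 k)"
    have dz: "(z has_vector_derivative (u' + q)) (at t)"
      using has_vector_derivative_diff[OF du heat_l2_has_vector_derivative[of h N t]]
      by (simp add: z_def[abs_def] q_def)
    have Az: "A_H (z t) (f - (one_l2 + q))"
      unfolding z_def q_def by (intro A_H_diff A A_H_heat_l2)
    define G where "G = g - one_l2"
    have "AE x in unit_leb. rep_l2 one_l2 x = 1"
      unfolding one_l2_def by (rule rep_abs_l2) (rule sq_int_const)
    moreover have "AE x in unit_leb. rep_l2 (heat_l2 h N t) x = heat_sum h N t x"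
      unfolding heat_l2_eq(2) by (rule rep_abs_l2) (rule heat_l2_eq(1))
    moreover note g rep_l2_diff[of g one_l2] rep_l2_diff[of "u t" "heat_l2 h N t"] AE_space
    ultimately have "AE x in unit_leb. rep_l2 G x * rep_l2 (z t) x \<le> 2 * \<bar>rep_l2 (z t) x\<bar> \<and>
      (x * (1 - x) / 4 \<le> \<bar>rep_l2 (z t) x\<bar> \<or> rep_l2 G x * rep_l2 (z t) x \<le> 0)"
    proof eventually_elim
      case (elim x)
      then have Gx: "rep_l2 G x = rep_l2 g x - 1"
        and zx: "rep_l2 (z t) x = rep_l2 (u t) x - heat_sum h N t x"
        by (simp_all add: G_def z_def)
      have low: "x * (1 - x) / 4 \<le> heat_sum h N t x" using lower[of t x] t elim by simp
      have pos: "0 < x * (1 - x)" using elim by simp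
      show ?case
      proof (cases "0 < rep_l2 (u t) x")
        case True
        then have "rep_l2 G x = 0" using elim by (simp add: H0_def Gx)
        then show ?thesis by simp
      next
        case False
        then have z1: "x * (1 - x) / 4 \<le> \<bar>rep_l2 (z t) x\<bar>" using low pos zx by linarith
        have "\<bar>rep_l2 G x\<bar> \<le> 2" using elim False by (auto simp: H0_def Gx split: if_splits)
        then have "\<bar>rep_l2 G x\<bar> * \<bar>rep_l2 (z t) x\<bar> \<le> 2 * \<bar>rep_l2 (z t) x\<bar>" by (intro mult_right_mono) auto
        then have "rep_l2 G x * rep_l2 (z t) x \<le> 2 * \<bar>rep_l2 (z t) x\<bar>"
          using abs_ge_self[of "rep_l2 G x * rep_l2 (z t) x"] by (simp add: abs_mult)
        with z1 show ?thesis by blast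
      qed
    qed
    from reaction_energy_bound[OF Az this]
    have energy: "G \<bullet> z t \<le> (f - (one_l2 + q)) \<bullet> z t + 512 * (norm (z t))\<^sup>2" .
    have "u' + q = G - (f - (one_l2 + q))" using eq by (simp add: G_def algebra_simps)
    then have "(u' + q) \<bullet> z t = G \<bullet> z t - (f - (one_l2 + q)) \<bullet> z t"
      by (simp only: inner_diff_left[of G])
    then have e2: "(u' + q) \<bullet> z t \<le> 512 * (norm (z t))\<^sup>2"
      using energy by linarith
    have "((\<lambda>s. z s \<bullet> z s) has_derivative (\<lambda>s. z t \<bullet> (s *\<^sub>R (u' + q)) + (s *\<^sub>R (u' + q)) \<bullet> z t)) (at t)"
      using dz unfolding has_vector_derivative_def by (intro has_derivative_inner)
    then have "((\<lambda>s. (norm (z s))\<^sup>2) has_field_derivative 2 * ((u' + q) \<bullet> z t)) (at t)"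
      unfolding has_field_derivative_def power2_norm_eq_inner
      by (rule has_derivative_eq_rhs) (auto simp: inner_commute algebra_simps)
    moreover have "((\<lambda>s. exp (- 1024 * s)) has_field_derivative exp (- 1024 * t) * (- 1024)) (at t)"
      by (auto intro!: derivative_eq_intros)
    ultimately have dF: "(F has_field_derivative
        exp (- 1024 * t) * (- 1024) * (norm (z t))\<^sup>2 + 2 * ((u' + q) \<bullet> z t) * exp (- 1024 * t)) (at t)"
      unfolding F_def by (rule DERIV_mult[rotated])
    have "exp (- 1024 * t) * (- 1024) * (norm (z t))\<^sup>2 + 2 * ((u' + q) \<bullet> z t) * exp (- 1024 * t)
      = exp (- 1024 * t) * (2 * ((u' + q) \<bullet> z t - 512 * (norm (z t))\<^sup>2))" by (simp add: algebra_simps)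
    also have "\<dots> \<le> 0" using e2 by (intro mult_nonneg_nonpos) auto
    finally show ?thesis using dF by blast
  qed
  have mono: "F b \<le> F a" if ab: "0 < a" "a < b" for a b
  proof -
    obtain L where L: "0 \<le> L"
      "\<And>x y. 0 \<le> x \<Longrightarrow> x \<le> y \<Longrightarrow> norm (heat_l2 h N x - heat_l2 h N y) \<le> L * (y - x)"
      by (rule heat_l2_Lipschitz[of h N]) (rule that)
    have "continuous_on {a..b} z" using cz by (rule continuous_on_subset) (use ab in auto)
    then obtain M where M: "\<And>t. t \<in> {a..b} \<Longrightarrow> norm (z t) \<le> M"
      using compact_imp_bounded[OF compact_continuous_image[of "{a..b}" z]] by (force simp: bounded_iff)
    have M0: "0 \<le> M" using M[of a] ab order_trans[OF norm_ge_zero, of "z a" M] by simp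
    show ?thesis
    \<comment> \<open>The difference of the squared norms contributes 2 M; the factor 1 + L takes in
      the Lipschitz constant of the linear flow.\<close>
    proof (rule abs_cont_nonincreasing[where F = F and a = a and b = b and K = "2 * M * (1 + L)" and U = u and N = Bad])
      show "a \<le> b" "0 \<le> 2 * M * (1 + L)" using ab M0 L(1) by auto
      show "abs_cont_on {a..b} u" using AC ab by blast
      show "negligible Bad" by (rule Bad)
      show "\<exists>D\<le>0. (F has_field_derivative D) (at t)" if "t \<in> {a..b} - Bad" for t
        using that ab by (intro D) auto
      fix x y assume xy: "a \<le> x" "x \<le> y" "y \<le> b"
      have "z y - z x = (u y - u x) + (heat_l2 h N x - heat_l2 h N y)" by (simp add: z_def)
      then have "norm (z y - z x) \<le> norm (u y - u x) + norm (heat_l2 h N x - heat_l2 h N y)"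
        by (metis norm_triangle_ineq)
      then have n1: "norm (z y - z x) \<le> dist (u x) (u y) + L * (y - x)"
        using L(2)[of x y] xy ab by (simp add: dist_norm norm_minus_commute)
      \<comment> \<open>Replacing the weight at y by the larger one at x is harmless, since only an
        upper bound on the increment is required.\<close>
      have "F y \<le> exp (- 1024 * x) * (norm (z y))\<^sup>2"
        unfolding F_def using xy by (intro mult_right_mono) auto
      then have "F y - F x \<le> exp (- 1024 * x) * ((norm (z y))\<^sup>2 - (norm (z x))\<^sup>2)"
        unfolding F_def by (simp add: right_diff_distrib)
      also have "\<dots> \<le> exp (- 1024 * x) * \<bar>(norm (z y))\<^sup>2 - (norm (z x))\<^sup>2\<bar>"
        by (intro mult_left_mono) auto
      also have "\<dots> \<le> 1 * \<bar>(norm (z y))\<^sup>2 - (norm (z x))\<^sup>2\<bar>"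
        using xy ab by (intro mult_right_mono) auto
      also have "\<dots> = \<bar>norm (z y) - norm (z x)\<bar> * (norm (z y) + norm (z x))"
        by (simp add: power2_eq_square square_diff_square_factored abs_mult)
      also have "\<dots> \<le> norm (z y - z x) * (M + M)"
        using M[of x] M[of y] xy by (intro mult_mono norm_triangle_ineq3 add_mono) auto
      also have "\<dots> \<le> (dist (u x) (u y) + L * (y - x)) * (M + M)"
        using n1 M0 by (intro mult_right_mono) auto
      also have "\<dots> \<le> ((1 + L) * (dist (u x) (u y) + (y - x))) * (M + M)"
        using xy mult_nonneg_nonneg[OF L(1) zero_le_dist[of "u x" "u y"]] M0
        by (intro mult_right_mono) (simp_all add: algebra_simps)
      finally show "F y - F x \<le> 2 * M * (1 + L) * (dist (u x) (u y) + (y - x))"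
        by (simp add: algebra_simps)
    qed
  qed
  \<comment> \<open>Absolute continuity is given on compact subintervals of the open half-line only;
    time 0 is reached by continuity.\<close>
  have "F T \<le> F 0"
  proof (cases "T = 0")
    case False
    then have T0: "0 < T" using T by simp
    \<comment> \<open>The double successor makes s 0 = T/2, strictly below T as \<open>mono\<close>
      demands.\<close>
    define s where "s n = T * inverse (real (Suc (Suc n)))" for n
    have s: "0 < s n" "s n < T" for n
    proof -
      have "inverse (real (Suc (Suc n))) < 1" by (simp add: inverse_less_1_iff)
      then have "s n < T * 1" unfolding s_def using T0 by (intro mult_strict_left_mono)
      then show "0 < s n" "s n < T" using T0 by (simp_all add: s_def)
    qed
    have "s \<longlonglongrightarrow> T * 0"
      unfolding s_def by (intro tendsto_intros LIMSEQ_Suc[OF LIMSEQ_inverse_real_of_nat])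
    then have "(\<lambda>n. F (s n)) \<longlonglongrightarrow> F 0"
      using s by (intro continuous_on_tendsto_compose[OF cF]) (auto simp: less_imp_le)
    then show ?thesis
      by (rule LIMSEQ_le_const) (use mono s in blast)
  qed simp
  then show ?thesis by (simp add: F_def z_def)
qed

text \<open>At fixed t the Gronwall factor does not depend on N while the initial error tends to 0,
  so the truncated flows converge to u t. Their k-th coefficient is constant once N > k. In
  particular every solution from this datum has these coefficients.\<close>

lemma solution_coefficients:
  assumes sol: "strong_solution (u 0) u"
    and lower: "\<And>N t x. 0 \<le> t \<Longrightarrow> 0 < x \<Longrightarrow> x < 1 \<Longrightarrow> x * (1 - x) / 4 \<le> heat_sum (u 0 - v1_plus) N t x"
    and t: "0 \<le> t"
  shows "(u t - v1_plus) \<bullet> sin_l2 k = exp (- eig k * t) * ((u 0 - v1_plus) \<bullet> sin_l2 k)"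
proof -
  let ?h = "u 0 - v1_plus"
  have "(\<lambda>N. v1_plus + (\<Sum>k<N. (?h \<bullet> sin_l2 k) *\<^sub>R sin_l2 k)) \<longlonglongrightarrow> v1_plus + ?h"
    using sine_expansion[of ?h] unfolding sums_def by (intro tendsto_intros)
  then have "(\<lambda>N. heat_l2 ?h N 0) \<longlonglongrightarrow> u 0" by (simp add: heat_l2_def)
  then have "(\<lambda>N. (norm (u 0 - heat_l2 ?h N 0))\<^sup>2) \<longlonglongrightarrow> (norm (u 0 - u 0))\<^sup>2"
    by (intro tendsto_intros)
  then have "(\<lambda>N. exp (1024 * t) * (norm (u 0 - heat_l2 ?h N 0))\<^sup>2) \<longlonglongrightarrow> exp (1024 * t) * (norm (u 0 - u 0))\<^sup>2"
    by (rule tendsto_mult[OF tendsto_const])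
  then have r0: "(\<lambda>N. exp (1024 * t) * (norm (u 0 - heat_l2 ?h N 0))\<^sup>2) \<longlonglongrightarrow> 0" by simp
  have "(norm (u t - heat_l2 ?h N t))\<^sup>2 \<le> exp (1024 * t) * (norm (u 0 - heat_l2 ?h N 0))\<^sup>2" for N
    using distance_to_heat_sum[OF sol lower t, of N] by (simp add: exp_minus field_simps)
  then have "(\<lambda>N. (norm (u t - heat_l2 ?h N t))\<^sup>2) \<longlonglongrightarrow> 0"
    by (intro tendsto_0_le[OF r0, of _ 1]) (auto intro!: always_eventually)
  then have "(\<lambda>N. sqrt ((norm (u t - heat_l2 ?h N t))\<^sup>2)) \<longlonglongrightarrow> sqrt 0" by (rule tendsto_real_sqrt)
  then have "(\<lambda>N. u t - heat_l2 ?h N t) \<longlonglongrightarrow> 0" by (simp add: tendsto_norm_zero_iff)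
  then have "(\<lambda>N. (u t - heat_l2 ?h N t) \<bullet> sin_l2 k) \<longlonglongrightarrow> 0 \<bullet> sin_l2 k" by (intro tendsto_intros)
  moreover have "\<forall>\<^sub>F N in sequentially. (u t - heat_l2 ?h N t) \<bullet> sin_l2 k
      = (u t - v1_plus) \<bullet> sin_l2 k - exp (- eig k * t) * (?h \<bullet> sin_l2 k)"
    using eventually_gt_at_top[of k]
  proof eventually_elim
    case (elim N)
    have "(\<Sum>j<N. (exp (- eig j * t) * (?h \<bullet> sin_l2 j)) *\<^sub>R sin_l2 j) \<bullet> sin_l2 k
      = (\<Sum>j<N. if j = k then exp (- eig k * t) * (?h \<bullet> sin_l2 k) else 0)"
      unfolding inner_sum_left by (intro sum.cong) (auto simp: inner_sin_l2)
    also have "\<dots> = exp (- eig k * t) * (?h \<bullet> sin_l2 k)" using elim by simp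
    finally show ?case
      unfolding heat_l2_def by (simp only: inner_diff_left inner_add_left diff_diff_eq)
  qed
  then have "(\<lambda>N. (u t - heat_l2 ?h N t) \<bullet> sin_l2 k) \<longlonglongrightarrow> (u t - v1_plus) \<bullet> sin_l2 k - exp (- eig k * t) * (?h \<bullet> sin_l2 k)"
    by (rule tendsto_eventually)
  ultimately have "0 \<bullet> sin_l2 k = (u t - v1_plus) \<bullet> sin_l2 k - exp (- eig k * t) * (?h \<bullet> sin_l2 k)"
    by (rule LIMSEQ_unique)
  then show ?thesis by simp
qed

text \<open>Membership needs an element with coefficients exp(-eig k t) w_k. For t > 0 the bound
  exp(-s) <= 1/s makes them absolutely summable, and for t = 0 it is \<open>w\<close>. By Parseval
  the smallest eigenvalue gives the decay rate.\<close>

lemma heat_decay_in_V: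
  assumes w: "\<And>k. w \<bullet> sin_l2 k = eig k powr r * (h \<bullet> sin_l2 k)" and t: "0 \<le> t"
    and p: "\<And>k. p \<bullet> sin_l2 k = exp (- eig k * t) * (h \<bullet> sin_l2 k)"
  shows "p \<in> V_H r" "V_norm r p \<le> exp (- eig 0 * t) * norm w"
proof -
  obtain q where q: "\<And>k. q \<bullet> sin_l2 k = exp (- eig k * t) * (w \<bullet> sin_l2 k)"
  proof (cases "t = 0")
    case True
    then show thesis by (intro that[of w]) simp
  next
    case False
    then have t0: "0 < t" using t by simp
    have bound: "norm \<bar>exp (- eig k * t) * (w \<bullet> sin_l2 k)\<bar> \<le> (norm w / t) * (real (Suc k) * pi) powr (- 2)" for k
    proof -
      have e: "0 < eig k * t" using t0 by simp
      have "eig k * t \<le> exp (eig k * t)" using exp_ge_add_one_self[of "eig k * t"] by linarith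
      then have "exp (- eig k * t) \<le> 1 / (eig k * t)"
        using e by (simp add: exp_minus inverse_eq_divide frac_le)
      moreover have "norm (sin_l2 k) = 1" by (simp add: norm_eq_sqrt_inner inner_sin_l2)
      then have "\<bar>w \<bullet> sin_l2 k\<bar> \<le> norm w" using Cauchy_Schwarz_ineq2[of w "sin_l2 k"] by simp
      ultimately have "exp (- eig k * t) * \<bar>w \<bullet> sin_l2 k\<bar> \<le> 1 / (eig k * t) * norm w"
        using e by (intro mult_mono) auto
      also have "\<dots> = (norm w / t) * (real (Suc k) * pi) powr (- 2)"
        by (simp add: eig_eq_powr powr_minus divide_inverse del: powr_numeral)
      finally show ?thesis by (simp add: abs_mult)
    qed
    have "summable (\<lambda>k. (norm w / t) * (real (Suc k) * pi) powr (- 2))"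
      by (intro summable_mult summable_freq_powr) simp
    then have "summable (\<lambda>k. \<bar>exp (- eig k * t) * (w \<bullet> sin_l2 k)\<bar>)"
      by (rule summable_comparison_test'[where N = 0]) (rule bound)
    then show thesis
      by (rule summable_coefficients[where c = "\<lambda>k. exp (- eig k * t) * (w \<bullet> sin_l2 k)"]) (rule that)
  qed
  have qp: "q \<bullet> sin_l2 k = eig k powr r * (p \<bullet> sin_l2 k)" for k
    by (simp add: q p w mult_ac)
  show "p \<in> V_H r" unfolding V_H_iff using qp by blast
  have "(norm q)\<^sup>2 \<le> (exp (- eig 0 * t))\<^sup>2 * (norm w)\<^sup>2"
  proof (rule sums_le[OF _ sine_Parseval sums_mult[OF sine_Parseval]])
    fix k
    have "eig 0 \<le> eig k" unfolding eig_def by (intro power_mono mult_right_mono) auto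
    then have "exp (- eig k * t) \<le> exp (- eig 0 * t)" using t by (simp add: mult_right_mono)
    then have "(exp (- eig k * t))\<^sup>2 \<le> (exp (- eig 0 * t))\<^sup>2" by (intro power_mono) auto
    then show "(q \<bullet> sin_l2 k)\<^sup>2 \<le> (exp (- eig 0 * t))\<^sup>2 * (w \<bullet> sin_l2 k)\<^sup>2"
      unfolding q power_mult_distrib by (intro mult_right_mono) auto
  qed
  then have "(norm q)\<^sup>2 \<le> (exp (- eig 0 * t) * norm w)\<^sup>2" by (simp add: power_mult_distrib)
  then have "norm q \<le> exp (- eig 0 * t) * norm w" by (rule power2_le_imp_le) simp
  then show "V_norm r p \<le> exp (- eig 0 * t) * norm w" by (simp add: V_norm_eq[OF qp])
qed

section \<open>Stability of the two fixed points\<close>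

lemma V_norm_nonneg: "0 \<le> V_norm r u"
  by (simp add: V_norm_def)

lemma asymp_stable_v1_plus:
  assumes r: "3 / 4 < r" "r < 1" shows "asymp_stable_in_V r v1_plus"
proof (rule heat_sum_lower_bound[OF r(1)])
  fix \<gamma> :: real
  assume \<gamma>: "0 < \<gamma>" and low: "\<And>h w N t x. \<lbrakk>\<And>k. w \<bullet> sin_l2 k = eig k powr r * (h \<bullet> sin_l2 k); norm w \<le> \<gamma>; 0 \<le> t;
      0 < x; x < 1\<rbrakk> \<Longrightarrow> x * (1 - x) / 4 \<le> heat_sum h N t x"
  have decay: "u t - v1_plus \<in> V_H r \<and> V_norm r (u t - v1_plus) \<le> exp (- eig 0 * t) * V_norm r (u 0 - v1_plus)"
    if sol: "strong_solution (u 0) u" and u0: "u 0 \<in> V_H r" "V_norm r (u 0 - v1_plus) \<le> \<gamma>" and t: "0 \<le> t" for u t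
  proof -
    have "u 0 - v1_plus \<in> V_H r" by (intro V_H_diff u0 v1_plus_in_V_H r)
    then obtain w where w: "\<And>k. w \<bullet> sin_l2 k = eig k powr r * ((u 0 - v1_plus) \<bullet> sin_l2 k)"
      unfolding V_H_iff by blast
    have nw: "V_norm r (u 0 - v1_plus) = norm w" by (rule V_norm_eq[OF w])
    have c: "(u t - v1_plus) \<bullet> sin_l2 k = exp (- eig k * t) * ((u 0 - v1_plus) \<bullet> sin_l2 k)" for k
      using sol low[OF w] nw u0(2) t by (intro solution_coefficients) auto
    show ?thesis using heat_decay_in_V[OF w t c] nw by simp
  qed
  have stable: "stable_in_V r v1_plus"
    unfolding stable_in_V_def
  proof (intro conjI allI impI fixed_point_v1_plus v1_plus_in_V_H r)
    fix \<epsilon> :: real assume \<epsilon>: "0 < \<epsilon>"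
    show "\<exists>\<gamma>>0. \<forall>u. strong_solution (u 0) u \<and> u 0 \<in> V_H r \<and> V_norm r (u 0 - v1_plus) \<le> \<gamma> \<longrightarrow>
      (\<forall>t\<ge>0. u t - v1_plus \<in> V_H r \<and> V_norm r (u t - v1_plus) \<le> \<epsilon>)"
    \<comment> \<open>\<open>\<gamma>\<close> makes the decay estimate applicable;
      \<open>\<epsilon>\<close> then suffices because the V-norm of the deviation never exceeds its
      initial value.\<close>
    proof (intro exI[of _ "min \<gamma> \<epsilon>"] conjI allI impI)
      show "0 < min \<gamma> \<epsilon>" using \<gamma> \<epsilon> by simp
      fix u t assume u: "strong_solution (u 0) u \<and> u 0 \<in> V_H r \<and> V_norm r (u 0 - v1_plus) \<le> min \<gamma> \<epsilon>"
        and t: "(0::real) \<le> t"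
      then have d: "u t - v1_plus \<in> V_H r"
        "V_norm r (u t - v1_plus) \<le> exp (- eig 0 * t) * V_norm r (u 0 - v1_plus)"
        using decay[of u t] by auto
      show "u t - v1_plus \<in> V_H r" by (rule d)
      have "exp (- eig 0 * t) * V_norm r (u 0 - v1_plus) \<le> 1 * \<epsilon>"
        using u t by (intro mult_mono V_norm_nonneg) (auto simp: less_imp_le)
      then show "V_norm r (u t - v1_plus) \<le> \<epsilon>" using d(2) by simp
    qed
  qed
  show ?thesis
    unfolding asymp_stable_in_V_def
  proof (intro conjI stable exI[of _ \<gamma>] allI impI \<gamma>)
    fix u assume u: "strong_solution (u 0) u \<and> u 0 \<in> V_H r \<and> V_norm r (u 0 - v1_plus) \<le> \<gamma>"
    show "u t - v1_plus \<in> V_H r" if "0 \<le> t" for t using decay[of u t] u that by auto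
    have "filterlim (\<lambda>t. eig 0 * t) at_top at_top"
      by (intro filterlim_tendsto_pos_mult_at_top[OF tendsto_const] filterlim_ident) simp
    then have "filterlim (\<lambda>t. - (eig 0 * t)) at_bot at_top"
      by (simp add: filterlim_uminus_at_bot)
    then have "((\<lambda>t. exp (- (eig 0 * t))) \<longlongrightarrow> 0) at_top"
      by (rule filterlim_compose[OF exp_at_bot])
    then have lim: "((\<lambda>t. exp (- eig 0 * t) * V_norm r (u 0 - v1_plus)) \<longlongrightarrow> 0) at_top"
      by (intro tendsto_mult_left_zero) simp
    show "((\<lambda>t. V_norm r (u t - v1_plus)) \<longlongrightarrow> 0) at_top"
    proof (rule tendsto_sandwich[OF _ _ tendsto_const lim])
      show "\<forall>\<^sub>F t in at_top. 0 \<le> V_norm r (u t - v1_plus)" by (simp add: V_norm_nonneg)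
      show "\<forall>\<^sub>F t in at_top. V_norm r (u t - v1_plus) \<le> exp (- eig 0 * t) * V_norm r (u 0 - v1_plus)"
        using eventually_ge_at_top[of 0] by eventually_elim (use decay u in blast)
    qed
  qed
qed

lemma strong_solution_uminus:
  assumes "strong_solution u0 u" shows "strong_solution (- u0) (\<lambda>t. - u t)"
proof -
  from assms obtain g where c: "continuous_on {0..} u" "u 0 = u0"
    "\<And>T1 T2. 0 < T1 \<Longrightarrow> T1 < T2 \<Longrightarrow> abs_cont_on {T1..T2} u"
    and g: "\<And>T. 0 < T \<Longrightarrow> g \<in> borel_measurable (lebesgue_on {0<..<T})"
      "\<And>T. 0 < T \<Longrightarrow> integrable (lebesgue_on {0<..<T}) (\<lambda>t. (norm (g t))\<^sup>2)"
      "AE t in lebesgue_on {0<..}. AE x in unit_leb. rep_l2 (g t) x \<in> H0 (rep_l2 (u t) x)"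
      "AE t in lebesgue_on {0<..}. \<exists>u' f. (u has_vector_derivative u') (at t) \<and> A_H (u t) f \<and> u' + f = g t"
    unfolding strong_solution_def by blast
  have eq: "AE t in lebesgue_on {0<..}. \<exists>u' f. ((\<lambda>t. - u t) has_vector_derivative u') (at t) \<and>
      A_H (- u t) f \<and> u' + f = - g t"
    using g(4)
  proof eventually_elim
    case (elim t)
    then obtain u' f where "(u has_vector_derivative u') (at t)" "A_H (u t) f" "u' + f = g t" by blast
    moreover from this have "- u' + - f = - g t" by (metis minus_add_distrib)
    ultimately show ?case
      by (blast intro: has_vector_derivative_minus A_H_uminus)
  qed
  then have dom: "AE t in lebesgue_on {0<..}. - u t \<in> H2 \<inter> H10"
    by eventually_elim (auto simp: A_H_def)
  have incl: "AE t in lebesgue_on {0<..}. AE x in unit_leb. rep_l2 (- g t) x \<in> H0 (rep_l2 (- u t) x)"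
    using g(3)
  proof eventually_elim
    case (elim t)
    then show ?case
      using rep_l2_uminus[of "g t"] rep_l2_uminus[of "u t"]
      by eventually_elim (auto simp: H0_def split: if_splits)
  qed
  have "continuous_on UNIV (uminus :: l2 \<Rightarrow> l2)" by (intro continuous_intros)
  then have meas: "(\<lambda>t. - g t) \<in> borel_measurable (lebesgue_on {0<..<T})" if "0 < T" for T
    using measurable_compose[OF g(1)[OF that] borel_measurable_continuous_onI] by blast
  have ac: "abs_cont_on {T1..T2} (\<lambda>t. - u t)" if "0 < T1" "T1 < T2" for T1 T2
    using c(3)[OF that] by (simp add: abs_cont_on_def dist_minus)
  show ?thesis
    unfolding strong_solution_def
  proof (intro conjI exI[of _ "\<lambda>t. - g t"] allI impI)
    show "continuous_on {0..} (\<lambda>t. - u t)" by (intro continuous_intros c)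
  qed (use c g eq dom incl meas ac in auto)
qed

text \<open>Negation maps solutions to solutions and preserves the V-norm, so the radii valid at
  \<open>v\<close> serve at \<open>- v\<close>.\<close>

lemma asymp_stable_uminus:
  assumes "asymp_stable_in_V r v" shows "asymp_stable_in_V r (- v)"
proof -
  from assms have fp: "fixed_point v" and v: "v \<in> V_H r"
    and st: "\<And>\<epsilon>. 0 < \<epsilon> \<Longrightarrow> \<exists>\<gamma>>0. \<forall>u. strong_solution (u 0) u \<and> u 0 \<in> V_H r \<and> V_norm r (u 0 - v) \<le> \<gamma> \<longrightarrow>
      (\<forall>t\<ge>0. u t - v \<in> V_H r \<and> V_norm r (u t - v) \<le> \<epsilon>)"
    and as: "\<exists>\<gamma>0>0. \<forall>u. strong_solution (u 0) u \<and> u 0 \<in> V_H r \<and> V_norm r (u 0 - v) \<le> \<gamma>0 \<longrightarrow>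
      (\<forall>t\<ge>0. u t - v \<in> V_H r) \<and> ((\<lambda>t. V_norm r (u t - v)) \<longlongrightarrow> 0) at_top"
    unfolding asymp_stable_in_V_def stable_in_V_def by blast+
  have diff: "- (a - (- v)) = - a - v" "- (- a - v) = a - (- v)" for a :: l2 by simp_all
  have V_iff: "- a - v \<in> V_H r \<longleftrightarrow> a - (- v) \<in> V_H r" for a
    using V_uminus(1)[of "- a - v" r] V_uminus(1)[of "a - (- v)" r] unfolding diff by blast
  \<comment> \<open>\<open>V_norm\<close> is a definite description, so its invariance under
    negation is stated on \<open>V_H r\<close>; memberships are therefore carried along with the
    norms.\<close>
  have V_eq: "V_norm r (- a - v) = V_norm r (a - (- v))" if "a - (- v) \<in> V_H r" for a
    using V_uminus(2)[OF that] unfolding diff .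
  have start: "strong_solution (- u 0) (\<lambda>t. - u t) \<and> - u 0 \<in> V_H r \<and> V_norm r (- u 0 - v) \<le> \<gamma>"
    if "strong_solution (u 0) u \<and> u 0 \<in> V_H r \<and> V_norm r (u 0 - (- v)) \<le> \<gamma>" for u \<gamma>
  proof (intro conjI)
    have u0: "u 0 \<in> V_H r" using that by blast
    show "strong_solution (- u 0) (\<lambda>t. - u t)" using that strong_solution_uminus by blast
    show "- u 0 \<in> V_H r" by (rule V_uminus(1)[OF u0])
    show "V_norm r (- u 0 - v) \<le> \<gamma>"
      unfolding V_eq[OF V_H_diff[OF u0 V_uminus(1)[OF v]]] using that by blast
  qed
  show ?thesis
    unfolding asymp_stable_in_V_def stable_in_V_def
  proof (intro conjI allI impI)
    show "fixed_point (- v)" using strong_solution_uminus[of v "\<lambda>_. v"] fp by (simp add: fixed_point_def)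
    show "- v \<in> V_H r" by (rule V_uminus[OF v])
    show "\<exists>\<gamma>>0. \<forall>u. strong_solution (u 0) u \<and> u 0 \<in> V_H r \<and> V_norm r (u 0 - (- v)) \<le> \<gamma> \<longrightarrow>
      (\<forall>t\<ge>0. u t - (- v) \<in> V_H r \<and> V_norm r (u t - (- v)) \<le> \<epsilon>)" if \<epsilon>: "0 < \<epsilon>" for \<epsilon>
    proof -
      from st[OF \<epsilon>] obtain \<gamma> where \<gamma>: "0 < \<gamma>" "\<And>u t. strong_solution (u 0) u \<and> u 0 \<in> V_H r \<and> V_norm r (u 0 - v) \<le> \<gamma> \<Longrightarrow>
        0 \<le> t \<Longrightarrow> u t - v \<in> V_H r \<and> V_norm r (u t - v) \<le> \<epsilon>" by blast
      show ?thesis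
      proof (intro exI[of _ \<gamma>] conjI allI impI \<gamma>(1))
        fix u t assume u: "strong_solution (u 0) u \<and> u 0 \<in> V_H r \<and> V_norm r (u 0 - (- v)) \<le> \<gamma>" and t: "(0::real) \<le> t"
        from \<gamma>(2)[of "\<lambda>t. - u t", OF start[OF u] t]
        have "- u t - v \<in> V_H r" and le: "V_norm r (- u t - v) \<le> \<epsilon>" by blast+
        then show mem: "u t - (- v) \<in> V_H r" unfolding V_iff by blast
        show "V_norm r (u t - (- v)) \<le> \<epsilon>" using le unfolding V_eq[OF mem] .
      qed
    qed
    from as obtain \<gamma> where \<gamma>: "0 < \<gamma>" "\<And>u. strong_solution (u 0) u \<and> u 0 \<in> V_H r \<and> V_norm r (u 0 - v) \<le> \<gamma> \<Longrightarrow>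
        (\<forall>t\<ge>0. u t - v \<in> V_H r) \<and> ((\<lambda>t. V_norm r (u t - v)) \<longlongrightarrow> 0) at_top" by blast
    show "\<exists>\<gamma>0>0. \<forall>u. strong_solution (u 0) u \<and> u 0 \<in> V_H r \<and> V_norm r (u 0 - (- v)) \<le> \<gamma>0 \<longrightarrow>
      (\<forall>t\<ge>0. u t - (- v) \<in> V_H r) \<and> ((\<lambda>t. V_norm r (u t - (- v))) \<longlongrightarrow> 0) at_top"
    proof (intro exI[of _ \<gamma>] conjI allI impI \<gamma>(1))
      fix u assume u: "strong_solution (u 0) u \<and> u 0 \<in> V_H r \<and> V_norm r (u 0 - (- v)) \<le> \<gamma>"
      from \<gamma>(2)[of "\<lambda>t. - u t", OF start[OF u]]
      have 1: "\<And>t. 0 \<le> t \<Longrightarrow> - u t - v \<in> V_H r" and 2: "((\<lambda>t. V_norm r (- u t - v)) \<longlongrightarrow> 0) at_top" by blast+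
      show mem: "u t - (- v) \<in> V_H r" if "0 \<le> t" for t using 1[OF that] V_iff by blast
      have "\<forall>\<^sub>F t in at_top. V_norm r (- u t - v) = V_norm r (u t - (- v))"
        using eventually_ge_at_top[of 0] by eventually_elim (rule V_eq[OF mem])
      then show "((\<lambda>t. V_norm r (u t - (- v))) \<longlongrightarrow> 0) at_top" by (rule Lim_transform_eventually[OF 2])
    qed
  qed
qed

theorem theorem22:
  fixes r :: real
  assumes "3 / 4 < r" and "r < 1"
  shows "asymp_stable_in_V r v1_plus \<and> asymp_stable_in_V r v1_minus"
  using asymp_stable_v1_plus[OF assms] asymp_stable_uminus[of r v1_plus]
  by (simp add: v1_minus_def)

end
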